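(* The following problem is decidable: given a finite set $\Sigma$, numbers $k,n$, and two quantifier-free interpretations $f,g:\mathsf E_k\Sigma\to\mathsf M^n1$, decide whether for every input tree $t\in\mathsf E_k\Sigma$ the output trees $f(t)$ and $g(t)$ are isomorphic.
   Context: $\mathsf E_k\Sigma$ is the class of finite unordered trees of height at most $k$ (height = maximal number of edges on a root-to-leaf path) with edges labelled by elements of the finite set $\Sigma$, in the edge representation: the universe is the set of edges; for each label $a\in\Sigma$ a unary relation selects edges with label $a$; and a unary function maps each edge to its parent edge, looping on edges leaving the root. $\mathsf M^n1$ is the class of unlabelled unordered trees of height at most $n$, represented as structures whose universe is the set of nodes with one binary parent-child relation. A quantifier-free interpretation $f:\mathcal C\to\mathcal D$ is given by a finite set $I$ of components, each $i$ with dimension $k_i\ge0$ and a quantifier-free formula $\varphi_i$ with $k_i$ free variables over the input vocabulary, such that the universe of $f(A)$ is $\coprod_{i\in I}\{\bar a\in A^{k_i}:A\models\varphi_i(\bar a)\}$, and for each $m$-ary output relation $R$ and components $i_1,\ldots,i_m$ a quantifier-free formula $\varphi$ with $k_{i_1}+\cdots+k_{i_m}$ free variables such that $f(A)\models R((i_1,\bar a_1),\ldots,(i_m,\bar a_m))$ iff $A\models\varphi(\bar a_1\cdots\bar a_m)$. The interpretations in the instance are assumed to produce outputs in $\mathsf M^n1$. *)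

theory Defs
  imports "HOL-Library.Nat_Bijection"
begin

section \<open>Partial recursive functions and decidability\<close>

text \<open>Proj is indexed from 0; PrimRec recurses on the first argument and Mu searches for the
  first argument.  Arities are not tracked: an application with a wrong number of arguments is
  either undefined or ignores the surplus ones.\<close>

datatype recf =
  Zero | Succ | Proj nat | Comp recf "recf list" | PrimRec recf recf | Mu recf

inductive rec_eval :: "recf \<Rightarrow> nat list \<Rightarrow> nat \<Rightarrow> bool" where
  Zero: "rec_eval Zero xs 0"
| Succ: "rec_eval Succ [x] (Suc x)"
| Proj: "i < length xs \<Longrightarrow> rec_eval (Proj i) xs (xs ! i)"
| Comp: "list_all2 (\<lambda>g y. rec_eval g xs y) gs ys \<Longrightarrow> rec_eval f ys z \<Longrightarrow> rec_eval (Comp f gs) xs z"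
| PrimRec_0: "rec_eval f xs z \<Longrightarrow> rec_eval (PrimRec f g) (0 # xs) z"
| PrimRec_Suc: "rec_eval (PrimRec f g) (m # xs) y \<Longrightarrow> rec_eval g (m # y # xs) z \<Longrightarrow>
    rec_eval (PrimRec f g) (Suc m # xs) z"
| Mu: "rec_eval f (m # xs) 0 \<Longrightarrow> (\<forall>l<m. \<exists>y>0. rec_eval f (l # xs) y) \<Longrightarrow> rec_eval (Mu f) xs m"

lemma rec_eval_deterministic:
  "rec_eval f xs y \<Longrightarrow> rec_eval f xs z \<Longrightarrow> y = z"
proof (induction arbitrary: z rule: rec_eval.induct)
  case (Comp xs gs ys f z')
  from Comp.prems obtain ys' where
    *: "list_all2 (\<lambda>g y. rec_eval g xs y) gs ys'" "rec_eval f ys' z"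
    by (auto elim: rec_eval.cases)
  have "ys = ys'"
    using Comp.IH(1) *(1) by (auto simp: list_all2_conv_all_nth intro!: nth_equalityI)
  then show ?case using Comp.IH(2) *(2) by simp
next
  case (PrimRec_0 f xs z' g)
  from PrimRec_0.prems show ?case by cases (auto intro: PrimRec_0.IH)
next
  case (PrimRec_Suc f g m xs y z')
  from PrimRec_Suc.prems show ?case by cases (auto intro: PrimRec_Suc.IH dest: PrimRec_Suc.IH(1))
next
  case (Mu f m xs)
  from Mu.prems have z: "rec_eval f (z # xs) 0" "\<forall>l<z. \<exists>y>0. rec_eval f (l # xs) y"
    by (auto elim: rec_eval.cases)
  show ?case
  proof (cases m z rule: linorder_cases)
    case less
    then show ?thesis using z(2) Mu.IH(1) by (metis less_numeral_extra(3))
  next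
    case greater
    then show ?thesis using z(1) Mu.IH(2) by (metis less_numeral_extra(3))
  qed
qed (auto elim: rec_eval.cases)

text \<open>Decidability of the property P for instances that are promised to lie in X: the algorithm
  must halt with the correct answer on every instance in X; nothing is required elsewhere.\<close>

definition decidable_on :: "('i \<Rightarrow> nat) \<Rightarrow> 'i set \<Rightarrow> ('i \<Rightarrow> bool) \<Rightarrow> bool" where
  "decidable_on enc X P \<longleftrightarrow>
     (\<exists>d. \<forall>x\<in>X. rec_eval d [enc x] (if P x then 1 else 0))"

section \<open>Trees\<close>

text \<open>R relates each parent to its children.\<close>

definition rooted_tree :: "'a set \<Rightarrow> ('a \<times> 'a) set \<Rightarrow> 'a \<Rightarrow> bool" where
  "rooted_tree V R r \<longleftrightarrow>
     finite V \<and> R \<subseteq> V \<times> V \<and> r \<in> V \<and>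
     (\<forall>u. (u, r) \<notin> R) \<and>
     (\<forall>v\<in>V - {r}. \<exists>!u. (u, v) \<in> R) \<and>
     (\<forall>v\<in>V. (r, v) \<in> R\<^sup>*)"

definition tree_height :: "('a \<times> 'a) set \<Rightarrow> 'a \<Rightarrow> nat" where
  "tree_height R r = Max {m. \<exists>v. (r, v) \<in> R ^^ m \<and> (\<forall>w. (v, w) \<notin> R)}"

type_synonym 'a graph = "'a set \<times> ('a \<times> 'a) set"

definition unlabelled_trees :: "nat \<Rightarrow> 'a graph set" where
  "unlabelled_trees n = {(V, R). \<exists>r. rooted_tree V R r \<and> tree_height R r \<le> n}"

definition graph_isomorphic :: "'a graph \<Rightarrow> 'b graph \<Rightarrow> bool" where
  "graph_isomorphic G H \<longleftrightarrow>
     (\<exists>h. bij_betw h (fst G) (fst H) \<and>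
          (\<forall>x\<in>fst G. \<forall>y\<in>fst G. (x, y) \<in> snd G \<longleftrightarrow> (h x, h y) \<in> snd H))"

text \<open>Nodes and labels are natural numbers, which covers all finite trees and alphabets up to
  isomorphism.  An edge is the pair of its parent node and its child node.\<close>

type_synonym edge = "nat \<times> nat"

record labelled_tree =
  tree_nodes :: "nat set"
  tree_edges :: "edge set"
  tree_root :: nat
  edge_label :: "edge \<Rightarrow> nat"

definition labelled_trees :: "nat \<Rightarrow> nat set \<Rightarrow> labelled_tree set" where
  "labelled_trees k \<Sigma> =
     {t. rooted_tree (tree_nodes t) (tree_edges t) (tree_root t) \<and>
         tree_height (tree_edges t) (tree_root t) \<le> k \<and>
         edge_label t ` tree_edges t \<subseteq> \<Sigma>}"

record 'a edge_structure =
  universe :: "'a set"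
  has_label :: "nat \<Rightarrow> 'a \<Rightarrow> bool"
  parent :: "'a \<Rightarrow> 'a"

definition edge_rep :: "labelled_tree \<Rightarrow> edge edge_structure" where
  "edge_rep t =
     \<lparr> universe = tree_edges t,
       has_label = (\<lambda>a e. edge_label t e = a),
       parent = (\<lambda>e. if fst e = tree_root t then e
                     else (THE e'. e' \<in> tree_edges t \<and> snd e' = fst e)) \<rparr>"

definition E_class :: "nat \<Rightarrow> nat set \<Rightarrow> edge edge_structure set" where
  "E_class k \<Sigma> = edge_rep ` labelled_trees k \<Sigma>"

section \<open>Quantifier-free interpretations\<close>

datatype tm = Var nat | Par tm

datatype qf =
  TrueF | LabelF nat tm | EqF tm tm | NotF qf | AndF qf qf | OrF qf qf

primrec tm_vars :: "tm \<Rightarrow> nat set" where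
  "tm_vars (Var p) = {p}"
| "tm_vars (Par s) = tm_vars s"

primrec qf_vars :: "qf \<Rightarrow> nat set" where
  "qf_vars TrueF = {}"
| "qf_vars (LabelF a s) = tm_vars s"
| "qf_vars (EqF s s') = tm_vars s \<union> tm_vars s'"
| "qf_vars (NotF \<phi>) = qf_vars \<phi>"
| "qf_vars (AndF \<phi> \<psi>) = qf_vars \<phi> \<union> qf_vars \<psi>"
| "qf_vars (OrF \<phi> \<psi>) = qf_vars \<phi> \<union> qf_vars \<psi>"

primrec qf_labels :: "qf \<Rightarrow> nat set" where
  "qf_labels TrueF = {}"
| "qf_labels (LabelF a s) = {a}"
| "qf_labels (EqF s s') = {}"
| "qf_labels (NotF \<phi>) = qf_labels \<phi>"
| "qf_labels (AndF \<phi> \<psi>) = qf_labels \<phi> \<union> qf_labels \<psi>"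
| "qf_labels (OrF \<phi> \<psi>) = qf_labels \<phi> \<union> qf_labels \<psi>"

text \<open>The variable with number p denotes the entry at position p of the tuple.\<close>

primrec tm_val :: "'a edge_structure \<Rightarrow> 'a list \<Rightarrow> tm \<Rightarrow> 'a" where
  "tm_val A xs (Var p) = xs ! p"
| "tm_val A xs (Par s) = parent A (tm_val A xs s)"

primrec qf_sat :: "'a edge_structure \<Rightarrow> 'a list \<Rightarrow> qf \<Rightarrow> bool" where
  "qf_sat A xs TrueF \<longleftrightarrow> True"
| "qf_sat A xs (LabelF a s) \<longleftrightarrow> has_label A a (tm_val A xs s)"
| "qf_sat A xs (EqF s s') \<longleftrightarrow> tm_val A xs s = tm_val A xs s'"
| "qf_sat A xs (NotF \<phi>) \<longleftrightarrow> \<not> qf_sat A xs \<phi>"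
| "qf_sat A xs (AndF \<phi> \<psi>) \<longleftrightarrow> qf_sat A xs \<phi> \<and> qf_sat A xs \<psi>"
| "qf_sat A xs (OrF \<phi> \<psi>) \<longleftrightarrow> qf_sat A xs \<phi> \<or> qf_sat A xs \<psi>"

text \<open>Components are numbered by list positions; each carries its dimension and its universe
  formula.  The output vocabulary is a single binary relation, whose formula for the components
  i, j is at position j of row i of the matrix.\<close>

record qf_interp =
  components :: "(nat \<times> qf) list"
  child_formulas :: "qf list list"

definition dimension :: "qf_interp \<Rightarrow> nat \<Rightarrow> nat" where
  "dimension f i = fst (components f ! i)"

definition universe_formula :: "qf_interp \<Rightarrow> nat \<Rightarrow> qf" where
  "universe_formula f i = snd (components f ! i)"

definition child_formula :: "qf_interp \<Rightarrow> nat \<Rightarrow> nat \<Rightarrow> qf" where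
  "child_formula f i j = child_formulas f ! i ! j"

definition wf_interpretation :: "nat set \<Rightarrow> qf_interp \<Rightarrow> bool" where
  "wf_interpretation \<Sigma> f \<longleftrightarrow>
     (let c = length (components f) in
        length (child_formulas f) = c \<and>
        (\<forall>i<c. length (child_formulas f ! i) = c) \<and>
        (\<forall>i<c. qf_vars (universe_formula f i) \<subseteq> {..<dimension f i} \<and>
               qf_labels (universe_formula f i) \<subseteq> \<Sigma>) \<and>
        (\<forall>i<c. \<forall>j<c. qf_vars (child_formula f i j) \<subseteq> {..<dimension f i + dimension f j} \<and>
               qf_labels (child_formula f i j) \<subseteq> \<Sigma>))"

definition output_universe ::
    "qf_interp \<Rightarrow> 'a edge_structure \<Rightarrow> (nat \<times> 'a list) set" where
  "output_universe f A =
     {(i, xs). i < length (components f) \<and> length xs = dimension f i \<and>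
               set xs \<subseteq> universe A \<and> qf_sat A xs (universe_formula f i)}"

definition apply_interpretation ::
    "qf_interp \<Rightarrow> 'a edge_structure \<Rightarrow> (nat \<times> 'a list) graph" where
  "apply_interpretation f A =
     (output_universe f A,
      {((i, xs), (j, ys)). (i, xs) \<in> output_universe f A \<and> (j, ys) \<in> output_universe f A \<and>
                           qf_sat A (xs @ ys) (child_formula f i j)})"

definition qf_interpretation_into_trees ::
    "nat \<Rightarrow> nat set \<Rightarrow> nat \<Rightarrow> qf_interp \<Rightarrow> bool" where
  "qf_interpretation_into_trees k \<Sigma> n f \<longleftrightarrow>
     wf_interpretation \<Sigma> f \<and>
     (\<forall>A\<in>E_class k \<Sigma>. apply_interpretation f A \<in> unlabelled_trees n)"

section \<open>Encoding of instances\<close>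

type_synonym problem_instance =
  "nat set \<times> nat \<times> nat \<times> qf_interp \<times> qf_interp"

primrec tm_encode :: "tm \<Rightarrow> nat" where
  "tm_encode (Var p) = prod_encode (0, p)"
| "tm_encode (Par s) = prod_encode (1, tm_encode s)"

primrec qf_encode :: "qf \<Rightarrow> nat" where
  "qf_encode TrueF = prod_encode (0, 0)"
| "qf_encode (LabelF a s) = prod_encode (1, prod_encode (a, tm_encode s))"
| "qf_encode (EqF s s') = prod_encode (2, prod_encode (tm_encode s, tm_encode s'))"
| "qf_encode (NotF \<phi>) = prod_encode (3, qf_encode \<phi>)"
| "qf_encode (AndF \<phi> \<psi>) = prod_encode (4, prod_encode (qf_encode \<phi>, qf_encode \<psi>))"
| "qf_encode (OrF \<phi> \<psi>) = prod_encode (5, prod_encode (qf_encode \<phi>, qf_encode \<psi>))"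

definition interpretation_encode :: "qf_interp \<Rightarrow> nat" where
  "interpretation_encode f =
     prod_encode
       (list_encode (map (\<lambda>(d, \<phi>). prod_encode (d, qf_encode \<phi>)) (components f)),
        list_encode (map (\<lambda>row. list_encode (map qf_encode row)) (child_formulas f)))"

text \<open>The library function set_encode codes a finite set of naturals by its characteristic
  binary expansion; it is injective on finite sets only.\<close>

fun instance_encode :: "problem_instance \<Rightarrow> nat" where
  "instance_encode (\<Sigma>, k, n, f, g) =
     list_encode [set_encode \<Sigma>, k, n, interpretation_encode f, interpretation_encode g]"

end

theory Submission
  imports Defs "HOL-Library.Multiset"
begin

text \<open>
  Fix an instance with interpretations f and g. There is one input tree t* such that f and g are
  equivalent on all inputs as soon as f(t*) and g(t*) are isomorphic. It is built by adding one
  block of sibling leaves after another, each block being enormous compared with everything built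
  before. Counting, in such a tree, the tuples that extend fixed parameters in a way prescribed by
  quantifier-free types gives numbers with no small integer relation except those that hold in
  all trees.

  Colour an output node by the multiset of the colours of its children, up to some depth; the
  colours determine an output tree up to isomorphism. By induction on the depth, two nodes with
  equal colours over t* have equal colours over every other input tree containing parameters of
  the same type: equality of colours over t* says that certain definable counts agree there,
  hence they agree everywhere. The decision procedure computes t* and compares the colours of
  f(t*) and g(t*).
\<close>

section \<open>Computable functions\<close>

text \<open>Whether two children have the same colour is not given by a quantifier-free formula, so
  counts of children by colour are not definable as they stand. The induction hypothesis repairs
  this in two ways. Applied to t* and itself, it says that equality of colours over t* is preserved
  by isomorphisms between closed parts of t*; so "same colour after embedding into t*" is a property
  of types and makes sense for nodes over any input. Applied to another input, it says that this
  relation is finer than equality of colours there.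

  The type of a tuple is recorded by the closed set of all ancestors of its entries. A count then
  splits into a sum over closed sets C containing the parameters, and the difference of two counts
  is a sum of integer weights W C. These weights are bounded, vanish on large C and are invariant
  under isomorphisms that fix the parameters. The counting argument knows nothing else about
  interpretations.

  Colours are compared in one direction only, from t* to the other inputs. The reverse is free, as
  t* is itself an input up to isomorphism.\<close>

definition ncomp :: "nat \<Rightarrow> (nat list \<Rightarrow> nat) \<Rightarrow> bool" where
  "ncomp n F \<longleftrightarrow> (\<exists>r. \<forall>xs. length xs = n \<longrightarrow> rec_eval r xs (F xs))"

lemma ncomp_proj: "i < n \<Longrightarrow> ncomp n (\<lambda>xs. xs ! i)"
  unfolding ncomp_def by (rule exI[of _ "Proj i"]) (auto intro: rec_eval.Proj)

lemma ncomp_0: "ncomp n (\<lambda>xs. 0)"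
  unfolding ncomp_def by (rule exI[of _ Zero]) (auto intro: rec_eval.Zero)

lemma ncomp_Suc:
  assumes "ncomp n F" shows "ncomp n (\<lambda>xs. Suc (F xs))"
proof -
  obtain r where r: "\<forall>xs. length xs = n \<longrightarrow> rec_eval r xs (F xs)"
    using assms by (auto simp: ncomp_def)
  show ?thesis unfolding ncomp_def
    by (rule exI[of _ "Comp Succ [r]"]) (use r in \<open>auto intro!: rec_eval.Comp[where ys = "[_]"] rec_eval.Succ\<close>)
qed

lemma ncomp_comp2:
  assumes "ncomp 2 (\<lambda>xs. f (xs ! 0) (xs ! 1))" "ncomp n G" "ncomp n H"
  shows "ncomp n (\<lambda>xs. f (G xs) (H xs))"
proof -
  obtain r s t where r: "\<And>xs. length xs = 2 \<Longrightarrow> rec_eval r xs (f (xs ! 0) (xs ! 1))"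
    and "\<forall>xs. length xs = n \<longrightarrow> rec_eval s xs (G xs)"
    and "\<forall>xs. length xs = n \<longrightarrow> rec_eval t xs (H xs)"
    using assms by (auto simp: ncomp_def)
  then show ?thesis unfolding ncomp_def
    by (intro exI[of _ "Comp r [s, t]"])
      (use r[of "[_, _]"] in \<open>auto intro!: rec_eval.Comp[where ys = "[_, _]"]\<close>)
qed

lemma ncomp_rec_nat:
  assumes "ncomp 1 (\<lambda>xs. a (xs ! 0))" "ncomp 3 (\<lambda>xs. g (xs ! 0) (xs ! 1) (xs ! 2))"
  shows "ncomp 2 (\<lambda>xs. rec_nat (a (xs ! 1)) (\<lambda>i acc. g i acc (xs ! 1)) (xs ! 0))"
proof -
  obtain r s where r: "\<And>xs. length xs = 1 \<Longrightarrow> rec_eval r xs (a (xs ! 0))"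
    and s: "\<And>xs. length xs = 3 \<Longrightarrow> rec_eval s xs (g (xs ! 0) (xs ! 1) (xs ! 2))"
    using assms by (auto simp: ncomp_def)
  have "rec_eval (PrimRec r s) [n, x] (rec_nat (a x) (\<lambda>i acc. g i acc x) n)" for n x
    by (induction n) (use r[of "[x]"] s[of "[_, _, x]"] in \<open>auto intro: rec_eval.PrimRec_0 rec_eval.PrimRec_Suc\<close>)
  then show ?thesis unfolding ncomp_def
    by (intro exI[of _ "PrimRec r s"]) (auto simp: length_Suc_conv eval_nat_numeral)
qed

lemma ncomp_rec_nat':
  assumes "ncomp 1 (\<lambda>xs. a (xs ! 0))" "ncomp 3 (\<lambda>xs. g (xs ! 0) (xs ! 1) (xs ! 2))"
    and "\<And>n x. rec_nat (a x) (\<lambda>i acc. g i acc x) n = h n x"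
    and "ncomp n G" "ncomp n H"
  shows "ncomp n (\<lambda>xs. h (G xs) (H xs))"
  using ncomp_comp2[OF ncomp_rec_nat[OF assms(1,2)] assms(4,5)] assms(3) by simp

lemma ncomp_add:
  assumes "ncomp n G" "ncomp n H" shows "ncomp n (\<lambda>xs. G xs + H xs)"
proof -
  have *: "rec_nat x (\<lambda>i acc. Suc acc) n = n + x" for n x :: nat by (induction n) auto
  show ?thesis
    by (rule ncomp_rec_nat'[OF _ _ * assms]) (simp_all add: ncomp_proj ncomp_Suc)
qed

lemma ncomp_mult:
  assumes "ncomp n G" "ncomp n H" shows "ncomp n (\<lambda>xs. G xs * H xs)"
proof -
  have *: "rec_nat 0 (\<lambda>i acc. acc + x) n = n * x" for n x :: nat by (induction n) auto
  show ?thesis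
    by (rule ncomp_rec_nat'[OF _ _ * assms]) (simp_all add: ncomp_0 ncomp_proj ncomp_add)
qed

lemma ncomp_power:
  assumes "ncomp n G" "ncomp n H" shows "ncomp n (\<lambda>xs. H xs ^ G xs)"
proof -
  have *: "rec_nat (Suc 0) (\<lambda>i acc. acc * x) n = x ^ n" for n x :: nat by (induction n) auto
  show ?thesis
    by (rule ncomp_rec_nat'[OF _ _ * assms]) (simp_all add: ncomp_0 ncomp_Suc ncomp_proj ncomp_mult)
qed

lemma ncomp_pred:
  assumes "ncomp n G" shows "ncomp n (\<lambda>xs. G xs - 1)"
proof -
  have *: "rec_nat 0 (\<lambda>i acc. i) n = n - 1" for n :: nat by (induction n) auto
  show ?thesis
    by (rule ncomp_rec_nat'[OF _ _ * assms ncomp_0]) (simp_all add: ncomp_0 ncomp_proj)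
qed

lemma ncomp_diff:
  assumes "ncomp n G" "ncomp n H" shows "ncomp n (\<lambda>xs. H xs - G xs)"
proof -
  have *: "rec_nat x (\<lambda>i acc. acc - 1) n = x - n" for n x :: nat by (induction n) auto
  show ?thesis
    by (rule ncomp_rec_nat'[OF _ _ * assms]) (intro ncomp_pred ncomp_proj; simp)+
qed

lemma ncomp_triangle:
  assumes "ncomp n G" shows "ncomp n (\<lambda>xs. triangle (G xs))"
proof -
  have *: "rec_nat 0 (\<lambda>i acc. acc + Suc i) n = triangle n" for n :: nat by (induction n) auto
  show ?thesis
    by (rule ncomp_rec_nat'[OF _ _ * assms ncomp_0])
      (intro ncomp_0 ncomp_proj ncomp_Suc ncomp_add; simp)+
qed

lemma ncomp_prod_encode:
  assumes "ncomp n G" "ncomp n H" shows "ncomp n (\<lambda>xs. prod_encode (G xs, H xs))"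
  unfolding prod_encode_def prod.case by (intro ncomp_add ncomp_triangle assms)

lemma ncomp_if_zero: 
  assumes "ncomp n F" "ncomp n G" "ncomp n H"
  shows "ncomp n (\<lambda>xs. if F xs = 0 then G xs else H xs)"
proof -
  have one: "ncomp m (\<lambda>xs. 1)" for m using ncomp_Suc[OF ncomp_0[of m]] by simp
  have "ncomp n (\<lambda>xs. (1 - F xs) * G xs + (1 - (1 - F xs)) * H xs)"
    by (intro ncomp_add ncomp_mult ncomp_diff assms one)
  moreover have "(\<lambda>xs. (1 - F xs) * G xs + (1 - (1 - F xs)) * H xs) = (\<lambda>xs. if F xs = 0 then G xs else H xs)"
    by auto
  ultimately show ?thesis by simp
qed

text \<open>Cantor pairing runs through the diagonals m + n = d, and diagonal d starts at
  \<open>triangle d\<close>. So only the index \<open>s x\<close> of the diagonal of x has to be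
  found by recursion: it goes up by one exactly when the next triangular number is reached. Both
  components are then differences.\<close>

lemma ncomp_prod_decode:
  assumes "ncomp n G"
  shows ncomp_prod_decode_fst: "ncomp n (\<lambda>xs. fst (prod_decode (G xs)))"
    and ncomp_prod_decode_snd: "ncomp n (\<lambda>xs. snd (prod_decode (G xs)))"
proof -
  define s where "s = rec_nat 0 (\<lambda>i acc. if triangle (Suc acc) - Suc i = 0 then Suc acc else acc)"
  have enc: "\<exists>m n. s x = m + n \<and> x = prod_encode (m, n)" for x
  proof (induction x)
    case 0 show ?case by (rule exI[of _ 0], rule exI[of _ 0]) (simp add: s_def prod_encode_def)
  next
    case (Suc x)
    then obtain m n where mn: "s x = m + n" "x = prod_encode (m, n)" by blast
    have sS: "s (Suc x) = (if triangle (Suc (s x)) - Suc x = 0 then Suc (s x) else s x)"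
      by (simp add: s_def)
    show ?case
    proof (cases n)
      case 0
      then have "s (Suc x) = Suc m" using sS mn by (simp add: prod_encode_def)
      then show ?thesis using mn 0
        by (intro exI[of _ 0] exI[of _ "Suc m"]) (simp add: prod_encode_def)
    next
      case (Suc n')
      then have "s (Suc x) = m + n" using sS mn by (simp add: prod_encode_def)
      then show ?thesis using mn Suc
        by (intro exI[of _ "Suc m"] exI[of _ n']) (simp add: prod_encode_def)
    qed
  qed
  have s: "rec_nat 0 (\<lambda>i acc. if triangle (Suc acc) - Suc i = 0 then Suc acc else acc) n = s n" for n
    by (simp add: s_def)
  have ns: "ncomp n (\<lambda>xs. s (G xs))"
    by (rule ncomp_rec_nat'[OF _ _ s assms ncomp_0])
      (intro ncomp_0 ncomp_if_zero ncomp_Suc ncomp_diff ncomp_triangle ncomp_proj; simp)+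
  have f: "fst (prod_decode x) = x - triangle (s x)" and g: "snd (prod_decode x) = s x - (x - triangle (s x))" for x
  proof -
    obtain m n where "s x = m + n" "x = prod_encode (m, n)" using enc[of x] by blast
    moreover from this have "x = triangle (s x) + m" by (simp add: prod_encode_def)
    moreover have "prod_decode x = (m, n)" using calculation(2) by simp
    ultimately show "fst (prod_decode x) = x - triangle (s x)" "snd (prod_decode x) = s x - (x - triangle (s x))"
      by simp_all
  qed
  have nf: "ncomp n (\<lambda>xs. G xs - triangle (s (G xs)))"
    by (intro ncomp_diff ncomp_triangle ns assms)
  then show "ncomp n (\<lambda>xs. fst (prod_decode (G xs)))" by (simp add: f)
  show "ncomp n (\<lambda>xs. snd (prod_decode (G xs)))"
    unfolding g by (intro ncomp_diff ns nf)
qed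


section \<open>Computable functions between coded types\<close>

class coded =
  fixes enc :: "'a \<Rightarrow> nat"

instantiation nat :: coded begin
definition enc_nat :: "nat \<Rightarrow> nat" where [simp]: "enc_nat n = n"
instance ..
end

instantiation bool :: coded begin
definition enc_bool :: "bool \<Rightarrow> nat" where [simp]: "enc_bool = of_bool"
instance ..
end

instantiation prod :: (coded, coded) coded begin
definition enc_prod :: "'a \<times> 'b \<Rightarrow> nat" where [simp]: "enc_prod p = prod_encode (enc (fst p), enc (snd p))"
instance ..
end

instantiation list :: (coded) coded begin
definition enc_list :: "'a list \<Rightarrow> nat" where [simp]: "enc_list xs = list_encode (map enc xs)"
instance ..
end

instantiation qf :: coded begin
definition enc_qf :: "qf \<Rightarrow> nat" where [simp]: "enc_qf = qf_encode"
instance ..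
end

text \<open>Codes are not assumed to be injective or to exhaust the naturals: the recursive function
  only has to be right on codes of arguments. Formulas remain opaque in this calculus, since the
  only access to them is through their code.\<close>

definition computable :: "('a::coded \<Rightarrow> 'b::coded) \<Rightarrow> bool" where
  "computable f \<longleftrightarrow> (\<exists>r. \<forall>x. rec_eval r [enc x] (enc (f x)))"

named_theorems comp_intros

lemma computable_ncomp3:
  assumes "ncomp 3 (\<lambda>xs. F (xs ! 0) (xs ! 1) (xs ! 2))"
    and "computable a" "computable b" "computable c"
    and eq: "\<And>x. enc (f x) = F (enc (a x)) (enc (b x)) (enc (c x))"
  shows "computable f"
proof -
  obtain r ra rb rc where r: "\<And>xs. length xs = 3 \<Longrightarrow> rec_eval r xs (F (xs ! 0) (xs ! 1) (xs ! 2))"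
    and "\<forall>x. rec_eval ra [enc x] (enc (a x))" "\<forall>x. rec_eval rb [enc x] (enc (b x))"
      "\<forall>x. rec_eval rc [enc x] (enc (c x))"
    using assms by (auto simp: ncomp_def computable_def)
  then show ?thesis unfolding computable_def
    by (intro exI[of _ "Comp r [ra, rb, rc]"])
      (use r[of "[_, _, _]"] in \<open>auto simp: eq numeral_2_eq_2 intro!: rec_eval.Comp[where ys = "[_, _, _]"]\<close>)
qed

lemma computable_ncomp2:
  assumes "ncomp 3 (\<lambda>xs. F (xs ! 0) (xs ! 1))" "computable a" "computable b"
    and "\<And>x. enc (f x) = F (enc (a x)) (enc (b x))"
  shows "computable f"
  by (rule computable_ncomp3[where F = "\<lambda>x y z. F x y", OF assms(1-3) assms(3)]) (use assms(4) in simp)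

lemma computable_ncomp1:
  assumes "ncomp 3 (\<lambda>xs. F (xs ! 0))" "computable a" "\<And>x. enc (f x) = F (enc (a x))"
  shows "computable f"
  by (rule computable_ncomp2[where F = "\<lambda>x y. F x", OF assms(1,2,2)]) (use assms(3) in simp)

lemma computable_id [comp_intros]: "computable (\<lambda>x. x)"
  unfolding computable_def by (rule exI[of _ "Proj 0"]) (auto intro!: rec_eval.Proj[of 0 "[_]", simplified])

lemma computable_const [comp_intros]: "computable (\<lambda>x. c)"
proof -
  have "ncomp 3 (\<lambda>xs. m)" for m by (induction m) (auto intro: ncomp_0 ncomp_Suc)
  then show ?thesis by (rule computable_ncomp1[OF _ computable_id]) simp
qed

lemma computable_compose:
  assumes "computable f" "computable g" shows "computable (\<lambda>x. f (g x))"
proof -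
  obtain r s where "\<forall>x. rec_eval r [enc x] (enc (f x))" "\<forall>x. rec_eval s [enc x] (enc (g x))"
    using assms by (auto simp: computable_def)
  then show ?thesis unfolding computable_def
    by (intro exI[of _ "Comp r [s]"]) (auto intro!: rec_eval.Comp[where ys = "[_]"])
qed

lemma computable_enc [comp_intros]: "computable f \<Longrightarrow> computable (\<lambda>x. enc (f x))"
  by (rule computable_ncomp1[where F = "\<lambda>x. x"]) (simp_all add: ncomp_proj)

lemma computable_Pair [comp_intros]: "computable f \<Longrightarrow> computable g \<Longrightarrow> computable (\<lambda>x. (f x, g x))"
  by (erule (1) computable_ncomp2[where F = "\<lambda>x y. prod_encode (x, y)", rotated])
    (simp_all add: ncomp_proj ncomp_prod_encode)

lemma computable_fst [comp_intros]: "computable f \<Longrightarrow> computable (\<lambda>x. fst (f x))"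
  by (erule computable_ncomp1[where F = "\<lambda>x. fst (prod_decode x)", rotated])
    (simp_all add: ncomp_proj ncomp_prod_decode_fst)

lemma computable_snd [comp_intros]: "computable f \<Longrightarrow> computable (\<lambda>x. snd (f x))"
  by (erule computable_ncomp1[where F = "\<lambda>x. snd (prod_decode x)", rotated])
    (simp_all add: ncomp_proj ncomp_prod_decode_snd)

lemma computable_decode [comp_intros]: "computable f \<Longrightarrow> computable (\<lambda>x. prod_decode (f x))"
  by (erule computable_ncomp1[where F = "\<lambda>x. x", rotated]) (simp_all add: ncomp_proj)

lemma computable_Suc [comp_intros]: "computable f \<Longrightarrow> computable (\<lambda>x. Suc (f x))"
  by (erule computable_ncomp1[where F = Suc, rotated]) (simp_all add: ncomp_proj ncomp_Suc)

lemma computable_add [comp_intros]: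
  fixes f g :: "_ \<Rightarrow> nat" shows "computable f \<Longrightarrow> computable g \<Longrightarrow> computable (\<lambda>x. f x + g x)"
  by (erule (1) computable_ncomp2[where F = "(+)", rotated]) (simp_all add: ncomp_proj ncomp_add)

lemma computable_mult [comp_intros]:
  fixes f g :: "_ \<Rightarrow> nat" shows "computable f \<Longrightarrow> computable g \<Longrightarrow> computable (\<lambda>x. f x * g x)"
  by (erule (1) computable_ncomp2[where F = "(*)", rotated]) (simp_all add: ncomp_proj ncomp_mult)

lemma computable_diff [comp_intros]:
  fixes f g :: "_ \<Rightarrow> nat" shows "computable f \<Longrightarrow> computable g \<Longrightarrow> computable (\<lambda>x. f x - g x)"
  by (erule (1) computable_ncomp2[where F = "(-)", rotated]) (simp_all add: ncomp_proj ncomp_diff)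

lemma computable_power [comp_intros]:
  fixes f g :: "_ \<Rightarrow> nat" shows "computable f \<Longrightarrow> computable g \<Longrightarrow> computable (\<lambda>x. f x ^ g x)"
  by (erule (1) computable_ncomp2[where F = "(^)", rotated]) (simp_all add: ncomp_proj ncomp_power)

lemma computable_If [comp_intros]:
  assumes "computable P" "computable f" "computable g"
  shows "computable (\<lambda>x. if P x then f x else g x)"
  by (rule computable_ncomp3[where F = "\<lambda>x y z. if x = 0 then z else y", OF _ assms])
    (simp_all add: ncomp_proj ncomp_if_zero)

lemma computable_not [comp_intros]: "computable P \<Longrightarrow> computable (\<lambda>x. \<not> P x)"
  using computable_If[of P "\<lambda>x. False" "\<lambda>x. True", OF _ computable_const computable_const]
  by (simp add: if_bool_eq_conj)

lemma computable_conj [comp_intros]: "computable P \<Longrightarrow> computable Q \<Longrightarrow> computable (\<lambda>x. P x \<and> Q x)"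
proof -
  assume "computable P" "computable Q"
  then have "computable (\<lambda>x. if P x then Q x else False)" by (intro computable_If computable_const)
  moreover have "(\<lambda>x. if P x then Q x else False) = (\<lambda>x. P x \<and> Q x)" by auto
  ultimately show ?thesis by simp
qed

lemma computable_disj [comp_intros]: "computable P \<Longrightarrow> computable Q \<Longrightarrow> computable (\<lambda>x. P x \<or> Q x)"
  using computable_not[OF computable_conj[OF computable_not computable_not], of P Q] by simp

lemma computable_eq_nat [comp_intros]:
  fixes f g :: "_ \<Rightarrow> nat" assumes "computable f" "computable g" shows "computable (\<lambda>x. f x = g x)"
  by (rule computable_ncomp2[where F = "\<lambda>x y. if (x - y) + (y - x) = 0 then Suc 0 else 0", OF _ assms])
    ((intro ncomp_if_zero ncomp_add ncomp_diff ncomp_Suc ncomp_0 ncomp_proj; simp), auto)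

lemma computable_le_nat [comp_intros]:
  fixes f g :: "_ \<Rightarrow> nat" assumes "computable f" "computable g" shows "computable (\<lambda>x. f x \<le> g x)"
proof -
  have "computable (\<lambda>x. f x - g x = 0)" by (intro comp_intros assms)
  then show ?thesis by simp
qed

lemma computable_rec_nat [comp_intros]:
  fixes F :: "'a::coded \<Rightarrow> nat \<Rightarrow> 'b::coded \<Rightarrow> 'b"
  assumes "computable (\<lambda>p. F (fst p) (fst (snd p)) (snd (snd p)))" "computable a" "computable n"
  shows "computable (\<lambda>x. rec_nat (a x) (\<lambda>i acc. F x i acc) (n x))"
proof -
  obtain rF where F: "\<And>p. rec_eval rF [enc p] (enc (F (fst p) (fst (snd p)) (snd (snd p))))"
    using assms(1) unfolding computable_def by blast
  obtain ra where a: "\<And>x. rec_eval ra [enc x] (enc (a x))"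
    using assms(2) unfolding computable_def by blast
  obtain rn where n: "\<And>x. rec_eval rn [enc x] (enc (n x))"
    using assms(3) unfolding computable_def by blast
  have "ncomp 3 (\<lambda>xs. prod_encode (xs ! 2, prod_encode (xs ! 0, xs ! 1)))"
    by (intro ncomp_prod_encode ncomp_proj) auto
  then obtain rp where rp: "\<And>xs. length xs = 3 \<Longrightarrow> rec_eval rp xs (prod_encode (xs ! 2, prod_encode (xs ! 0, xs ! 1)))"
    by (auto simp: ncomp_def)
  have step: "rec_eval (Comp rF [rp]) [i, enc y, enc x] (enc (F x i y))" for i y x
    using F[of "(x, i, y)"] rp[of "[i, enc y, enc x]"]
    by (auto intro!: rec_eval.Comp[where ys = "[_]"])
  have main: "rec_eval (PrimRec ra (Comp rF [rp])) [m, enc x] (enc (rec_nat (a x) (\<lambda>i acc. F x i acc) m))" for m x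
    by (induction m) (auto intro: rec_eval.PrimRec_0 rec_eval.PrimRec_Suc a step)
  show ?thesis unfolding computable_def
  proof (intro exI allI)
    fix x
    show "rec_eval (Comp (PrimRec ra (Comp rF [rp])) [rn, Proj 0]) [enc x]
      (enc (rec_nat (a x) (\<lambda>i acc. F x i acc) (n x)))"
      using n[of x] main[of "n x" x]
      by (auto intro!: rec_eval.Comp[where ys = "[n x, enc x]"] rec_eval.Proj[of 0 "[_]", simplified])
  qed
qed

lemma computable_case_nat [comp_intros]:
  fixes F :: "'a::coded \<Rightarrow> nat \<Rightarrow> 'b::coded"
  assumes "computable (\<lambda>p. F (fst p) (snd p))" "computable a" "computable n"
  shows "computable (\<lambda>x. case n x of 0 \<Rightarrow> a x | Suc m \<Rightarrow> F x m)"
proof -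
  have "computable (\<lambda>x. if n x = 0 then a x else F x (n x - 1))"
    using computable_compose[OF assms(1) computable_Pair[OF computable_id computable_diff[OF assms(3) computable_const[of 1]]]]
    by (intro comp_intros assms) simp
  moreover have "(\<lambda>x. if n x = 0 then a x else F x (n x - 1)) = (\<lambda>x. case n x of 0 \<Rightarrow> a x | Suc m \<Rightarrow> F x m)"
    by (auto split: nat.split)
  ultimately show ?thesis by simp
qed

section \<open>Computable operations on lists\<close>

lemma computable_Cons [comp_intros]: "computable f \<Longrightarrow> computable g \<Longrightarrow> computable (\<lambda>x. f x # g x)"
  by (erule (1) computable_ncomp2[where F = "\<lambda>x y. Suc (prod_encode (x, y))", rotated])
    (simp_all add: ncomp_proj ncomp_prod_encode ncomp_Suc)

text \<open>The value of hd [] is some fixed element, so hd is total and computable; entries of lists are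
  read by hd (drop i xs) because nothing is known about xs ! i beyond the length.\<close>

lemma computable_hd [comp_intros]:
  fixes f :: "'a::coded \<Rightarrow> 'b::coded list"
  assumes "computable f" shows "computable (\<lambda>x. hd (f x))"
proof -
  have "ncomp 3 (\<lambda>xs. m)" for m by (induction m) (auto intro: ncomp_0 ncomp_Suc)
  then have "ncomp 3 (\<lambda>xs. if xs ! 0 = 0 then enc (hd ([] :: 'b list)) else fst (prod_decode (xs ! 0 - 1)))"
    by (intro ncomp_if_zero ncomp_prod_decode_fst ncomp_pred ncomp_proj) simp_all
  then show ?thesis
  proof (rule computable_ncomp1[OF _ assms])
    show "enc (hd (f x)) = (if enc (f x) = 0 then enc (hd ([] :: 'b list)) else fst (prod_decode (enc (f x) - 1)))" for x
      by (cases "f x") auto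
  qed
qed

lemma computable_tl [comp_intros]:
  assumes "computable f" shows "computable (\<lambda>x. tl (f x))"
proof (rule computable_ncomp1[where F = "\<lambda>c. if c = 0 then 0 else snd (prod_decode (c - 1))", OF _ assms])
  show "enc (tl (f x)) = (if enc (f x) = 0 then 0 else snd (prod_decode (enc (f x) - 1)))" for x
    by (cases "f x") auto
qed (intro ncomp_if_zero ncomp_prod_decode_snd ncomp_pred ncomp_proj ncomp_0; simp)

text \<open>Under a binder the outer argument becomes the first component of a pair; this carries a
  known fact of computability there.\<close>

lemma compose_fst: "computable f \<Longrightarrow> computable (\<lambda>x. f (fst x))"
  by (rule computable_compose[of f, OF _ computable_fst[OF computable_id]])

lemma computable_null [comp_intros]:
  assumes "computable f" shows "computable (\<lambda>x. f x = [])"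
proof (rule computable_ncomp1[where F = "\<lambda>c. if c = 0 then Suc 0 else 0", OF _ assms])
  show "enc (f x = []) = (if enc (f x) = 0 then Suc 0 else 0)" for x
    by (cases "f x") auto
qed (intro ncomp_if_zero ncomp_Suc ncomp_0 ncomp_proj; simp)

lemma computable_drop [comp_intros]:
  fixes f :: "'a::coded \<Rightarrow> 'b::coded list"
  assumes "computable n" "computable f" shows "computable (\<lambda>x. drop (n x) (f x))"
proof -
  have "drop n xs = rec_nat xs (\<lambda>i ys. tl ys) n" for n and xs :: "'b list"
    by (induction n) (simp_all add: drop_Suc flip: tl_drop)
  then show ?thesis by (auto intro!: comp_intros assms)
qed

text \<open>Primitive recursion carries the pair of the accumulator and the remaining list. The
  number of rounds is the code of the list, which bounds its length; rounds after the end of the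
  list change nothing. Most of the later list operations are reduced to this fold.\<close>

lemma computable_foldl [comp_intros]:
  fixes F :: "'a::coded \<Rightarrow> 'b::coded \<Rightarrow> 'c::coded \<Rightarrow> 'b"
  assumes F: "computable (\<lambda>p. F (fst p) (fst (snd p)) (snd (snd p)))" and a: "computable a" and xs: "computable xs"
  shows "computable (\<lambda>x. foldl (\<lambda>acc y. F x acc y) (a x) (xs x))"
proof -
  define step where "step x s = (if snd s = [] then s else (F x (fst s) (hd (snd s)), tl (snd s)))" for x s
  have it: "rec_nat (b, l) (\<lambda>i s. step x s) m = (foldl (\<lambda>acc y. F x acc y) b (take m l), drop m l)" for b l m x
    by (induction m)
      (auto simp: step_def tl_drop drop_Suc hd_drop_conv_nth take_Suc_conv_app_nth)
  have len: "length l \<le> enc l" for l :: "'c list"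
  proof (induction l)
    case (Cons y l)
    then show ?case using le_prod_encode_2[of "list_encode (map enc l)" "enc y"] by simp
  qed simp
  have "computable (\<lambda>p. step (fst p) (snd (snd p)))"
    unfolding step_def
    by (intro comp_intros computable_compose[OF F, of "\<lambda>p. (fst p, fst (snd (snd p)), hd (snd (snd (snd p))))", simplified])
  then have "computable (\<lambda>x. fst (rec_nat (a x, xs x) (\<lambda>i s. step x s) (enc (xs x))))"
    by (intro comp_intros a xs)
  then show ?thesis by (simp add: it len del: enc_list_def)
qed

lemma computable_rev [comp_intros]: "computable f \<Longrightarrow> computable (\<lambda>x. rev (f x))"
proof -
  have "rev l = foldl (\<lambda>acc y. y # acc) [] l" for l :: "'b list"
    by (simp add: foldl_conv_fold rev_conv_fold)
  then show "computable f \<Longrightarrow> computable (\<lambda>x. rev (f x))"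
    by (simp add: comp_intros)
qed

lemma computable_append [comp_intros]: "computable f \<Longrightarrow> computable g \<Longrightarrow> computable (\<lambda>x. f x @ g x)"
proof -
  have "l @ l' = foldl (\<lambda>acc y. y # acc) l' (rev l)" for l l' :: "'b list"
    by (induction l) simp_all
  then show "computable f \<Longrightarrow> computable g \<Longrightarrow> computable (\<lambda>x. f x @ g x)"
    by (simp add: comp_intros)
qed

lemma computable_map [comp_intros]:
  assumes F: "computable (\<lambda>p. F (fst p) (snd p))" and "computable xs"
  shows "computable (\<lambda>x. map (\<lambda>y. F x y) (xs x))"
proof -
  have "map h l = foldl (\<lambda>acc y. acc @ [h y]) [] l" for h :: "'b \<Rightarrow> 'c" and l
    by (induction l rule: rev_induct) auto
  then show ?thesis
    by (simp) (intro comp_intros assms computable_compose[OF F, of "\<lambda>p. (fst p, snd (snd p))", simplified])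
qed

lemma computable_filter [comp_intros]:
  assumes P: "computable (\<lambda>p. P (fst p) (snd p))" and "computable xs"
  shows "computable (\<lambda>x. filter (\<lambda>y. P x y) (xs x))"
proof -
  have "filter h l = foldl (\<lambda>acc y. if h y then acc @ [y] else acc) [] l" for h :: "'b \<Rightarrow> bool" and l
    by (induction l rule: rev_induct) auto
  then show ?thesis
    by (simp) (intro comp_intros assms computable_compose[OF P, of "\<lambda>p. (fst p, snd (snd p))", simplified])
qed

lemma computable_concat [comp_intros]: "computable f \<Longrightarrow> computable (\<lambda>x. concat (f x))"
proof -
  have "concat l = foldl (\<lambda>acc y. acc @ y) [] l" for l :: "'b list list"
    by (induction l rule: rev_induct) auto
  then show "computable f \<Longrightarrow> computable (\<lambda>x. concat (f x))"
    by (simp add: comp_intros)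
qed

lemma computable_length [comp_intros]: "computable f \<Longrightarrow> computable (\<lambda>x. length (f x))"
proof -
  have "length l = foldl (\<lambda>acc y. Suc acc) 0 l" for l :: "'b list"
    by (induction l rule: rev_induct) auto
  then show "computable f \<Longrightarrow> computable (\<lambda>x. length (f x))"
    by (simp add: comp_intros)
qed

lemma computable_list_ex [comp_intros]:
  assumes P: "computable (\<lambda>p. P (fst p) (snd p))" and "computable xs"
  shows "computable (\<lambda>x. list_ex (\<lambda>y. P x y) (xs x))"
proof -
  have "list_ex h l \<longleftrightarrow> filter h l \<noteq> []" for h :: "'b \<Rightarrow> bool" and l
    by (induction l) auto
  then show ?thesis
    by (simp) (intro comp_intros assms)
qed

lemma computable_replicate [comp_intros]:
  "computable n \<Longrightarrow> computable f \<Longrightarrow> computable (\<lambda>x. replicate (n x) (f x))"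
proof -
  have "replicate n y = rec_nat [] (\<lambda>i l. y # l) n" for n and y :: 'b
    by (induction n) auto
  moreover assume "computable n" "computable f"
  ultimately show "computable (\<lambda>x. replicate (n x) (f x))"
    by simp (intro comp_intros; simp add: compose_fst)
qed

lemma computable_upt [comp_intros]: "computable n \<Longrightarrow> computable (\<lambda>x. [0..<n x])"
proof -
  have "[0..<n] = rec_nat [] (\<lambda>i l. l @ [i]) n" for n
    by (induction n) auto
  then show "computable n \<Longrightarrow> computable (\<lambda>x. [0..<n x])"
    by (simp add: comp_intros)
qed

lemma computable_sort [comp_intros]:
  fixes f :: "'a::coded \<Rightarrow> nat list"
  shows "computable f \<Longrightarrow> computable (\<lambda>x. sort (f x))"
proof -
  have "sort l = foldl (\<lambda>acc y. filter (\<lambda>z. z \<le> y) acc @ y # filter (\<lambda>z. \<not> z \<le> y) acc) [] l" for l :: "nat list"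
  proof (rule properties_for_sort, goal_cases)
    case 1 show ?case
      by (induction l rule: rev_induct) auto
  next
    case 2 show ?case
      by (induction l rule: rev_induct) (auto simp: sorted_append sorted_wrt_filter)
  qed
  then show "computable f \<Longrightarrow> computable (\<lambda>x. sort (f x))"
    by simp (intro comp_intros)
qed

lemma computable_n_lists [comp_intros]:
  assumes "computable n" "computable f" shows "computable (\<lambda>x. List.n_lists (n x) (f x))"
proof -
  have "List.n_lists n l = rec_nat [[]] (\<lambda>i acc. concat (map (\<lambda>ys. map (\<lambda>y. y # ys) l) acc)) n" for n and l :: "'b list"
    by (induction n) auto
  then show ?thesis
    by simp (intro comp_intros assms; auto intro!: computable_compose[OF assms(2)] comp_intros)
qed

section \<open>Forests without cancellation\<close>

definition down_closed :: "'a edge_structure \<Rightarrow> 'a set \<Rightarrow> bool" where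
  "down_closed A C \<longleftrightarrow> C \<subseteq> universe A \<and> parent A ` C \<subseteq> C"

text \<open>Such maps stand for equality of quantifier-free types: a tuple in C and its image
  satisfy the same quantifier-free formulas. Closedness under \<open>parent\<close> keeps the values
  of all terms inside the domain.\<close>

definition local_iso :: "'a edge_structure \<Rightarrow> 'b edge_structure \<Rightarrow> 'a set \<Rightarrow> ('a \<Rightarrow> 'b) \<Rightarrow> bool" where
  "local_iso A B C h \<longleftrightarrow> down_closed A C \<and> inj_on h C \<and> down_closed B (h ` C) \<and>
     (\<forall>e\<in>C. parent B (h e) = h (parent A e) \<and> (\<forall>a. has_label B a (h e) = has_label A a e))"

definition ancestors :: "'a edge_structure \<Rightarrow> 'a set \<Rightarrow> 'a set" where
  "ancestors A S = {d. \<exists>e\<in>S. \<exists>i. d = (parent A ^^ i) e}"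

lemma ancestors_superset: "S \<subseteq> ancestors A S"
proof
  fix e assume "e \<in> S"
  moreover have "e = (parent A ^^ 0) e" by simp
  ultimately show "e \<in> ancestors A S" unfolding ancestors_def by blast
qed

lemma down_closed_funpow:
  assumes "down_closed A C" "e \<in> C" shows "(parent A ^^ i) e \<in> C"
  using assms by (induction i) (auto simp: down_closed_def)

lemma ancestors_least: "down_closed A C \<Longrightarrow> S \<subseteq> C \<Longrightarrow> ancestors A S \<subseteq> C"
  unfolding ancestors_def using down_closed_funpow[of A C] by auto

lemma down_closed_ancestors:
  assumes "down_closed A (universe A)" "S \<subseteq> universe A" shows "down_closed A (ancestors A S)"
proof -
  have "parent A d \<in> ancestors A S" if d: "d \<in> ancestors A S" for d
  proof -
    obtain e i where "e \<in> S" "d = (parent A ^^ i) e" using d by (auto simp: ancestors_def)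
    then have "parent A d = (parent A ^^ Suc i) e" by simp
    with \<open>e \<in> S\<close> show ?thesis unfolding ancestors_def by blast
  qed
  then show ?thesis using ancestors_least[OF assms] by (auto simp: down_closed_def)
qed

lemma down_closed_Un: "down_closed A C \<Longrightarrow> down_closed A D \<Longrightarrow> down_closed A (C \<union> D)"
  by (auto simp: down_closed_def)

lemma ancestors_Un: "ancestors A (S \<union> S') = ancestors A S \<union> ancestors A S'"
  unfolding ancestors_def by blast

text \<open>A list of pairs (p, a) is read as a forest of edges 0, 1, ...: edge j has label a, it leaves
  the root if p = 0 and has the parent edge q if p = Suc q.\<close>

definition list_structure :: "(nat \<times> nat) list \<Rightarrow> nat edge_structure" where
  "list_structure T =
     \<lparr> universe = {..<length T},
       has_label = (\<lambda>a j. snd (T ! j) = a),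
       parent = (\<lambda>j. case fst (T ! j) of 0 \<Rightarrow> j | Suc q \<Rightarrow> q) \<rparr>"

text \<open>The bound on p lets a block hang from the root or from any edge built before it, never
  from itself. Its size depends on the number m of earlier edges alone; there are at most 2 ^ m
  closed sets of earlier edges, and this is what the block has to outweigh.\<close>

inductive generic :: "(nat \<Rightarrow> nat) \<Rightarrow> (nat \<times> nat) list \<Rightarrow> bool" for G where
  Nil: "generic G []"
| block: "generic G T \<Longrightarrow> p \<le> length T \<Longrightarrow> generic G (T @ replicate (G (length T)) (p, a))"

lemma generic_fst:
  assumes "generic G T" "j < length T" shows "fst (T ! j) \<le> j"
  using assms
proof (induction arbitrary: j)
  case (block T p a)
  then show ?case by (cases "j < length T") (auto simp: nth_append)
qed simp

lemma generic_down_closed: "generic G T \<Longrightarrow> down_closed (list_structure T) {..<length T}"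
proof -
  assume "generic G T"
  have "parent (list_structure T) j < length T" if "j < length T" for j
    using generic_fst[OF \<open>generic G T\<close> that] that by (auto simp: list_structure_def split: nat.split)
  then show ?thesis by (auto simp: down_closed_def list_structure_def)
qed

text \<open>Take the largest m with \<open>A m \<noteq> 0\<close>, which is at most R. Its term has
  absolute value at least \<open>b m\<close>, whereas the lower terms together reach at most K times
  the sum of the lower values of b. So they cannot offset it.\<close>

lemma dominated_sum_zero:
  fixes A b :: "nat \<Rightarrow> int"
  assumes b: "\<And>q. 0 \<le> b q" "b 0 > 0" "\<And>q. 0 < q \<Longrightarrow> q \<le> R \<Longrightarrow> K * (\<Sum>p<q. b p) < b q"
    and A: "\<And>q. \<bar>A q\<bar> \<le> K" "\<And>q. R < q \<Longrightarrow> A q = 0"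
    and 0: "(\<Sum>q\<le>n. b q * A q) = 0" and "q \<le> n"
  shows "A q = 0"
proof (rule ccontr)
  assume "A q \<noteq> 0"
  define S where "S = {q. q \<le> n \<and> A q \<noteq> 0}"
  define m where "m = Max S"
  have S: "finite S" "q \<in> S" using \<open>A q \<noteq> 0\<close> \<open>q \<le> n\<close> by (auto simp: S_def)
  then have m: "m \<in> S" "\<And>q. q \<in> S \<Longrightarrow> q \<le> m" unfolding m_def by (auto intro: Max_in)
  then have mR: "m \<le> R" "m \<le> n" "A m \<noteq> 0" using A(2)[of m] by (auto simp: S_def not_le[symmetric])
  have "(\<Sum>q\<le>n. b q * A q) = (\<Sum>q\<le>m. b q * A q)"
    using m(2) mR by (intro sum.mono_neutral_right) (auto simp: S_def)
  also have "\<dots> = (\<Sum>p<m. b p * A p) + b m * A m"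
    by (simp add: lessThan_Suc_atMost[symmetric])
  finally have "b m * A m = - (\<Sum>p<m. b p * A p)" using 0 by simp
  then have "\<bar>b m * A m\<bar> = \<bar>\<Sum>p<m. b p * A p\<bar>" by simp
  also have "\<dots> \<le> (\<Sum>p<m. \<bar>b p * A p\<bar>)" by (rule sum_abs)
  also have "\<dots> \<le> (\<Sum>p<m. K * b p)"
    by (intro sum_mono) (use b(1) A(1) in \<open>auto simp: abs_mult mult.commute[of K] intro: mult_left_mono\<close>)
  also have "\<dots> = K * (\<Sum>p<m. b p)" by (simp add: sum_distrib_left)
  finally have le: "\<bar>b m * A m\<bar> \<le> K * (\<Sum>p<m. b p)" .
  have ge: "b m \<le> \<bar>b m * A m\<bar>"
    using b(1)[of m] mR mult_left_mono[of 1 "\<bar>A m\<bar>" "b m"] by (auto simp: abs_mult)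
  show False
  proof (cases "m = 0")
    case True then show ?thesis using le ge b(2) by simp
  next
    case False then show ?thesis using le ge b(3)[of m] mR by simp
  qed
qed

lemma sum_Pow_card:
  fixes A :: "nat \<Rightarrow> int"
  assumes "finite P"
  shows "(\<Sum>Q\<in>Pow P. A (card Q)) = (\<Sum>q\<le>card P. int (card P choose q) * A q)"
proof -
  have "(\<Sum>Q\<in>Pow P. A (card Q)) = (\<Sum>q\<le>card P. \<Sum>Q\<in>{Q\<in>Pow P. card Q = q}. A (card Q))"
    using assms by (intro sum.group[symmetric]) (auto intro: card_mono)
  also have "\<dots> = (\<Sum>q\<le>card P. int (card P choose q) * A q)"
  proof (intro sum.cong refl)
    fix q
    have "(\<Sum>Q\<in>{Q\<in>Pow P. card Q = q}. A (card Q)) = (\<Sum>Q\<in>{Q\<in>Pow P. card Q = q}. A q)"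
      by (intro sum.cong) auto
    also have "\<dots> = int (card P choose q) * A q"
      using n_subsets[OF assms, of q] by (simp add: Pow_def)
    finally show "(\<Sum>Q\<in>{Q\<in>Pow P. card Q = q}. A (card Q)) = int (card P choose q) * A q" .
  qed
  finally show ?thesis .
qed

text \<open>In the application x counts the edges of a block of size \<open>G m\<close> that lie
  outside the parameters; the parameters take away at most R edges, hence \<open>x + R\<close>. The
  factor \<open>M * 2 ^ m\<close> bounds a sum of weights of absolute value at most M over the
  closed sets of the m earlier edges.\<close>

definition fast_growing :: "nat \<Rightarrow> nat \<Rightarrow> (nat \<Rightarrow> nat) \<Rightarrow> bool" where
  "fast_growing R M G \<longleftrightarrow>
     (\<forall>m x q. G m \<le> x + R \<longrightarrow> 0 < q \<longrightarrow> q \<le> R \<longrightarrow> M * 2 ^ m * (\<Sum>p<q. x choose p) < x choose q) \<and>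
     (\<forall>m. R < G m)"

lemma local_iso_id: "down_closed A C \<Longrightarrow> local_iso A A C (\<lambda>e. e)"
  by (auto simp: local_iso_def)

definition above :: "'a edge_structure \<Rightarrow> 'a set \<Rightarrow> 'a set set" where
  "above A D = {C. down_closed A C \<and> D \<subseteq> C}"

text \<open>A closed set is determined by its part before the last block and the edges it takes from
  the block; by invariance only their number q matters. Grouping the sum by q, the size of the
  block makes the binomial coefficients dominate everything else, so the sum over each group
  vanishes, and the induction hypothesis applies to the forest without the block.\<close>

lemma generic_no_cancellation:
  fixes W :: "nat set \<Rightarrow> int"
  assumes "generic G T" and G: "fast_growing R M G"
    and "down_closed (list_structure T) D"
    and "\<And>C. C \<in> above (list_structure T) D \<Longrightarrow> \<bar>W C\<bar> \<le> int M"
    and "\<And>C. C \<in> above (list_structure T) D \<Longrightarrow> R < card C \<Longrightarrow> W C = 0"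
    and "\<And>C h. C \<in> above (list_structure T) D \<Longrightarrow> local_iso (list_structure T) (list_structure T) C h \<Longrightarrow>
           (\<forall>e\<in>D. h e = e) \<Longrightarrow> W (h ` C) = W C"
    and "(\<Sum>C\<in>above (list_structure T) D. W C) = 0"
    and "C \<in> above (list_structure T) D"
  shows "W C = 0"
  using assms(1,3-)
proof (induction arbitrary: D W C)
  case Nil
  have "above (list_structure []) D = {{}}"
    using Nil(1) by (auto simp: above_def down_closed_def list_structure_def)
  then show ?case using Nil by simp
next
  case (block T p a D W C)
  define T' where "T' = T @ replicate (G (length T)) (p, a)"
  define A where "A = list_structure T"
  define A' where "A' = list_structure T'"
  define N where "N = length T"
  define X where "X = {N..<N + G N}"
  define Q0 where "Q0 = D \<inter> X"
  define P where "P = X - Q0"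
  define D' where "D' = D \<inter> {..<N}"
  define x where "x = card P"
  note prems = block.prems[folded T'_def, folded A'_def]
  have lenT': "length T' = N + G N" by (simp add: T'_def N_def)
  have uA: "universe A = {..<N}" and uA': "universe A' = {..<N} \<union> X"
    by (auto simp: A_def A'_def list_structure_def lenT' N_def X_def)
  have nth: "j < N \<Longrightarrow> T' ! j = T ! j" "j \<in> X \<Longrightarrow> T' ! j = (p, a)" for j
    by (auto simp: T'_def N_def X_def nth_append)
  have old: "parent A' j = parent A j" "has_label A' b j = has_label A b j" if "j < N" for j b
    using nth(1)[OF that] by (simp_all add: A_def A'_def list_structure_def)
  have new: "parent A' j = (case p of 0 \<Rightarrow> j | Suc u \<Rightarrow> u)" "has_label A' b j \<longleftrightarrow> b = a" if "j \<in> X" for j b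
    using nth(2)[OF that] by (auto simp: A_def A'_def list_structure_def)
  have pN: "p \<le> N" using block.hyps by (simp add: N_def)
  have dc_univ: "down_closed A (universe A)"
    using generic_down_closed[OF block.hyps(1)] by (simp add: A_def list_structure_def)
  have parA: "parent A j < N" if "j < N" for j
    using dc_univ that by (auto simp: down_closed_def uA)
  have disj: "{..<N} \<inter> X = {}" by (auto simp: X_def)
  \<comment> \<open>Edges of one block are siblings, so among them closedness asks only for the
    common parent, and only if the block is touched at all.\<close>
  define ok where "ok C Q \<longleftrightarrow> Q = {} \<or> (\<forall>u. p = Suc u \<longrightarrow> u \<in> C)" for C Q :: "nat set"
  have dc_iff: "down_closed A' (E \<union> Q) \<longleftrightarrow> down_closed A E \<and> ok E Q"
    if "E \<subseteq> {..<N}" "Q \<subseteq> X" for E Q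
  proof
    assume L: "down_closed A' (E \<union> Q)"
    then have "parent A' ` E \<subseteq> E \<union> Q" by (auto simp: down_closed_def)
    have "parent A j \<in> E" if "j \<in> E" for j
    proof -
      have j: "j < N" "parent A' j \<in> E \<union> Q"
        using that \<open>E \<subseteq> {..<N}\<close> \<open>parent A' ` E \<subseteq> E \<union> Q\<close> by auto
      then have "parent A j \<notin> X" using parA[of j] disj by auto
      then show ?thesis using j old(1) \<open>Q \<subseteq> X\<close> by auto
    qed
    moreover have "u \<in> E" if "j \<in> Q" "p = Suc u" for u j
    proof -
      have "parent A' j = u" using that \<open>Q \<subseteq> X\<close> new(1)[of j] by auto
      then have "u \<in> E \<union> Q" using L that(1) by (auto simp: down_closed_def)
      moreover have "u < N" using pN that by simp
      ultimately show ?thesis using \<open>Q \<subseteq> X\<close> disj by auto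
    qed
    ultimately show "down_closed A E \<and> ok E Q"
      using that by (auto simp: down_closed_def uA ok_def)
  next
    assume R: "down_closed A E \<and> ok E Q"
    have "parent A' j \<in> E \<union> Q" if "j \<in> E" for j
    proof -
      have "j < N" using that \<open>E \<subseteq> {..<N}\<close> by auto
      moreover have "parent A j \<in> E" using R that by (auto simp: down_closed_def)
      ultimately show ?thesis by (simp add: old(1))
    qed
    moreover have "parent A' j \<in> E \<union> Q" if "j \<in> Q" for j
    proof -
      have "j \<in> X" using that \<open>Q \<subseteq> X\<close> by auto
      then show ?thesis using R that by (cases p) (auto simp: new(1) ok_def)
    qed
    ultimately show "down_closed A' (E \<union> Q)" using that uA' by (auto simp: down_closed_def)
  qed
  have D: "D = D' \<union> Q0" "D' \<subseteq> {..<N}" "Q0 \<subseteq> X"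
    using prems(1) by (auto simp: D'_def Q0_def down_closed_def uA')
  then have dcD': "down_closed A D'" and okD: "ok D' Q0" using prems(1) dc_iff by auto
  have finX: "finite X" by (simp add: X_def)
  then have finP: "finite P" "finite Q0" using finite_subset[OF D(3)] by (simp_all add: P_def)
  \<comment> \<open>As soon as a closed set touches the block, the ancestors of the parent of the
    block are forced. So the old parts of the closed sets that take q further edges of the block are
    the closed sets above \<open>Dq q\<close>, and the induction hypothesis will be applied with
    this base.\<close>
  define Dq where "Dq q = (if Q0 = {} \<and> q = 0 then D' else D' \<union> ancestors A {u. p = Suc u})" for q :: nat
  have pu: "{u. p = Suc u} \<subseteq> universe A" unfolding uA using pN by auto
  have dcDq: "down_closed A (Dq q)" for q
    using dcD' down_closed_Un[OF dcD' down_closed_ancestors[OF dc_univ pu]] by (simp add: Dq_def)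
  have aboveDq: "E \<in> above A (Dq (card Q)) \<longleftrightarrow> down_closed A E \<and> D' \<subseteq> E \<and> ok E (Q0 \<union> Q)"
    if "Q \<subseteq> P" for E Q
  proof -
    have "finite Q" using finite_subset[OF that finP(1)] .
    have "ancestors A {u. p = Suc u} \<subseteq> E \<longleftrightarrow> (\<forall>u. p = Suc u \<longrightarrow> u \<in> E)" if "down_closed A E"
      using ancestors_least[OF that, of "{u. p = Suc u}"] ancestors_superset[of "{u. p = Suc u}" A] by auto
    then show ?thesis
      using \<open>finite Q\<close> by (auto simp: above_def Dq_def ok_def)
  qed
  \<comment> \<open>A closed set above D amounts to the set Q of its block edges outside D together
    with its old part E.\<close>
  let ?f = "\<lambda>(Q, E). E \<union> (Q0 \<union> Q)" and ?S = "SIGMA Q:Pow P. above A (Dq (card Q))"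
  have bij: "bij_betw ?f ?S (above A' D)"
  proof (rule bij_betw_byWitness[where f' = "\<lambda>C. (C \<inter> P, C \<inter> {..<N})"])
    show "\<forall>y\<in>?S. (?f y \<inter> P, ?f y \<inter> {..<N}) = y"
    proof
      fix y assume "y \<in> ?S"
      then obtain Q E where y: "y = (Q, E)" "Q \<subseteq> P" "E \<in> above A (Dq (card Q))" by auto
      then have "E \<subseteq> {..<N}" "Q \<subseteq> X" "Q \<inter> Q0 = {}" by (auto simp: above_def down_closed_def uA P_def)
      then have "(E \<union> (Q0 \<union> Q)) \<inter> P = Q" "(E \<union> (Q0 \<union> Q)) \<inter> {..<N} = E"
        using disj \<open>Q0 \<subseteq> X\<close> \<open>Q \<subseteq> P\<close> by (auto simp: P_def)
      then show "(?f y \<inter> P, ?f y \<inter> {..<N}) = y"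
        by (simp add: y(1))
    qed
    have split: "(C \<inter> {..<N}) \<union> (Q0 \<union> (C \<inter> P)) = C" if "C \<in> above A' D" for C
      using that D by (auto simp: above_def down_closed_def uA' P_def)
    then show "\<forall>C\<in>above A' D. ?f (C \<inter> P, C \<inter> {..<N}) = C" by simp
    show "?f ` ?S \<subseteq> above A' D"
    proof
      fix y assume "y \<in> ?f ` ?S"
      then obtain Q E where y: "y = E \<union> (Q0 \<union> Q)" and Q: "Q \<subseteq> P" and "E \<in> above A (Dq (card Q))" by auto
      then have "down_closed A E" "D' \<subseteq> E" "ok E (Q0 \<union> Q)" using aboveDq by auto
      moreover have "E \<subseteq> {..<N}" "Q0 \<union> Q \<subseteq> X" using \<open>down_closed A E\<close> Q D by (auto simp: down_closed_def uA P_def)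
      ultimately show "y \<in> above A' D"
        using dc_iff[of E "Q0 \<union> Q"] D y by (auto simp: above_def)
    qed
    show "(\<lambda>C. (C \<inter> P, C \<inter> {..<N})) ` above A' D \<subseteq> ?S"
    proof
      fix y assume "y \<in> (\<lambda>C. (C \<inter> P, C \<inter> {..<N})) ` above A' D"
      then obtain C where y: "y = (C \<inter> P, C \<inter> {..<N})" and C: "C \<in> above A' D" by auto
      have "down_closed A' ((C \<inter> {..<N}) \<union> (Q0 \<union> (C \<inter> P)))" using C split by (auto simp: above_def)
      then have "down_closed A (C \<inter> {..<N})" "ok (C \<inter> {..<N}) (Q0 \<union> (C \<inter> P))"
        using dc_iff[of "C \<inter> {..<N}" "Q0 \<union> (C \<inter> P)"] D by (auto simp: P_def)
      moreover have "D' \<subseteq> C \<inter> {..<N}" using C D by (auto simp: above_def)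
      ultimately show "y \<in> ?S"
        using aboveDq[of "C \<inter> P"] y by auto
    qed
  qed
  have in_above: "E \<union> (Q0 \<union> Q) \<in> above A' D" if "Q \<subseteq> P" "E \<in> above A (Dq (card Q))" for E Q
    using bij that by (auto simp: bij_betw_def)
  \<comment> \<open>A local isomorphism of the old part that fixes the parent of the block is
    compatible with every bijection between block edges, because these all have the same parent and
    label.\<close>
  have iso: "local_iso A' A' (E \<union> Q) h'"
    if "E \<subseteq> {..<N}" "Q \<subseteq> X" "down_closed A E" "ok E Q" "local_iso A A E h" "ok (h ` E) Q'"
      "\<forall>u. p = Suc u \<longrightarrow> Q \<noteq> {} \<longrightarrow> h u = u"
      "\<forall>e\<in>E. h' e = h e" "bij_betw h' Q Q'" "Q' \<subseteq> X" for E Q Q' h h'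
  proof -
    have hE: "h ` E \<subseteq> {..<N}" "inj_on h E" "down_closed A (h ` E)"
      using that(5) uA by (auto simp: local_iso_def down_closed_def)
    have imgs: "h' ` E = h ` E" "h' ` Q = Q'" using that(8,9) by (simp_all add: bij_betw_def cong: image_cong)
    then have img: "h' ` (E \<union> Q) = h ` E \<union> Q'" by (simp add: image_Un)
    have "inj_on h' (E \<union> Q)"
      unfolding inj_on_Un
    proof (intro conjI)
      show "inj_on h' E" using hE(2) that(8) by (simp add: inj_on_def)
      show "inj_on h' Q" using that(9) by (simp add: bij_betw_def)
      have "h' ` E \<inter> h' ` Q = {}" unfolding imgs using hE(1) that(10) disj by blast
      then show "h' ` (E - Q) \<inter> h' ` (Q - E) = {}" by blast
    qed
    moreover have "down_closed A' (E \<union> Q)" "down_closed A' (h ` E \<union> Q')"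
      using that hE dc_iff by auto
    moreover have "parent A' (h' e) = h' (parent A' e) \<and> (\<forall>b. has_label A' b (h' e) = has_label A' b e)"
      if "e \<in> E" for e
    proof -
      have "e < N" "h e < N" using that hE(1) \<open>E \<subseteq> {..<N}\<close> by auto
      moreover have "parent A e \<in> E" using \<open>down_closed A E\<close> that by (auto simp: down_closed_def)
      ultimately show ?thesis
        using \<open>local_iso A A E h\<close> that \<open>\<forall>e\<in>E. h' e = h e\<close> by (simp add: old local_iso_def)
    qed
    moreover have "parent A' (h' e) = h' (parent A' e) \<and> (\<forall>b. has_label A' b (h' e) = has_label A' b e)"
      if e: "e \<in> Q" for e
    proof -
      have "e \<in> X" "h' e \<in> X" using e \<open>Q \<subseteq> X\<close> \<open>Q' \<subseteq> X\<close> \<open>bij_betw h' Q Q'\<close> by (auto simp: bij_betw_def)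
      moreover have "h' u = u" if "p = Suc u" for u
      proof -
        have "u \<in> E" using \<open>ok E Q\<close> e that by (auto simp: ok_def)
        then show ?thesis using \<open>\<forall>e\<in>E. h' e = h e\<close> \<open>\<forall>u. p = Suc u \<longrightarrow> Q \<noteq> {} \<longrightarrow> h u = u\<close> that e by auto
      qed
      ultimately show ?thesis by (auto simp: new split: nat.split)
    qed
    ultimately show ?thesis unfolding local_iso_def img by blast
  qed
  \<comment> \<open>Exchanging Q for a set of the same size moves nothing in the old part or in D,
    so invariance applies and W sees only the size of Q.\<close>
  have W_card: "W (E \<union> (Q0 \<union> Q)) = W (E \<union> (Q0 \<union> Q'))"
    if "Q \<subseteq> P" "Q' \<subseteq> P" and cards: "card Q = card Q'" and "E \<in> above A (Dq (card Q))" for E Q Q'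
  proof -
    have "finite Q" "finite Q'"
      using finite_subset[OF that(1) finP(1)] finite_subset[OF that(2) finP(1)] .
    then obtain f where f: "bij_betw f Q Q'" using cards finite_same_card_bij by blast
    define h' where "h' e = (if e \<in> Q then f e else e)" for e
    have E: "E \<subseteq> {..<N}" "down_closed A E" using that(4) by (auto simp: above_def down_closed_def uA)
    have QX: "Q0 \<union> Q \<subseteq> X" "Q0 \<union> Q' \<subseteq> X" using that D by (auto simp: P_def)
    have okE: "ok E (Q0 \<union> Q)" "ok E (Q0 \<union> Q')" and D'E: "D' \<subseteq> E"
      using aboveDq[OF that(1), of E] aboveDq[OF that(2), of E] that(4) cards by auto
    have h'E: "\<forall>e\<in>E. h' e = e" using E(1) QX disj by (auto simp: h'_def)
    have h'Q0: "\<forall>e\<in>Q0. h' e = e" using that by (auto simp: h'_def P_def)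
    have h'Q: "bij_betw h' Q Q'" using f bij_betw_cong[of Q h' f] by (simp add: h'_def)
    have "bij_betw h' (Q0 \<union> Q) (Q0 \<union> Q')"
    proof (rule bij_betw_combine)
      show "bij_betw h' Q0 Q0" using h'Q0 by (auto simp: bij_betw_def inj_on_def)
    qed (use h'Q that in \<open>auto simp: P_def\<close>)
    then have "local_iso A' A' (E \<union> (Q0 \<union> Q)) h'"
      using iso[OF E(1) QX(1) E(2) okE(1) local_iso_id[OF E(2)], of "Q0 \<union> Q'" h'] okE(2) h'E QX by simp
    moreover have "h' ` (E \<union> (Q0 \<union> Q)) = E \<union> (Q0 \<union> Q')"
    proof -
      have "h' ` E = E" "h' ` Q0 = Q0" "h' ` Q = Q'"
        using h'E h'Q0 h'Q by (simp_all add: bij_betw_def cong: image_cong)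
      then show ?thesis by (simp add: image_Un)
    qed
    moreover have "\<forall>e\<in>D. h' e = e"
      using h'E h'Q0 D(1) D'E by blast
    ultimately show ?thesis using prems(4)[OF in_above[OF that(1,4)], of h'] by simp
  qed
  define Pq where "Pq q = (SOME Q. Q \<subseteq> P \<and> card Q = q)" for q
  have Pq: "Pq q \<subseteq> P" "card (Pq q) = q" if "q \<le> x" for q
  proof -
    have "\<exists>Q. Q \<subseteq> P \<and> card Q = q" using that by (metis x_def obtain_subset_with_card_n)
    from someI_ex[OF this] show "Pq q \<subseteq> P" "card (Pq q) = q" by (auto simp: Pq_def)
  qed
  define W' where "W' q E = W (E \<union> (Q0 \<union> Pq q))" for q E
  \<comment> \<open>The cut-off matters because \<open>Pq q\<close> is an arbitrary set for q >
    x.\<close>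
  define S where "S q = (if q \<le> x then \<Sum>E\<in>above A (Dq q). W' q E else 0)" for q
  have fin_above: "finite (above A E)" and card_above: "card (above A E) \<le> 2 ^ N" for E
  proof -
    have "above A E \<subseteq> Pow {..<N}" by (auto simp: above_def down_closed_def uA)
    then show "finite (above A E)" "card (above A E) \<le> 2 ^ N"
      using finite_subset[of "above A E"] card_mono[of "Pow {..<N}" "above A E"] by (auto simp: card_Pow)
  qed
  have x_large: "G N \<le> x + R \<and> R < x + card Q0" if "card D \<le> R"
  proof -
    have "x = G N - card Q0"
      using card_Diff_subset[OF finP(2) D(3)] by (simp add: x_def P_def X_def)
    moreover have "finite D" using finite_subset[OF D(2)] finP(2) by (subst D(1)) simp
    then have "card Q0 \<le> card D" by (rule card_mono) (simp add: Q0_def)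
    moreover have "R < G N" using G by (simp add: fast_growing_def)
    ultimately show ?thesis using that by simp
  qed
  have finite_above': "finite E" if "E \<in> above A' D" for E
  proof (rule finite_subset)
    show "E \<subseteq> {..<N} \<union> X" using that by (auto simp: above_def down_closed_def uA')
  qed (simp add: finX)
  show ?case
  \<comment> \<open>If D has more than R edges, then so has every closed set above it, and W
    vanishes on all of them by assumption.\<close>
  proof (cases "card D \<le> R")
    case False
    have "card D \<le> card C" using prems(6) finite_above' by (intro card_mono) (auto simp: above_def)
    then show ?thesis using prems(3)[OF prems(6)] False by simp
  next
    case True
    have "S q = 0" if "q \<le> x" for q
    \<comment> \<open>K is the weight bound M times the number of possible old parts, at most 2 ^ N.
      For q > R the closed sets in question are too large to carry weight.\<close>
    proof (rule dominated_sum_zero[where b = "\<lambda>q. int (x choose q)" and K = "int (M * 2 ^ N)" and R = R and n = x])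
      show "\<bar>S q\<bar> \<le> int (M * 2 ^ N)" for q
      proof (cases "q \<le> x")
        case True
        have "\<bar>\<Sum>E\<in>above A (Dq q). W' q E\<bar> \<le> (\<Sum>E\<in>above A (Dq q). \<bar>W' q E\<bar>)" by (rule sum_abs)
        also have "\<dots> \<le> (\<Sum>E\<in>above A (Dq q). int M)"
          using prems(2)[OF in_above[of "Pq q"]] Pq[OF True] by (intro sum_mono) (auto simp: W'_def)
        also have "\<dots> = int (card (above A (Dq q)) * M)" by simp
        also have "\<dots> \<le> int (M * 2 ^ N)"
          using mult_right_mono[OF card_above[of "Dq q"], of M] by (simp only: of_nat_le_iff mult.commute[of M])
        finally show ?thesis using True by (simp add: S_def)
      qed (simp add: S_def)
      show "S q = 0" if "R < q" for q
      proof (cases "q \<le> x")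
        case True
        have "W' q E = 0" if E: "E \<in> above A (Dq q)" for E
        proof -
          have mem: "E \<union> (Q0 \<union> Pq q) \<in> above A' D" using in_above Pq[OF True] E by simp
          have "card (Pq q) \<le> card (E \<union> (Q0 \<union> Pq q))"
            using finite_above'[OF mem] by (intro card_mono) auto
          then show ?thesis using prems(3)[OF mem] Pq(2)[OF True] \<open>R < q\<close> by (simp add: W'_def)
        qed
        then show ?thesis by (simp add: S_def)
      qed (simp add: S_def)
      show "int (M * 2 ^ N) * (\<Sum>p<q. int (x choose p)) < int (x choose q)" if "0 < q" "q \<le> R" for q
      proof -
        have "M * 2 ^ N * (\<Sum>p<q. x choose p) < x choose q"
          using G x_large[OF True] that by (simp add: fast_growing_def)
        then show ?thesis by (metis of_nat_less_iff of_nat_mult of_nat_sum)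
      qed
      have "0 = (\<Sum>C\<in>above A' D. W C)" using prems(5) by simp
      also have "\<dots> = (\<Sum>(Q, E)\<in>(SIGMA Q:Pow P. above A (Dq (card Q))). W (E \<union> (Q0 \<union> Q)))"
        using sum.reindex_bij_betw[OF bij, of W] by (simp add: case_prod_unfold)
      also have "\<dots> = (\<Sum>Q\<in>Pow P. \<Sum>E\<in>above A (Dq (card Q)). W (E \<union> (Q0 \<union> Q)))"
        by (rule sum.Sigma[symmetric]) (simp_all add: finP fin_above)
      also have "\<dots> = (\<Sum>Q\<in>Pow P. S (card Q))"
      proof (intro sum.cong refl)
        fix Q assume "Q \<in> Pow P"
        then have Q: "Q \<subseteq> P" "card Q \<le> x" using finP by (auto simp: x_def card_mono)
        show "(\<Sum>E\<in>above A (Dq (card Q)). W (E \<union> (Q0 \<union> Q))) = S (card Q)"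
          using W_card[OF Q(1) Pq(1)[OF Q(2)]] Pq(2)[OF Q(2)] Q(2)
          by (auto simp: S_def W'_def intro: sum.cong)
      qed
      also have "\<dots> = (\<Sum>q\<le>x. int (x choose q) * S q)"
        using sum_Pow_card[OF finP(1), of S] by (simp add: x_def)
      finally show "(\<Sum>q\<le>x. int (x choose q) * S q) = 0" by simp
    qed (use that in auto)
    then have S0: "(\<Sum>E\<in>above A (Dq q). W' q E) = 0" if "q \<le> x" for q
      using that by (simp add: S_def)
    have W'0: "W' q E = 0" if q: "q \<le> x" and "E \<in> above A (Dq q)" for q E
    proof (rule block.IH[folded A_def, OF dcDq _ _ _ S0[OF q] that(2)])
      fix E assume E: "E \<in> above A (Dq q)"
      have mem: "E \<union> (Q0 \<union> Pq q) \<in> above A' D" using in_above Pq[OF q] E by simp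
      show "\<bar>W' q E\<bar> \<le> int M" using prems(2)[OF mem] by (simp add: W'_def)
      show "W' q E = 0" if "R < card E"
      proof -
        have "card E \<le> card (E \<union> (Q0 \<union> Pq q))"
          using finite_above'[OF mem] by (intro card_mono) auto
        then show ?thesis using prems(3)[OF mem] that by (simp add: W'_def)
      qed
      \<comment> \<open>Since h fixes \<open>Dq q\<close>, it fixes the parent of the block whenever
        block edges occur. Extended by the identity on the block, it is a local isomorphism of the
        larger forest, and so the invariance of W passes to \<open>W' q\<close>.\<close>
      fix h assume h: "local_iso A A E h" "\<forall>e\<in>Dq q. h e = e"
      define Q where "Q = Q0 \<union> Pq q"
      have QX: "Q \<subseteq> X" using D Pq[OF q] by (auto simp: Q_def P_def)
      have "down_closed A E \<and> D' \<subseteq> E \<and> ok E Q"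
        using aboveDq[OF Pq(1)[OF q]] Pq(2)[OF q] E by (simp add: Q_def)
      then have E': "down_closed A E" "D' \<subseteq> E" "ok E Q" "E \<subseteq> {..<N}" by (auto simp: down_closed_def uA)
      define h' where "h' e = (if e \<in> E then h e else e)" for e
      have hu: "h u = u" if "p = Suc u" "Q \<noteq> {}" for u
      proof -
        have "u \<in> Dq q"
          using that ancestors_superset[of "{u. p = Suc u}" A] Pq(2)[OF q] finite_subset[OF Pq(1)[OF q] finP(1)]
          by (auto simp: Dq_def Q_def)
        then show ?thesis using h(2) by simp
      qed
      have okh: "ok (h ` E) Q" using E'(3) hu unfolding ok_def by (metis imageI)
      have idQ: "\<forall>e\<in>Q. h' e = e" using QX E'(4) disj by (auto simp: h'_def)
      have "local_iso A' A' (E \<union> Q) h'"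
        by (rule iso[OF E'(4) QX E'(1,3) h(1) okh _ _ _ QX])
          (use hu idQ in \<open>auto simp: h'_def bij_betw_def inj_on_def\<close>)
      moreover have "\<forall>e\<in>D. h' e = e"
      proof -
        have "h' e = e" if "e \<in> D'" for e using that h(2) by (auto simp: Dq_def h'_def split: if_splits)
        moreover have "h' e = e" if "e \<in> Q0" for e using that idQ unfolding Q_def by blast
        ultimately show ?thesis using D(1) by blast
      qed
      moreover have "h' ` (E \<union> Q) = h ` E \<union> Q"
      proof -
        have "h' ` E = h ` E" by (intro image_cong) (simp_all add: h'_def)
        moreover have "h' ` Q = Q" using idQ by (simp cong: image_cong)
        ultimately show ?thesis by (simp add: image_Un)
      qed
      ultimately show "W' q (h ` E) = W' q E"
        using prems(4)[OF mem, of h'] by (simp add: W'_def Q_def)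
    qed
    have "C \<in> (\<lambda>(Q, E). E \<union> (Q0 \<union> Q)) ` (SIGMA Q:Pow P. above A (Dq (card Q)))"
      using bij_betw_imp_surj_on[OF bij] prems(6) by simp
    then obtain Q E where QE: "Q \<subseteq> P" "E \<in> above A (Dq (card Q))" "C = E \<union> (Q0 \<union> Q)" by auto
    have q: "card Q \<le> x" using QE(1) finP by (simp add: x_def card_mono)
    then show ?thesis
      using W_card[OF QE(1) Pq(1)[OF q] Pq(2)[OF q, symmetric] QE(2)] W'0[OF q QE(2)] QE(3) by (simp add: W'_def)
  qed
qed

section \<open>Local isomorphisms\<close>

lemma local_iso_funpow:
  assumes "local_iso A B C h" "e \<in> C" shows "(parent B ^^ i) (h e) = h ((parent A ^^ i) e)"
proof (induction i)
  case (Suc i)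
  have "(parent A ^^ i) e \<in> C" using down_closed_funpow assms by (auto simp: local_iso_def)
  then show ?case using Suc assms(1) by (simp add: local_iso_def)
qed simp

lemma local_iso_ancestors:
  assumes "local_iso A B C h" "S \<subseteq> C" shows "ancestors B (h ` S) = h ` ancestors A S"
proof -
  have *: "(parent B ^^ i) (h e) = h ((parent A ^^ i) e)" if "e \<in> S" for e i
    using local_iso_funpow[OF assms(1)] assms(2) that by blast
  show ?thesis
  proof
    show "ancestors B (h ` S) \<subseteq> h ` ancestors A S"
      unfolding ancestors_def using * by blast
    show "h ` ancestors A S \<subseteq> ancestors B (h ` S)"
    proof
      fix y assume "y \<in> h ` ancestors A S"
      then obtain e i where "e \<in> S" "y = h ((parent A ^^ i) e)" unfolding ancestors_def by blast
      then have "y = (parent B ^^ i) (h e)" "h e \<in> h ` S" using * by simp_all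
      then show "y \<in> ancestors B (h ` S)" unfolding ancestors_def by blast
    qed
  qed
qed

lemma local_iso_image_subset: "local_iso A B C h \<Longrightarrow> S \<subseteq> C \<Longrightarrow> h ` S \<subseteq> universe B"
proof -
  assume "local_iso A B C h" "S \<subseteq> C"
  then have "h ` C \<subseteq> universe B" "h ` S \<subseteq> h ` C" by (simp_all add: local_iso_def down_closed_def image_mono)
  then show ?thesis by simp
qed

lemma local_iso_subset:
  assumes "local_iso A B C h" "down_closed A C'" "C' \<subseteq> C" shows "local_iso A B C' h"
proof -
  have "down_closed B (h ` C')"
  proof -
    have "h ` C' \<subseteq> universe B" using local_iso_image_subset assms by blast
    moreover have "parent B (h e) \<in> h ` C'" if "e \<in> C'" for e
    proof -
      have "parent B (h e) = h (parent A e)" "parent A e \<in> C'"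
        using assms that by (auto simp: local_iso_def down_closed_def)
      then show ?thesis by simp
    qed
    ultimately show ?thesis by (auto simp: down_closed_def)
  qed
  then show ?thesis using assms inj_on_subset[of h C C'] by (auto simp: local_iso_def)
qed

lemma local_iso_inv:
  assumes "local_iso A B C h" shows "local_iso B A (h ` C) (inv_into C h)"
proof -
  have inj: "inj_on h C" using assms by (simp add: local_iso_def)
  have "inv_into C h ` h ` C = C" using inv_into_image_cancel[OF inj order_refl] .
  moreover have "inj_on (inv_into C h) (h ` C)" by (rule inj_on_inv_into) simp
  moreover have "parent A (inv_into C h (h e)) = inv_into C h (parent B (h e)) \<and>
      (\<forall>a. has_label A a (inv_into C h (h e)) = has_label B a (h e))" if "e \<in> C" for e
  proof -
    have "parent A e \<in> C" using assms that by (auto simp: local_iso_def down_closed_def)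
    then show ?thesis using assms that inj by (simp add: local_iso_def)
  qed
  ultimately show ?thesis using assms by (auto simp: local_iso_def)
qed

lemma local_iso_comp:
  assumes h: "local_iso A B C h" and g: "local_iso B E (h ` C) g" shows "local_iso A E C (\<lambda>x. g (h x))"
proof -
  have "inj_on (g \<circ> h) C" using h g by (intro comp_inj_on) (auto simp: local_iso_def)
  then have "inj_on (\<lambda>x. g (h x)) C" by (simp add: comp_def)
  moreover have "(\<lambda>x. g (h x)) ` C = g ` h ` C" by auto
  ultimately show ?thesis using h g by (simp add: local_iso_def)
qed

lemma tm_val_in:
  assumes "down_closed A C" "set xs \<subseteq> C" "tm_vars s \<subseteq> {..<length xs}"
  shows "tm_val A xs s \<in> C"
  using assms by (induction s) (auto simp: down_closed_def)

lemma local_iso_tm_val: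
  assumes "local_iso A B C h" "set xs \<subseteq> C" "tm_vars s \<subseteq> {..<length xs}"
  shows "tm_val B (map h xs) s = h (tm_val A xs s)"
  using assms(3)
proof (induction s)
  case (Par s)
  then have "tm_val A xs s \<in> C" using assms tm_val_in by (auto simp: local_iso_def)
  then show ?case using Par assms by (simp add: local_iso_def)
qed simp

lemma local_iso_qf_sat:
  assumes "local_iso A B C h" "set xs \<subseteq> C" "qf_vars \<phi> \<subseteq> {..<length xs}"
  shows "qf_sat B (map h xs) \<phi> \<longleftrightarrow> qf_sat A xs \<phi>"
  using assms(3)
proof (induction \<phi>)
  case (LabelF a s)
  then have "tm_val A xs s \<in> C" using assms tm_val_in by (auto simp: local_iso_def)
  then show ?case using LabelF assms local_iso_tm_val[OF assms(1,2)] by (simp add: local_iso_def)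
next
  case (EqF s s')
  then have "tm_val A xs s \<in> C" "tm_val A xs s' \<in> C" using assms tm_val_in by (auto simp: local_iso_def)
  then show ?case using EqF assms local_iso_tm_val[OF assms(1,2)] by (auto simp: local_iso_def dest: inj_onD)
qed simp_all

section \<open>Output nodes and their colours\<close>

text \<open>A node (p, i, xs) is the output node (i, xs) of the interpretation p; the number of
  components of p is used as index i of an additional node whose children are all output nodes.\<close>

type_synonym 'a onode = "qf_interp \<times> nat \<times> 'a list"

definition children :: "'a edge_structure \<Rightarrow> 'a onode \<Rightarrow> 'a onode set" where
  "children A = (\<lambda>(p, i, xs). {(q, j, ys). q = p \<and> (j, ys) \<in> output_universe p A \<and>
     (i = length (components p) \<or> qf_sat A (xs @ ys) (child_formula p i j))})"

text \<open>Coding the sorted list as a number, instead of nesting multisets, gives colours of one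
  type at all depths and over all structures; these numbers are also what the program
  computes.\<close>

primrec colour :: "'a edge_structure \<Rightarrow> nat \<Rightarrow> 'a onode \<Rightarrow> nat" where
  "colour A 0 v = 0"
| "colour A (Suc m) v =
     list_encode (sorted_list_of_multiset (image_mset (colour A m) (mset_set (children A v))))"

lemma colour_Suc_eq_iff:
  "colour A (Suc m) v = colour B (Suc n) w \<longleftrightarrow>
     image_mset (colour A m) (mset_set (children A v)) = image_mset (colour B n) (mset_set (children B w))"
  by (auto simp: list_encode_eq) (metis mset_sorted_list_of_multiset)

definition entries :: "'a onode \<Rightarrow> 'a set" where
  "entries v = set (snd (snd v))"

definition map_node :: "('a \<Rightarrow> 'b) \<Rightarrow> 'a onode \<Rightarrow> 'b onode" where
  "map_node h v = (fst v, fst (snd v), map h (snd (snd v)))"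

definition bounded_interp :: "nat \<Rightarrow> qf_interp \<Rightarrow> bool" where
  "bounded_interp d p \<longleftrightarrow> (\<exists>\<Sigma>. wf_interpretation \<Sigma> p) \<and> length (components p) \<le> d \<and>
     (\<forall>j<length (components p). dimension p j \<le> d)"

definition onode :: "nat \<Rightarrow> 'a edge_structure \<Rightarrow> 'a onode \<Rightarrow> bool" where
  "onode d A = (\<lambda>(p, i, xs). bounded_interp d p \<and> set xs \<subseteq> universe A \<and>
     (i = length (components p) \<and> xs = [] \<or> i < length (components p) \<and> length xs = dimension p i))"

lemma entries_map_node [simp]: "entries (map_node h v) = h ` entries v"
  by (simp add: entries_def map_node_def)

lemma map_node_comp: "map_node g (map_node h v) = map_node (\<lambda>x. g (h x)) v"
  by (simp add: map_node_def comp_def)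

lemma map_node_cong: "(\<And>e. e \<in> entries v \<Longrightarrow> g e = h e) \<Longrightarrow> map_node g v = map_node h v"
  by (simp add: map_node_def entries_def)

lemma map_node_ident: "(\<And>e. e \<in> entries v \<Longrightarrow> g e = e) \<Longrightarrow> map_node g v = v"
  by (cases v) (simp add: map_node_def entries_def map_idI)

lemma map_node_inj:
  assumes "inj_on h C" "entries v \<subseteq> C" "entries w \<subseteq> C" "map_node h v = map_node h w" shows "v = w"
  using assms inj_on_map_eq_map[of h "snd (snd v)" "snd (snd w)"] inj_on_subset[OF assms(1)]
  by (cases v; cases w) (auto simp: map_node_def entries_def)

lemma onode_entries: "onode d A v \<Longrightarrow> entries v \<subseteq> universe A"
  by (auto simp: onode_def entries_def split: prod.splits)

lemma onode_card_entries: "onode d A v \<Longrightarrow> card (entries v) \<le> d"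
proof -
  assume "onode d A v"
  then have "length (snd (snd v)) \<le> d" by (auto simp: onode_def bounded_interp_def)
  then show ?thesis using card_length[of "snd (snd v)"] by (simp add: entries_def)
qed

lemma onode_children: "onode d A v \<Longrightarrow> w \<in> children A v \<Longrightarrow> onode d A w"
  by (auto simp: onode_def children_def output_universe_def)

lemma onode_map_node:
  assumes "local_iso A B C h" "entries v \<subseteq> C" "onode d A v" shows "onode d B (map_node h v)"
proof -
  have "h ` entries v \<subseteq> universe B" using local_iso_image_subset assms by blast
  then show ?thesis using assms(3) by (auto simp: onode_def map_node_def entries_def)
qed

text \<open>Being a child is decided by quantifier-free formulas in the entries of both nodes, and
  these have the same truth values on both sides of a local isomorphism.\<close>

lemma map_node_children:
  assumes h: "local_iso A B C h" and "entries v \<subseteq> C" "entries w \<subseteq> C" "onode d A v"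
  shows "map_node h w \<in> children B (map_node h v) \<longleftrightarrow> w \<in> children A v"
proof -
  obtain p i xs q j ys where v: "v = (p, i, xs)" and w: "w = (q, j, ys)" by (metis prod_cases3)
  have s: "set xs \<subseteq> C" "set ys \<subseteq> C" "set xs \<subseteq> universe A" "set ys \<subseteq> universe A" "set (map h ys) \<subseteq> universe B"
    using assms local_iso_image_subset[OF h, of "set ys"] by (auto simp: v w entries_def local_iso_def down_closed_def)
  obtain \<Sigma> where wf: "wf_interpretation \<Sigma> p" using assms(4) by (auto simp: v onode_def bounded_interp_def)
  have 1: "qf_sat B (map h ys) (universe_formula p j) \<longleftrightarrow> qf_sat A ys (universe_formula p j)"
    if "j < length (components p)" "length ys = dimension p j"
    using wf that s by (intro local_iso_qf_sat[OF h]) (auto simp: wf_interpretation_def Let_def)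
  have 2: "qf_sat B (map h xs @ map h ys) (child_formula p i j) \<longleftrightarrow> qf_sat A (xs @ ys) (child_formula p i j)"
    if "j < length (components p)" "length ys = dimension p j" "i < length (components p)" "length xs = dimension p i"
    using wf that s local_iso_qf_sat[OF h, of "xs @ ys"] by (auto simp: wf_interpretation_def Let_def)
  show ?thesis
    using 1 2 s assms(4)
    by (auto simp: v w children_def map_node_def output_universe_def onode_def)
qed

section \<open>Forests\<close>

text \<open>The input class in terms of edges alone: the height bound says that fewer than k parent
  steps lead to an edge leaving the root. Lists and edge representations of trees both fit this
  description, so local isomorphisms can go between them.\<close>

definition forest :: "nat set \<Rightarrow> nat \<Rightarrow> 'a edge_structure \<Rightarrow> bool" where
  "forest \<Sigma> k A \<longleftrightarrow> finite (universe A) \<and> down_closed A (universe A) \<and>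
     (\<forall>e\<in>universe A. \<exists>i<k. parent A ((parent A ^^ i) e) = (parent A ^^ i) e) \<and>
     (\<forall>e\<in>universe A. \<exists>a\<in>\<Sigma>. \<forall>b. has_label A b e \<longleftrightarrow> b = a)"

lemma finite_children: "finite (universe A) \<Longrightarrow> finite (children A v)"
proof -
  assume "finite (universe A)"
  obtain p i xs where v: "v = (p, i, xs)" by (metis prod_cases3)
  have "output_universe p A \<subseteq> (SIGMA j:{..<length (components p)}. {ys. set ys \<subseteq> universe A \<and> length ys = dimension p j})"
    by (auto simp: output_universe_def)
  then have "finite (output_universe p A)"
    by (rule finite_subset) (intro finite_SigmaI finite_lists_length_eq \<open>finite (universe A)\<close>; simp)
  moreover have "children A v \<subseteq> Pair p ` output_universe p A" by (auto simp: v children_def)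
  ultimately show ?thesis using finite_surj by blast
qed

lemma funpow_fixed: "f ((f ^^ i) e) = (f ^^ i) e \<Longrightarrow> i \<le> j \<Longrightarrow> (f ^^ j) e = (f ^^ i) e"
  by (induction j) (auto simp: le_Suc_eq)

lemma forest_finite: "forest \<Sigma> k A \<Longrightarrow> S \<subseteq> universe A \<Longrightarrow> finite S"
  unfolding forest_def using finite_subset by blast

lemma forest_fixed:
  "forest \<Sigma> k A \<Longrightarrow> e \<in> universe A \<Longrightarrow> \<exists>i<k. parent A ((parent A ^^ i) e) = (parent A ^^ i) e"
  by (simp add: forest_def)

lemma card_ancestors:
  assumes "forest \<Sigma> k A" "S \<subseteq> universe A" shows "card (ancestors A S) \<le> k * card S"
proof -
  have fin: "finite S" using forest_finite assms .
  have "ancestors A S \<subseteq> (\<lambda>(e, i). (parent A ^^ i) e) ` (S \<times> {..<k})"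
  proof
    fix d assume "d \<in> ancestors A S"
    then obtain e j where e: "e \<in> S" "d = (parent A ^^ j) e" unfolding ancestors_def by blast
    have "e \<in> universe A" using assms(2) e(1) by auto
    then obtain i where i: "i < k" "parent A ((parent A ^^ i) e) = (parent A ^^ i) e"
      using forest_fixed[OF assms(1)] by blast
    have "d = (parent A ^^ (min i j)) e"
    proof (cases "i \<le> j")
      case True
      then show ?thesis using funpow_fixed[of "parent A" i e j] i(2) e(2) by (simp add: min_absorb1)
    next
      case False
      then show ?thesis using e(2) by (simp add: min_absorb2)
    qed
    then show "d \<in> (\<lambda>(e, i). (parent A ^^ i) e) ` (S \<times> {..<k})"
      using e(1) i(1) by (intro image_eqI[where x = "(e, min i j)"]) auto
  qed
  then have "card (ancestors A S) \<le> card (S \<times> {..<k})"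
    using fin by (intro order_trans[OF card_mono card_image_le]) auto
  then show ?thesis by (simp add: card_cartesian_product mult.commute)
qed

definition saturated :: "nat \<Rightarrow> nat set \<Rightarrow> nat \<Rightarrow> 'a edge_structure \<Rightarrow> bool" where
  "saturated R \<Sigma> k B \<longleftrightarrow>
     (\<forall>a\<in>\<Sigma>. 0 < k \<longrightarrow> R < card {x\<in>universe B. parent B x = x \<and> (\<forall>b. has_label B b x \<longleftrightarrow> b = a)}) \<and>
     (\<forall>a\<in>\<Sigma>. \<forall>u\<in>universe B. \<forall>i. Suc i < k \<longrightarrow> parent B ((parent B ^^ i) u) = (parent B ^^ i) u \<longrightarrow>
        R < card {x\<in>universe B. parent B x = u \<and> (\<forall>b. has_label B b x \<longleftrightarrow> b = a)})"

lemma saturated_extend_insert: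
  assumes A: "forest \<Sigma> k A" and B: "down_closed B (universe B)" "saturated R \<Sigma> k B"
    and h: "local_iso A B D h" and e: "e \<in> universe A" "e \<notin> D" "parent A e \<in> insert e D" and "finite D" "card D \<le> R"
  obtains x where "local_iso A B (insert e D) (h(e := x))"
proof -
  obtain a where a: "a \<in> \<Sigma>" "\<And>b. has_label A b e \<longleftrightarrow> b = a" using A e(1) by (auto simp: forest_def)
  obtain i where i: "i < k" "parent A ((parent A ^^ i) e) = (parent A ^^ i) e"
    using forest_fixed[OF A e(1)] by blast
  define P where "P x \<longleftrightarrow> (if parent A e = e then parent B x = x else parent B x = h (parent A e))" for x
  have "R < card {x\<in>universe B. P x \<and> (\<forall>b. has_label B b x \<longleftrightarrow> b = a)}"
  proof (cases "parent A e = e")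
    case True
    then show ?thesis using B(2) a(1) i(1) by (auto simp: saturated_def P_def)
  next
    case False
    then obtain j where j: "i = Suc j" using i(2) by (cases i) auto
    have u: "parent A e \<in> D" using e(3) False by simp
    then have "h (parent A e) \<in> universe B" using h by (auto simp: local_iso_def down_closed_def)
    \<comment> \<open>Local isomorphisms commute with iterated parents, so the image of the parent
      of e is as close to the root as that parent itself. This gives the depth condition of
      saturation, with one step less than for e.\<close>
    moreover have "(parent A ^^ j) (parent A e) = (parent A ^^ i) e"
      by (simp only: j funpow_Suc_right comp_apply)
    then have "parent B ((parent B ^^ j) (h (parent A e))) = (parent B ^^ j) (h (parent A e))"
      using local_iso_funpow[OF h u, of j] local_iso_funpow[OF h u, of "Suc j"] i(2) by simp
    ultimately show ?thesis using B(2) a(1) i(1) j False by (simp add: saturated_def P_def)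
  qed
  moreover have "card (h ` D) \<le> R" using card_image_le[OF \<open>finite D\<close>, of h] \<open>card D \<le> R\<close> by simp
  ultimately have "\<not> {x\<in>universe B. P x \<and> (\<forall>b. has_label B b x \<longleftrightarrow> b = a)} \<subseteq> h ` D"
    using card_mono[OF finite_imageI[OF \<open>finite D\<close>], of "{x\<in>universe B. P x \<and> (\<forall>b. has_label B b x \<longleftrightarrow> b = a)}" h]
    by linarith
  then obtain x where x: "x \<in> universe B" "P x" "\<forall>b. has_label B b x \<longleftrightarrow> b = a" "x \<notin> h ` D" by blast
  have dD: "down_closed A D" "down_closed B (h ` D)" "inj_on h D" using h by (auto simp: local_iso_def)
  have eq: "(h(e := x)) d = h d" if "d \<in> D" for d using that e(2) by auto
  have "(h(e := x)) ` D = h ` D" using eq by (rule image_cong[OF refl])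
  then have img: "(h(e := x)) ` insert e D = insert x (h ` D)" by (simp only: image_insert fun_upd_same)
  have "local_iso A B (insert e D) (h(e := x))"
    unfolding local_iso_def img
  proof (intro conjI ballI)
    show "down_closed A (insert e D)" using dD e by (auto simp: down_closed_def)
    show "inj_on (h(e := x)) (insert e D)"
      using dD(3) x(4) e(2) by (auto simp: inj_on_def)
    show "down_closed B (insert x (h ` D))"
    proof -
      have "parent B x \<in> insert x (h ` D)" using x(2) e(3) by (auto simp: P_def split: if_splits)
      then show ?thesis using dD(2) x(1) unfolding down_closed_def by blast
    qed
    fix d assume d: "d \<in> insert e D"
    show "parent B ((h(e := x)) d) = (h(e := x)) (parent A d)"
    proof (cases "d = e")
      case True
      then show ?thesis using x(2) by (auto simp: P_def)
    next
      case False
      then have "d \<in> D" "parent A d \<in> D" using d dD by (auto simp: down_closed_def)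
      then show ?thesis using h eq by (simp add: local_iso_def)
    qed
    show "\<forall>b. has_label B b ((h(e := x)) d) = has_label A b d"
    proof (cases "d = e")
      case True
      then show ?thesis using x(3) a(2) by simp
    next
      case False
      then show ?thesis using d h eq by (simp add: local_iso_def)
    qed
  qed
  then show ?thesis by (rule that)
qed

lemma saturated_extend:
  assumes A: "forest \<Sigma> k A" and B: "down_closed B (universe B)" "saturated R \<Sigma> k B"
    and "local_iso A B D h" "down_closed A D'" "D \<subseteq> D'" "card D' \<le> R"
  shows "\<exists>h'. local_iso A B D' h' \<and> (\<forall>e\<in>D. h' e = h e)"
  using assms(4-)
proof (induction "card (D' - D)" arbitrary: D h)
  case 0
  have "finite D'" using forest_finite[OF A] 0(3) by (simp add: down_closed_def)
  then have "D' = D" using 0 by auto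
  then show ?case using 0 by auto
next
  case (Suc n)
  have fin: "finite D'" using forest_finite[OF A] Suc(4) by (simp add: down_closed_def)
  have "D' - D \<noteq> {}" using Suc(2) by (metis card.empty nat.distinct(1))
  then obtain e0 where e0: "e0 \<in> D'" "e0 \<notin> D" by auto
  then have "e0 \<in> universe A" using Suc(4) by (auto simp: down_closed_def)
  then obtain i where i: "parent A ((parent A ^^ i) e0) = (parent A ^^ i) e0"
    using forest_fixed[OF A] by blast
  \<comment> \<open>Walk from \<open>e0\<close> towards the root. The last edge before D is entered
    has its parent in D; if the walk misses D, its final edge is its own parent.\<close>
  obtain e where e: "e \<in> D'" "e \<notin> D" "parent A e \<in> insert e D"
  proof (cases "(parent A ^^ i) e0 \<in> D")
    case False
    then show ?thesis using that[of "(parent A ^^ i) e0"] i down_closed_funpow[OF Suc(4) e0(1)] by auto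
  next
    case True
    define j where "j = (LEAST j. (parent A ^^ j) e0 \<in> D)"
    have j: "(parent A ^^ j) e0 \<in> D" unfolding j_def using True by (rule LeastI)
    then obtain l where l: "j = Suc l" using e0(2) by (cases j) auto
    have "(parent A ^^ l) e0 \<notin> D" using not_less_Least[of l "\<lambda>j. (parent A ^^ j) e0 \<in> D"] l j_def by simp
    then show ?thesis using that[of "(parent A ^^ l) e0"] j l down_closed_funpow[OF Suc(4) e0(1)] by simp
  qed
  have D: "finite D" "card D \<le> R"
    using fin Suc(6) finite_subset[OF Suc(5)] card_mono[OF fin Suc(5)] by simp_all
  have "e \<in> universe A" using e(1) Suc(4) by (auto simp: down_closed_def)
  then obtain x where x: "local_iso A B (insert e D) (h(e := x))"
    using saturated_extend_insert[OF A B Suc(3) _ e(2,3) D] by blast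
  have "D' - insert e D = (D' - D) - {e}" by auto
  then have "n = card (D' - insert e D)" using Suc(2) e fin by simp
  from Suc(1)[OF this x Suc(4) _ Suc(6)] obtain h' where
    "local_iso A B D' h'" "\<forall>d\<in>insert e D. h' d = (h(e := x)) d" using e(1) Suc(5) by auto
  then show ?case using e(2) by (intro exI[of _ h']) auto
qed

lemma local_iso_empty: "local_iso A B {} h"
  by (simp add: local_iso_def down_closed_def)

lemma count_image_mset_eq_size: "count (image_mset r M) y = size (filter_mset (\<lambda>z. r z = y) M)"
  by (induction M) auto

text \<open>The value of c is a function of the class \<open>r z\<close>, so it is enough that every
  class meets X and Y equally often. The relation E may be finer than equality of c, and it has to
  be an equivalence only on the union of X and Y.\<close>

lemma image_mset_eq_if_equiv:
  assumes fin: "finite X" "finite Y"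
    and refl: "\<And>z. z \<in> X \<union> Y \<Longrightarrow> E z z"
    and sym: "\<And>y z. y \<in> X \<union> Y \<Longrightarrow> z \<in> X \<union> Y \<Longrightarrow> E y z \<Longrightarrow> E z y"
    and trans: "\<And>x y z. x \<in> X \<union> Y \<Longrightarrow> y \<in> X \<union> Y \<Longrightarrow> z \<in> X \<union> Y \<Longrightarrow> E x y \<Longrightarrow> E y z \<Longrightarrow> E x z"
    and c: "\<And>y z. y \<in> X \<union> Y \<Longrightarrow> z \<in> X \<union> Y \<Longrightarrow> E y z \<Longrightarrow> c y = c z"
    and counts: "\<And>z. z \<in> X \<union> Y \<Longrightarrow> card {x\<in>X. E x z} = card {y\<in>Y. E y z}"
  shows "image_mset c (mset_set X) = image_mset c (mset_set Y)"
proof -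
  define r where "r z = {y\<in>X \<union> Y. E y z}" for z
  have r: "r y = r z \<longleftrightarrow> E y z" if "y \<in> X \<union> Y" "z \<in> X \<union> Y" for y z
  proof
    assume "r y = r z"
    moreover have "y \<in> r y" using refl that by (simp add: r_def)
    ultimately have "y \<in> r z" by simp
    then show "E y z" by (simp add: r_def)
  next
    assume yz: "E y z"
    have "E x y \<longleftrightarrow> E x z" if "x \<in> X \<union> Y" for x
      using trans[OF that \<open>y \<in> X \<union> Y\<close> \<open>z \<in> X \<union> Y\<close> _ yz]
        trans[OF that \<open>z \<in> X \<union> Y\<close> \<open>y \<in> X \<union> Y\<close> _ sym[OF \<open>y \<in> X \<union> Y\<close> \<open>z \<in> X \<union> Y\<close> yz]] by blast
    then show "r y = r z" unfolding r_def by blast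
  qed
  define c' where "c' S = c (SOME z. z \<in> S)" for S
  have c': "c' (r z) = c z" if "z \<in> X \<union> Y" for z
  proof -
    have "z \<in> r z" using refl that by (simp add: r_def)
    then have "(SOME y. y \<in> r z) \<in> r z" by (rule someI)
    then have "(SOME y. y \<in> r z) \<in> X \<union> Y" "E (SOME y. y \<in> r z) z" unfolding r_def by blast+
    from c[OF this(1) that this(2)] show ?thesis by (simp only: c'_def)
  qed
  have cnt: "count (image_mset r (mset_set Z)) S = card {z\<in>Z. r z = S}" if "finite Z" for Z S
    using that by (simp add: count_image_mset_eq_size)
  have "image_mset r (mset_set X) = image_mset r (mset_set Y)"
  proof (rule multiset_eqI)
    fix S
    show "count (image_mset r (mset_set X)) S = count (image_mset r (mset_set Y)) S"
    proof (cases "\<exists>z\<in>X \<union> Y. r z = S")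
      case True
      then obtain z where z: "z \<in> X \<union> Y" "S = r z" by blast
      have "{x\<in>X. r x = S} = {x\<in>X. E x z}" "{y\<in>Y. r y = S} = {y\<in>Y. E y z}"
        using r[OF _ z(1)] z(2) by blast+
      then show ?thesis using counts[OF z(1)] by (simp add: cnt fin)
    next
      case False
      then have "{x\<in>X. r x = S} = {}" "{y\<in>Y. r y = S} = {}" by auto
      then show ?thesis by (simp only: cnt[OF fin(1)] cnt[OF fin(2)])
    qed
  qed
  then have "image_mset c' (image_mset r (mset_set X)) = image_mset c' (image_mset r (mset_set Y))" by simp
  moreover have "image_mset c' (image_mset r (mset_set Z)) = image_mset c (mset_set Z)"
    if "finite Z" "Z \<subseteq> X \<union> Y" for Z
    using that c' by (auto simp: image_mset.compositionality comp_def intro!: image_mset_cong)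
  ultimately show ?thesis using fin by simp
qed

section \<open>Generic forests decide equality of colours\<close>

lemma sum_card_fibres:
  assumes "finite S" "finite \<F>" "f ` S \<subseteq> \<F>"
  shows "(\<Sum>F\<in>\<F>. card {z\<in>S. f z = F}) = card S"
  using sum.group[OF assms, of "\<lambda>_. 1::nat"] by simp

lemma finite_above: "finite (universe A) \<Longrightarrow> finite (above A D)"
  by (rule finite_subset[of _ "Pow (universe A)"]) (auto simp: above_def down_closed_def)

text \<open>R covers the ancestors of the entries of four nodes, with at most d entries per node and
  at most k ancestors per entry, the entry included; the four nodes will be v, w, z0 and a child z.
  M bounds the number of children with all entries in a set of at most R edges: at most d components
  with at most \<open>Suc R ^ d\<close> tuples each.\<close>

locale generic_base =
  fixes \<Sigma> :: "nat set" and k R M d :: nat and G :: "nat \<Rightarrow> nat" and T :: "(nat \<times> nat) list"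
  assumes gen: "generic G T" and fast: "fast_growing R M G"
    and sat: "saturated R \<Sigma> k (list_structure T)" and forestB: "forest \<Sigma> k (list_structure T)"
    and R: "5 * d * k \<le> R" and M: "d * Suc R ^ d \<le> M"
begin

abbreviation "B \<equiv> list_structure T"

text \<open>The case A = B is not trivial: it says that local isomorphisms of B preserve equality of
  colours, although they need not extend to automorphisms and the colours depend on all of
  B.\<close>

definition reflects :: "'a edge_structure \<Rightarrow> nat \<Rightarrow> bool" where
  "reflects A m \<longleftrightarrow> (\<forall>v w C h. onode d A v \<longrightarrow> onode d A w \<longrightarrow> local_iso A B C h \<longrightarrow> entries v \<union> entries w \<subseteq> C \<longrightarrow>
     colour B m (map_node h v) = colour B m (map_node h w) \<longrightarrow> colour A m v = colour A m w)"

text \<open>The image in A of equality of colours over B. The quantifier over all embeddings avoids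
  a choice and makes reflexivity and symmetry immediate.\<close>

definition same :: "'a edge_structure \<Rightarrow> nat \<Rightarrow> 'a onode \<Rightarrow> 'a onode \<Rightarrow> bool" where
  "same A m z z' \<longleftrightarrow> (\<forall>h. local_iso A B (ancestors A (entries z \<union> entries z')) h \<longrightarrow>
     colour B m (map_node h z) = colour B m (map_node h z'))"

lemma dc_ancestors: "forest \<Sigma> k A \<Longrightarrow> S \<subseteq> universe A \<Longrightarrow> down_closed A (ancestors A S)"
  by (rule down_closed_ancestors) (simp_all add: forest_def)

text \<open>Two embeddings g and h of the same closed set differ by a local isomorphism of B, namely
  h after the inverse of g. Along it \<open>reflects B m\<close> carries equality of colours back to
  the images under g.\<close>

lemma same_iff:
  assumes B: "reflects B m" and A: "forest \<Sigma> k A" and z: "onode d A z" "onode d A z'"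
    and h: "local_iso A B F h" "entries z \<union> entries z' \<subseteq> F"
  shows "same A m z z' \<longleftrightarrow> colour B m (map_node h z) = colour B m (map_node h z')"
proof
  let ?F = "ancestors A (entries z \<union> entries z')"
  have F: "?F \<subseteq> F" using ancestors_least[of A F] h by (simp add: local_iso_def)
  have U: "entries z \<union> entries z' \<subseteq> universe A" using onode_entries z by blast
  have h': "local_iso A B ?F h" using local_iso_subset[OF h(1) dc_ancestors[OF A U] F] .
  have sup: "entries z \<subseteq> ?F" "entries z' \<subseteq> ?F" using ancestors_superset[of "entries z \<union> entries z'" A] by simp_all
  show "same A m z z' \<Longrightarrow> colour B m (map_node h z) = colour B m (map_node h z')"
    using h' by (simp add: same_def)
  assume eq: "colour B m (map_node h z) = colour B m (map_node h z')"
  show "same A m z z'"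
    unfolding same_def
  proof (intro allI impI)
    fix g assume g: "local_iso A B ?F g"
    define f where "f x = h (inv_into ?F g x)" for x
    have inj: "inj_on g ?F" using g by (simp add: local_iso_def)
    have "inv_into ?F g ` g ` ?F = ?F" using inv_into_image_cancel[OF inj order_refl] .
    then have f: "local_iso B B (g ` ?F) f"
      using local_iso_comp[OF local_iso_inv[OF g], of B h] h' by (simp add: f_def[abs_def])
    have fg: "f (g x) = h x" if "x \<in> ?F" for x using inj that by (simp add: f_def)
    have "map_node f (map_node g z) = map_node h z" "map_node f (map_node g z') = map_node h z'"
      unfolding map_node_comp using fg sup by (auto intro!: map_node_cong)
    moreover have "onode d B (map_node g z)" "onode d B (map_node g z')"
      using onode_map_node[OF g] sup z by blast+
    moreover have "entries (map_node g z) \<union> entries (map_node g z') \<subseteq> g ` ?F" using sup by auto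
    ultimately show "colour B m (map_node g z) = colour B m (map_node g z')"
      using B f eq unfolding reflects_def by metis
  qed
qed

text \<open>The counted children have all their entries in F, so F alone decides their number. With
  A = B this gives the invariance of the weights; for other A it moves counts over A into B.\<close>

lemma count_transfer:
  assumes B: "reflects B m" and A: "forest \<Sigma> k A" and h: "local_iso A B F h"
    and D: "down_closed A D" "D \<subseteq> F" and v: "onode d A v" "entries v \<subseteq> D" and z0: "onode d A z0" "entries z0 \<subseteq> D"
  shows "card {z\<in>children A v. same A m z z0 \<and> D \<union> ancestors A (entries z) = F} =
    card {z\<in>children B (map_node h v). same B m z (map_node h z0) \<and> h ` D \<union> ancestors B (entries z) = h ` F}"
    (is "card ?L = card ?R")
proof -
  have inj: "inj_on h F" and dcF: "down_closed A F" and dcB: "down_closed B (h ` F)" using h by (simp_all add: local_iso_def)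
  have key: "map_node h z \<in> ?R \<longleftrightarrow> z \<in> ?L" if z: "entries z \<subseteq> F" for z
  proof -
    have ch: "map_node h z \<in> children B (map_node h v) \<longleftrightarrow> z \<in> children A v"
      using map_node_children[OF h _ z v(1)] v(2) D(2) by blast
    have sm: "same B m (map_node h z) (map_node h z0) \<longleftrightarrow> same A m z z0" if "z \<in> children A v"
    proof -
      have oz: "onode d A z" using onode_children[OF v(1) that] .
      have s: "entries z \<union> entries z0 \<subseteq> F" using z z0 D by auto
      have "onode d B (map_node h z)" "onode d B (map_node h z0)"
        using onode_map_node[OF h] oz z0 s by blast+
      then have "same B m (map_node h z) (map_node h z0) \<longleftrightarrow>
          colour B m (map_node (\<lambda>x. x) (map_node h z)) = colour B m (map_node (\<lambda>x. x) (map_node h z0))"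
        using s by (intro same_iff[OF B forestB _ _ local_iso_id[OF dcB]]) auto
      then show ?thesis
        using same_iff[OF B A oz z0(1) h s] by (simp add: map_node_ident)
    qed
    have "h ` D \<union> ancestors B (h ` entries z) = h ` (D \<union> ancestors A (entries z))"
      using local_iso_ancestors[OF h z] by (simp add: image_Un)
    moreover have "D \<union> ancestors A (entries z) \<subseteq> F" using D(2) ancestors_least[OF dcF z] by simp
    ultimately have "h ` D \<union> ancestors B (h ` entries z) = h ` F \<longleftrightarrow> D \<union> ancestors A (entries z) = F"
      using inj_on_image_eq_iff[OF inj _ order_refl] by simp
    then show ?thesis using ch sm by auto
  qed
  have "bij_betw (map_node h) ?L ?R"
    unfolding bij_betw_def
  proof
    have sub: "entries z \<subseteq> F" if "z \<in> ?L" for z using that ancestors_superset[of "entries z" A] by blast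
    show "inj_on (map_node h) ?L"
      by (rule inj_onI) (use map_node_inj[OF inj] sub in blast)
    show "map_node h ` ?L = ?R"
    proof
      show "map_node h ` ?L \<subseteq> ?R" using key sub by blast
      show "?R \<subseteq> map_node h ` ?L"
      proof
        fix y assume y: "y \<in> ?R"
        then have ys: "entries y \<subseteq> h ` F" using ancestors_superset[of "entries y" B] by blast
        define z where "z = map_node (inv_into F h) y"
        have "map_node h z = y"
          unfolding z_def map_node_comp using ys by (intro map_node_ident) (simp add: f_inv_into_f subset_iff)
        moreover have "entries z \<subseteq> F" using ys inv_into_into[of _ h F] by (auto simp: z_def)
        ultimately show "y \<in> map_node h ` ?L" using key[of z] y by blast
      qed
    qed
  qed
  then show ?thesis by (rule bij_betw_same_card)
qed

lemma card_children_le: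
  assumes v: "onode d B v" and "card E \<le> R" "finite E"
  shows "card {z\<in>children B v. Q z \<and> D \<union> ancestors B (entries z) = E} \<le> M"
proof -
  obtain p i xs where v': "v = (p, i, xs)" by (metis prod_cases3)
  have p: "length (components p) \<le> d" "\<And>j. j < length (components p) \<Longrightarrow> dimension p j \<le> d"
    using v by (auto simp: v' onode_def bounded_interp_def)
  let ?S = "SIGMA j:{..<length (components p)}. {ys. set ys \<subseteq> E \<and> length ys = dimension p j}"
  have "{z\<in>children B v. Q z \<and> D \<union> ancestors B (entries z) = E} \<subseteq> Pair p ` ?S"
  proof
    fix z assume z: "z \<in> {z\<in>children B v. Q z \<and> D \<union> ancestors B (entries z) = E}"
    then have "entries z \<subseteq> E" using ancestors_superset[of "entries z" B] by blast
    then show "z \<in> Pair p ` ?S"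
      using z by (auto simp: v' children_def output_universe_def entries_def)
  qed
  then have "card {z\<in>children B v. Q z \<and> D \<union> ancestors B (entries z) = E} \<le> card (Pair p ` ?S)"
    using assms(3) by (intro card_mono finite_imageI finite_SigmaI finite_lists_length_eq) auto
  also have "\<dots> \<le> card ?S"
    using assms(3) by (intro card_image_le finite_SigmaI finite_lists_length_eq) auto
  also have "\<dots> = (\<Sum>j<length (components p). card E ^ dimension p j)"
    using assms(3) by (subst card_SigmaI) (auto simp: finite_lists_length_eq card_lists_length_eq)
  also have "\<dots> \<le> (\<Sum>j<length (components p). Suc R ^ d)"
  proof (rule sum_mono)
    \<comment> \<open>The base \<open>Suc R\<close> is positive, so the power grows with the
      exponent even if R = 0.\<close>
    fix j assume "j \<in> {..<length (components p)}"
    then have "card E ^ dimension p j \<le> Suc R ^ dimension p j" "Suc R ^ dimension p j \<le> Suc R ^ d"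
      using assms(2) p(2)[of j] by (simp_all add: power_mono power_increasing del: power_Suc)
    then show "card E ^ dimension p j \<le> Suc R ^ d" by linarith
  qed
  also have "\<dots> \<le> d * Suc R ^ d" using p(1) by simp
  finally show ?thesis using M by linarith
qed

text \<open>Equal colours over B say that each colour class has as many members among the children
  of one image as among those of the other. Split by the closed sets that the children generate, the
  differences sum to 0, so each of them is 0. Every relevant closed set of A embeds into B over the
  parameters, hence the classes of \<open>same\<close> have equal sizes among the children of v and
  w.\<close>

lemma reflects_Suc:
  assumes clB: "reflects B m" and clA: "reflects A m" and A: "forest \<Sigma> k A"
  shows "reflects A (Suc m)"
  unfolding reflects_def
proof (intro allI impI)
  fix v w C h
  assume v: "onode d A v" and w: "onode d A w" and h: "local_iso A B C h"
    and C: "entries v \<union> entries w \<subseteq> C"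
    and eq: "colour B (Suc m) (map_node h v) = colour B (Suc m) (map_node h w)"
  define C0 where "C0 = ancestors A (entries v \<union> entries w)"
  have dcU: "down_closed A (universe A)" "finite (universe A)" using A by (auto simp: forest_def)
  have dcB: "down_closed B (universe B)" "finite (universe B)" using forestB by (auto simp: forest_def)
  have C0U: "entries v \<union> entries w \<subseteq> universe A" using onode_entries v w by blast
  have dcC0: "down_closed A C0" unfolding C0_def using dc_ancestors[OF A C0U] .
  have C0C: "C0 \<subseteq> C" unfolding C0_def using ancestors_least[of A C] h C by (simp add: local_iso_def)
  have vwC0: "entries v \<subseteq> C0" "entries w \<subseteq> C0"
    using ancestors_superset[of "entries v \<union> entries w" A] by (auto simp: C0_def)
  have h0: "local_iso A B C0 h" using local_iso_subset[OF h dcC0 C0C] .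
  define X where "X = children A v"
  define Y where "Y = children A w"
  have finX: "finite X" "finite Y" unfolding X_def Y_def using finite_children dcU by blast+
  have XY: "onode d A z" if "z \<in> X \<union> Y" for z
    using that onode_children v w unfolding X_def Y_def by blast
  have cardA: "card (ancestors A (entries z)) \<le> d * k" if "onode d A z" for z
    using order_trans[OF card_ancestors[OF A onode_entries[OF that]] mult_le_mono2[OF onode_card_entries[OF that], of k]]
    by (simp only: mult.commute[of d k])
  have cardB: "card (ancestors B (entries z)) \<le> d * k" if "onode d B z" for z
    using order_trans[OF card_ancestors[OF forestB onode_entries[OF that]] mult_le_mono2[OF onode_card_entries[OF that], of k]]
    by (simp only: mult.commute[of d k])
  have cardC0: "card C0 \<le> 2 * (d * k)"
    using cardA[OF v] cardA[OF w] card_Un_le[of "ancestors A (entries v)" "ancestors A (entries w)"]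
    by (simp add: C0_def ancestors_Un)
  have R': "5 * (d * k) \<le> R" using R by (simp add: mult.assoc)
  have ex: "\<exists>h'. local_iso A B D' h' \<and> (\<forall>e\<in>D. h' e = f e)"
    if "local_iso A B D f" "down_closed A D'" "D \<subseteq> D'" "card D' \<le> R" for D D' f
    using saturated_extend[OF A dcB(1) sat that] .
  \<comment> \<open>Transitivity of \<open>same\<close> compares three nodes, so a single embedding
    has to contain the ancestors of all three.\<close>
  have ex3: "\<exists>F h'. local_iso A B F h' \<and> entries x \<union> entries y \<union> entries z \<subseteq> F"
    if "x \<in> X \<union> Y" "y \<in> X \<union> Y" "z \<in> X \<union> Y" for x y z
  proof -
    let ?F = "ancestors A (entries x) \<union> ancestors A (entries y) \<union> ancestors A (entries z)"
    have "card ?F \<le> 3 * (d * k)"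
      using cardA[OF XY[OF that(1)]] cardA[OF XY[OF that(2)]] cardA[OF XY[OF that(3)]]
        card_Un_le[of "ancestors A (entries x) \<union> ancestors A (entries y)" "ancestors A (entries z)"]
        card_Un_le[of "ancestors A (entries x)" "ancestors A (entries y)"] by linarith
    then have "card ?F \<le> R" using R' by linarith
    moreover have "down_closed A ?F"
      using dc_ancestors[OF A onode_entries[OF XY]] that by (intro down_closed_Un) blast+
    ultimately obtain h' where "local_iso A B ?F h'" using ex[OF local_iso_empty] by blast
    moreover have "entries x \<union> entries y \<union> entries z \<subseteq> ?F"
      using ancestors_superset[of _ A] by blast
    ultimately show ?thesis by blast
  qed
  have "image_mset (colour A m) (mset_set X) = image_mset (colour A m) (mset_set Y)"
  proof (rule image_mset_eq_if_equiv[where E = "same A m", OF finX])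
    fix z assume "z \<in> X \<union> Y" then show "same A m z z" by (simp add: same_def)
  next
    fix y z assume yz: "y \<in> X \<union> Y" "z \<in> X \<union> Y" "same A m y z"
    then show "same A m z y" by (simp add: same_def Un_commute)
    obtain F g where g: "local_iso A B F g" "entries y \<union> entries z \<subseteq> F" using ex3[OF yz(1,2,2)] by auto
    then have "colour B m (map_node g y) = colour B m (map_node g z)"
      using same_iff[OF clB A XY[OF yz(1)] XY[OF yz(2)] g] yz(3) by simp
    then show "colour A m y = colour A m z"
      using clA XY yz(1,2) g unfolding reflects_def by metis
  next
    fix x y z assume xyz: "x \<in> X \<union> Y" "y \<in> X \<union> Y" "z \<in> X \<union> Y" "same A m x y" "same A m y z"
    obtain F g where g: "local_iso A B F g" "entries x \<union> entries y \<union> entries z \<subseteq> F" using ex3[OF xyz(1-3)] by auto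
    note s = same_iff[OF clB A XY XY g(1)]
    show "same A m x z"
      using s[OF xyz(1,2)] s[OF xyz(2,3)] s[OF xyz(1,3)] g(2) xyz(4,5) by simp
  next
    \<comment> \<open>The class of z0 is counted with z0 among the parameters; membership in it then
      depends only on the type over \<open>D0\<close>.\<close>
    fix z0 assume z0: "z0 \<in> X \<union> Y"
    define D0 where "D0 = C0 \<union> ancestors A (entries z0)"
    have oz0: "onode d A z0" using XY z0 .
    have dcz: "down_closed A (ancestors A (entries z))" if "onode d A z" for z
      using dc_ancestors[OF A onode_entries[OF that]] .
    have dcD0: "down_closed A D0" unfolding D0_def using down_closed_Un[OF dcC0 dcz[OF oz0]] .
    have cardD0: "card D0 \<le> 3 * (d * k)"
      using cardC0 cardA[OF oz0] card_Un_le[of C0 "ancestors A (entries z0)"] by (simp add: D0_def)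
    have "card D0 \<le> R" using cardD0 R' by linarith
    \<comment> \<open>As g agrees with h on \<open>C0\<close>, the images of v and w and the assumed
      equality of their colours are kept.\<close>
    then obtain g where g: "local_iso A B D0 g" "\<forall>e\<in>C0. g e = h e"
      using ex[OF h0 dcD0] by (auto simp: D0_def)
    have ent: "entries v \<subseteq> D0" "entries w \<subseteq> D0" "entries z0 \<subseteq> D0"
      using vwC0 ancestors_superset[of "entries z0" A] by (auto simp: D0_def)
    have gh: "map_node g v = map_node h v" "map_node g w = map_node h w"
      using g(2) vwC0 by (auto intro!: map_node_cong)
    define D where "D = g ` D0"
    have dcD: "down_closed B D" using g(1) by (simp add: D_def local_iso_def)
    have finD0: "finite D0" using forest_finite[OF A] dcD0 by (simp add: down_closed_def)
    have cardD: "card D \<le> 3 * (d * k)" using cardD0 card_image_le[OF finD0, of g] by (simp add: D_def)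
    define \<zeta> where "\<zeta> = map_node g z0"
    have o\<zeta>: "onode d B \<zeta>" "onode d B (map_node g v)" "onode d B (map_node g w)"
      unfolding \<zeta>_def using onode_map_node[OF g(1)] ent oz0 v w by blast+
    have ent\<zeta>: "entries \<zeta> \<subseteq> D" "entries (map_node g v) \<subseteq> D" "entries (map_node g w) \<subseteq> D"
      unfolding \<zeta>_def D_def using ent by auto
    define cnt where "cnt u E = card {z\<in>children B u. same B m z \<zeta> \<and> D \<union> ancestors B (entries z) = E}" for u E
    \<comment> \<open>The sum of W over all closed sets above D will be the difference between the
      sizes of the colour class of \<open>\<zeta>\<close> among the children of the two
      images.\<close>
    define W where "W E = int (cnt (map_node g v) E) - int (cnt (map_node g w) E)" for E
    have finE: "finite E" if "E \<in> above B D" for E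
      using forest_finite[OF forestB] that by (simp add: above_def down_closed_def)
    have cnt_le: "cnt u E \<le> M" and cnt_0: "R < card E \<Longrightarrow> cnt u E = 0"
      if "onode d B u" "E \<in> above B D" for u E
    proof -
      have zero: "cnt u E = 0" if "R < card E"
      proof -
        have "{z\<in>children B u. same B m z \<zeta> \<and> D \<union> ancestors B (entries z) = E} = {}"
        proof (rule ccontr)
          assume "\<not> ?thesis"
          then obtain z where z: "z \<in> children B u" "E = D \<union> ancestors B (entries z)" by blast
          then have "card E \<le> 4 * (d * k)"
            using card_Un_le[of D "ancestors B (entries z)"] cardD cardB[OF onode_children[OF \<open>onode d B u\<close> z(1)]] by simp
          then show False using that R' by linarith
        qed
        then show ?thesis unfolding cnt_def by (simp only: card.empty)
      qed
      then show "R < card E \<Longrightarrow> cnt u E = 0" .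
      show "cnt u E \<le> M"
      proof (cases "card E \<le> R")
        case True
        then show ?thesis unfolding cnt_def using card_children_le[OF that(1) True finE[OF that(2)]] by simp
      next
        case False
        then show ?thesis using zero by simp
      qed
    qed
    have W0: "W E = 0" if "E \<in> above B D" for E
    proof (rule generic_no_cancellation[OF gen fast dcD _ _ _ _ that])
      fix E assume E: "E \<in> above B D"
      show "\<bar>W E\<bar> \<le> int M"
        using cnt_le[OF o\<zeta>(2) E] cnt_le[OF o\<zeta>(3) E] by (simp add: W_def)
      show "R < card E \<Longrightarrow> W E = 0"
        using cnt_0[OF o\<zeta>(2) E] cnt_0[OF o\<zeta>(3) E] by (simp add: W_def)
      fix f assume f: "local_iso B B E f" "\<forall>e\<in>D. f e = e"
      have DE: "D \<subseteq> E" using E by (simp add: above_def)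
      have fD: "f ` D = D" using f(2) by (simp cong: image_cong)
      have "cnt u (f ` E) = cnt u E" if "onode d B u" "entries u \<subseteq> D" for u
      proof -
        have "map_node f u = u" "map_node f \<zeta> = \<zeta>"
          using f(2) that(2) ent\<zeta>(1) by (auto intro!: map_node_ident)
        then show ?thesis
          using count_transfer[OF clB forestB f(1) dcD DE that o\<zeta>(1) ent\<zeta>(1)] by (simp add: cnt_def fD)
      qed
      then show "W (f ` E) = W E" using o\<zeta> ent\<zeta> by (simp add: W_def)
    next
      \<comment> \<open>Each child generates exactly one closed set together with D. Over B itself
        the identity is an embedding, so \<open>same\<close> is plain equality of colours
        there.\<close>
      have total: "(\<Sum>E\<in>above B D. cnt u E) = card {z\<in>children B u. colour B m z = colour B m \<zeta>}"
        if u: "onode d B u" for u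
      proof -
        have S: "{z\<in>children B u. same B m z \<zeta> \<and> D \<union> ancestors B (entries z) = E} =
            {z\<in>{z\<in>children B u. same B m z \<zeta>}. D \<union> ancestors B (entries z) = E}" for E by blast
        have "(\<Sum>E\<in>above B D. cnt u E) = card {z\<in>children B u. same B m z \<zeta>}"
          unfolding cnt_def S
        proof (rule sum_card_fibres)
          show "finite {z\<in>children B u. same B m z \<zeta>}" using finite_children[OF dcB(2)] by simp
          show "finite (above B D)" using finite_above[OF dcB(2)] .
          show "(\<lambda>z. D \<union> ancestors B (entries z)) ` {z\<in>children B u. same B m z \<zeta>} \<subseteq> above B D"
            using down_closed_Un[OF dcD dc_ancestors[OF forestB onode_entries[OF onode_children[OF u]]]]
            by (auto simp: above_def)
        qed
        moreover have "same B m z \<zeta> \<longleftrightarrow> colour B m z = colour B m \<zeta>" if "z \<in> children B u" for z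
        proof -
          have oz: "onode d B z" using onode_children[OF u that] .
          have "same B m z \<zeta> \<longleftrightarrow> colour B m (map_node (\<lambda>x. x) z) = colour B m (map_node (\<lambda>x. x) \<zeta>)"
            using onode_entries[OF oz] onode_entries[OF o\<zeta>(1)]
            by (intro same_iff[OF clB forestB oz o\<zeta>(1) local_iso_id[OF dcB(1)]]) simp
          then show ?thesis by (simp add: map_node_ident)
        qed
        ultimately show ?thesis by (simp cong: conj_cong)
      qed
      have "image_mset (colour B m) (mset_set (children B (map_node g v))) =
          image_mset (colour B m) (mset_set (children B (map_node g w)))"
        using eq unfolding gh colour_Suc_eq_iff .
      then have "size (filter_mset (\<lambda>z. colour B m z = colour B m \<zeta>) (mset_set (children B (map_node g v)))) =
          size (filter_mset (\<lambda>z. colour B m z = colour B m \<zeta>) (mset_set (children B (map_node g w))))"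
        unfolding count_image_mset_eq_size[symmetric] by simp
      then have "card {z\<in>children B (map_node g v). colour B m z = colour B m \<zeta>} =
          card {z\<in>children B (map_node g w). colour B m z = colour B m \<zeta>}"
        using finite_children[OF dcB(2)] by simp
      then have "(\<Sum>E\<in>above B D. cnt (map_node g v) E) = (\<Sum>E\<in>above B D. cnt (map_node g w) E)"
        using total o\<zeta> by simp
      then have "int (\<Sum>E\<in>above B D. cnt (map_node g v) E) = int (\<Sum>E\<in>above B D. cnt (map_node g w) E)" by simp
      then show "(\<Sum>E\<in>above B D. W E) = 0"
        by (simp add: W_def sum_subtractf of_nat_sum)
    qed
    \<comment> \<open>\<open>W0\<close> speaks about closed sets of B; F is moved there by an
      embedding that extends g. If F has more than R edges, no child generates it and both sides are
      empty.\<close>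
    have fibre: "card {z\<in>X. same A m z z0 \<and> D0 \<union> ancestors A (entries z) = F} =
        card {z\<in>Y. same A m z z0 \<and> D0 \<union> ancestors A (entries z) = F}"
      if F: "F \<in> above A D0" for F
    proof (cases "card F \<le> R")
      case True
      have dcF: "down_closed A F" "D0 \<subseteq> F" using F by (auto simp: above_def)
      obtain f where f: "local_iso A B F f" "\<forall>e\<in>D0. f e = g e" using ex[OF g(1) dcF True] by blast
      have fD: "f ` D0 = D" using f(2) by (simp add: D_def cong: image_cong)
      have fg: "map_node f v = map_node g v" "map_node f w = map_node g w" "map_node f z0 = \<zeta>"
        unfolding \<zeta>_def using f(2) ent by (auto intro!: map_node_cong)
      have "f ` F \<in> above B D" using f(1) dcF(2) fD by (auto simp: above_def local_iso_def)
      from W0[OF this] have "cnt (map_node g v) (f ` F) = cnt (map_node g w) (f ` F)" by (simp add: W_def)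
      then show ?thesis
        using count_transfer[OF clB A f(1) dcD0 dcF(2) v ent(1) oz0 ent(3)]
          count_transfer[OF clB A f(1) dcD0 dcF(2) w ent(2) oz0 ent(3)]
        by (simp add: X_def Y_def fg fD cnt_def)
    next
      case False
      have emp: "{z\<in>Z. same A m z z0 \<and> D0 \<union> ancestors A (entries z) = F} = {}" if Z: "Z \<subseteq> X \<union> Y" for Z
      proof (rule ccontr)
        assume "\<not> ?thesis"
        then obtain z where z: "z \<in> X \<union> Y" "F = D0 \<union> ancestors A (entries z)" using Z by blast
        then have "card F \<le> 4 * (d * k)"
          using card_Un_le[of D0 "ancestors A (entries z)"] cardD0 cardA[OF XY[OF z(1)]] by simp
        then show False using False R' by linarith
      qed
      show ?thesis using emp[of X] emp[of Y] by (simp only: Un_upper1 Un_upper2 simp_thms)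
    qed
    have total: "(\<Sum>F\<in>above A D0. card {z\<in>Z. same A m z z0 \<and> D0 \<union> ancestors A (entries z) = F}) =
        card {z\<in>Z. same A m z z0}" if Z: "Z \<subseteq> X \<union> Y" "finite Z" for Z
    proof -
      have S: "{z\<in>Z. same A m z z0 \<and> D0 \<union> ancestors A (entries z) = F} =
          {z\<in>{z\<in>Z. same A m z z0}. D0 \<union> ancestors A (entries z) = F}" for F by blast
      show ?thesis unfolding S
      proof (rule sum_card_fibres)
        show "finite {z\<in>Z. same A m z z0}" using Z(2) by simp
        show "finite (above A D0)" using finite_above[OF dcU(2)] .
        have "D0 \<union> ancestors A (entries z) \<in> above A D0" if "z \<in> Z" for z
        proof -
          have "z \<in> X \<union> Y" using that Z(1) by blast
          then show ?thesis using down_closed_Un[OF dcD0 dcz[OF XY]] by (simp add: above_def)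
        qed
        then show "(\<lambda>z. D0 \<union> ancestors A (entries z)) ` {z\<in>Z. same A m z z0} \<subseteq> above A D0" by blast
      qed
    qed
    have "(\<Sum>F\<in>above A D0. card {z\<in>X. same A m z z0 \<and> D0 \<union> ancestors A (entries z) = F}) =
        (\<Sum>F\<in>above A D0. card {z\<in>Y. same A m z z0 \<and> D0 \<union> ancestors A (entries z) = F})"
      by (rule sum.cong[OF refl fibre])
    then show "card {x\<in>X. same A m x z0} = card {y\<in>Y. same A m y z0}"
      unfolding total[OF Un_upper1 finX(1)] total[OF Un_upper2 finX(2)] .
  qed
  then show "colour A (Suc m) v = colour A (Suc m) w"
    unfolding colour_Suc_eq_iff X_def Y_def .
qed

lemma reflects_0: "reflects A 0"
  by (simp add: reflects_def)

text \<open>B has to come first: the step for A at depth m uses the statement for B at depth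
  m.\<close>

lemma reflects_B: "reflects B m"
  by (induction m) (simp_all add: reflects_0 reflects_Suc forestB)

lemma reflects_forest: "forest \<Sigma> k A \<Longrightarrow> reflects A m"
  by (induction m) (simp_all add: reflects_0 reflects_Suc reflects_B)

end

section \<open>Construction of a generic forest\<close>

text \<open>Skipping the pairs that occur already gives each parent and label a single block,
  although \<open>extend\<close> runs in every round over all edges and not only over the newest
  ones.\<close>

definition add_block :: "(nat \<Rightarrow> nat) \<Rightarrow> (nat \<times> nat) list \<Rightarrow> nat \<times> nat \<Rightarrow> (nat \<times> nat) list" where
  "add_block G T x = (if x \<in> set T then T else T @ replicate (G (length T)) x)"

definition extend :: "(nat \<Rightarrow> nat) \<Rightarrow> nat list \<Rightarrow> (nat \<times> nat) list \<Rightarrow> (nat \<times> nat) list" where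
  "extend G L T = foldl (add_block G) T (concat (map (\<lambda>p. map (\<lambda>a. (p, a)) L) [0..<Suc (length T)]))"

lemma foldl_add_block:
  assumes "generic G T" "\<And>m. 0 < G m" "\<forall>x\<in>set xs. fst x \<le> length T"
  shows "\<exists>E. foldl (add_block G) T xs = T @ E \<and> generic G (T @ E) \<and> set E \<inter> set T = {} \<and>
    set E \<subseteq> set xs \<and> set xs \<subseteq> set T \<union> set E"
  using assms(3)
proof (induction xs rule: rev_induct)
  case Nil
  then show ?case using assms(1) by (intro exI[of _ "[]"]) simp
next
  case (snoc x xs)
  then obtain E where E: "foldl (add_block G) T xs = T @ E" "generic G (T @ E)" "set E \<inter> set T = {}"
    "set E \<subseteq> set xs" "set xs \<subseteq> set T \<union> set E" by auto
  show ?case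
  proof (cases "x \<in> set (T @ E)")
    case True
    then have "foldl (add_block G) T (xs @ [x]) = T @ E" by (simp add: E(1)) (simp add: add_block_def)
    then show ?thesis using E True by (intro exI[of _ E]) auto
  next
    case False
    obtain p a where x: "x = (p, a)" by fastforce
    have "generic G ((T @ E) @ replicate (G (length (T @ E))) (p, a))"
      using E(2) by (rule generic.block) (use snoc(2) x in auto)
    moreover have "set (replicate (G (length (T @ E))) x) = {x}" using assms(2) by simp
    moreover have "foldl (add_block G) T (xs @ [x]) = T @ E @ replicate (G (length (T @ E))) x"
      using False by (simp add: E(1)) (simp add: add_block_def)
    ultimately show ?thesis using E False
      by (intro exI[of _ "E @ replicate (G (length (T @ E))) x"]) (auto simp: x)
  qed
qed

lemma extend_props:
  assumes "generic G T" "\<And>m. 0 < G m"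
  obtains E where "extend G L T = T @ E" "generic G (T @ E)" "set E \<inter> set T = {}"
    "set E \<subseteq> {..length T} \<times> set L" "{..length T} \<times> set L \<subseteq> set T \<union> set E"
proof -
  define xs where "xs = concat (map (\<lambda>p. map (\<lambda>a. (p, a)) L) [0..<Suc (length T)])"
  have xs: "set xs = {..length T} \<times> set L" by (auto simp: xs_def image_iff)
  have "\<forall>x\<in>set xs. fst x \<le> length T" unfolding xs by auto
  from foldl_add_block[of G T, OF assms this] show ?thesis
    using that unfolding extend_def xs_def[symmetric] xs by blast
qed

lemma generic_multiplicity:
  assumes "generic G T" "\<And>m. R < G m" "x \<in> set T"
  shows "R < card {j\<in>{..<length T}. T ! j = x}"
  using assms(1,3)
proof induction
  case (block T p a)
  let ?T = "T @ replicate (G (length T)) (p, a)"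
  show ?case
  proof (cases "x \<in> set T")
    case True
    have "{j\<in>{..<length T}. T ! j = x} \<subseteq> {j\<in>{..<length ?T}. ?T ! j = x}" by (auto simp: nth_append)
    then have "card {j\<in>{..<length T}. T ! j = x} \<le> card {j\<in>{..<length ?T}. ?T ! j = x}" by (intro card_mono) auto
    then show ?thesis using block.IH[OF True] by linarith
  next
    case False
    then have x: "x = (p, a)" using block.prems by (auto split: if_splits)
    have "{length T..<length ?T} \<subseteq> {j\<in>{..<length ?T}. ?T ! j = x}" by (auto simp: nth_append x)
    then have "card {length T..<length ?T} \<le> card {j\<in>{..<length ?T}. ?T ! j = x}" by (intro card_mono) auto
    then show ?thesis using assms(2)[of "length T"] by simp
  qed
qed simp

section \<open>Distance from the root in growing lists\<close>

abbreviation "list_parent T \<equiv> parent (list_structure T)"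

lemma list_structure_append:
  assumes "j < length T" shows "list_parent (T @ E) j = list_parent T j"
  using assms by (simp add: list_structure_def nth_append)

lemma list_structure_append_funpow:
  assumes "generic G T" "j < length T"
  shows "(list_parent (T @ E) ^^ i) j = (list_parent T ^^ i) j"
proof (induction i)
  case (Suc i)
  have "(list_parent T ^^ i) j < length T"
    using down_closed_funpow[OF generic_down_closed[OF assms(1)], of j i] assms(2) by simp
  then show ?case using Suc by (simp add: list_structure_append)
qed simp

definition fixed_at :: "(nat \<times> nat) list \<Rightarrow> nat \<Rightarrow> nat \<Rightarrow> bool" where
  "fixed_at T i j \<longleftrightarrow>
     list_parent T ((list_parent T ^^ i) j) = (list_parent T ^^ i) j"

lemma fixed_at_append:
  assumes "generic G T" "j < length T" shows "fixed_at (T @ E) i j \<longleftrightarrow> fixed_at T i j"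
  using list_structure_append_funpow[OF assms, of i E] list_structure_append_funpow[OF assms, of "Suc i" E]
  by (simp add: fixed_at_def)

lemma fixed_at_Suc: "fixed_at T (Suc i) j \<longleftrightarrow> fixed_at T i (list_parent T j)"
proof -
  have "(list_parent T ^^ Suc i) j = (list_parent T ^^ i) (list_parent T j)"
    by (simp only: funpow_Suc_right comp_apply)
  then show ?thesis unfolding fixed_at_def by (simp only:)
qed

definition generic_forest :: "(nat \<Rightarrow> nat) \<Rightarrow> nat list \<Rightarrow> nat \<Rightarrow> (nat \<times> nat) list" where
  "generic_forest G L k = (extend G L ^^ k) []"

lemma generic_forest_props:
  assumes "\<And>m. 0 < G m" and T: "T = generic_forest G L k"
  shows "generic G T" (is ?A) "snd ` set T \<subseteq> set L" (is ?B) "\<forall>j<length T. \<exists>i<k. fixed_at T i j" (is ?C)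
    "\<forall>a\<in>set L. 0 < k \<longrightarrow> (0, a) \<in> set T" (is ?D)
    "\<forall>a\<in>set L. \<forall>u<length T. \<forall>i. Suc i < k \<longrightarrow> fixed_at T i u \<longrightarrow> (Suc u, a) \<in> set T" (is ?E)
proof -
  have "?A \<and> ?B \<and> ?C \<and> ?D \<and> ?E"
    unfolding T
  proof (induction k)
    case 0
    then show ?case by (auto simp: generic_forest_def intro: generic.Nil)
  next
    case (Suc r)
    define T where "T = generic_forest G L r"
    have gT: "generic G T" and sndT: "snd ` set T \<subseteq> set L" and dep: "\<And>j. j < length T \<Longrightarrow> \<exists>i<r. fixed_at T i j"
      and root: "\<And>a. a \<in> set L \<Longrightarrow> 0 < r \<Longrightarrow> (0, a) \<in> set T"
      and inner: "\<And>a u i. a \<in> set L \<Longrightarrow> u < length T \<Longrightarrow> Suc i < r \<Longrightarrow> fixed_at T i u \<Longrightarrow> (Suc u, a) \<in> set T"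
      using Suc unfolding T_def by blast+
    obtain E where E: "extend G L T = T @ E" "generic G (T @ E)" "set E \<inter> set T = {}"
      "set E \<subseteq> {..length T} \<times> set L" "{..length T} \<times> set L \<subseteq> set T \<union> set E"
      using extend_props[OF gT assms(1)] .
    have T': "generic_forest G L (Suc r) = T @ E" using E(1) by (simp add: generic_forest_def T_def)
    \<comment> \<open>A new edge carries a pair that did not occur before. The root and all edges
      above the last level have been served in earlier rounds, so new edges can only hang from the
      last level.\<close>
    have new: "(\<exists>a\<in>set L. (T @ E) ! j = (0, a) \<and> list_parent (T @ E) j = j \<and> (0, a) \<notin> set T) \<or>
        (\<exists>a\<in>set L. \<exists>q<length T. (T @ E) ! j = (Suc q, a) \<and> list_parent (T @ E) j = q \<and> (Suc q, a) \<notin> set T)"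
      if "\<not> j < length T" "j < length (T @ E)" for j
    proof -
      have "(T @ E) ! j \<in> set E" using that by (auto simp: nth_append)
      moreover obtain p a where pa: "(T @ E) ! j = (p, a)" by fastforce
      ultimately have "p \<le> length T" "a \<in> set L" "(p, a) \<notin> set T" using E(3,4) by auto
      then show ?thesis using pa by (cases p) (auto simp: list_structure_def)
    qed
    have "\<exists>i<Suc r. fixed_at (T @ E) i j" if j: "j < length (T @ E)" for j
    proof (cases "j < length T")
      case True
      then show ?thesis using dep[OF True] fixed_at_append[OF gT True] less_SucI by blast
    next
      case False
      from new[OF False j] show ?thesis
      proof (elim disjE bexE exE conjE)
        assume "list_parent (T @ E) j = j"
        then have "fixed_at (T @ E) 0 j" by (simp add: fixed_at_def)
        then show ?thesis by blast
      next
        fix q assume q: "q < length T" "list_parent (T @ E) j = q"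
        obtain i where "i < r" "fixed_at T i q" using dep[OF q(1)] by blast
        then have "fixed_at (T @ E) (Suc i) j" using q fixed_at_append[OF gT q(1)] by (simp add: fixed_at_Suc)
        then show ?thesis using \<open>i < r\<close> by blast
      qed
    qed
    moreover have "(Suc u, a) \<in> set (T @ E)"
      if a: "a \<in> set L" and u: "u < length (T @ E)" and i: "Suc i < Suc r" "fixed_at (T @ E) i u" for a u i
    proof (cases "u < length T")
      case True
      then have "(Suc u, a) \<in> {..length T} \<times> set L" using a by simp
      then show ?thesis using E(5) by (simp only: set_append) blast
    next
      \<comment> \<open>Contradictory, since a new edge u is too deep for children in this round:
        with so small an i, the pair of u would have occurred in T by \<open>root\<close> or
        \<open>inner\<close>, or u would be its own parent.\<close>
      case False
      from new[OF False u] show ?thesis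
      proof (elim disjE bexE exE conjE)
        fix b assume "b \<in> set L" "(0, b) \<notin> set T"
        then show ?thesis using root[of b] i(1) by simp
      next
        fix b q assume q: "b \<in> set L" "q < length T" "list_parent (T @ E) u = q" "(Suc q, b) \<notin> set T"
        show ?thesis
        proof (cases i)
          case 0
          then show ?thesis using i(2) q False by (simp add: fixed_at_def)
        next
          case (Suc i')
          then have "fixed_at T i' q" using i(2) q fixed_at_append[OF gT q(2)] by (simp add: fixed_at_Suc)
          then show ?thesis using inner[OF q(1,2), of i'] q(4) i(1) Suc by simp
        qed
      qed
    qed
    moreover have "snd ` set (T @ E) \<subseteq> set L" using sndT E(4) by auto
    moreover have "(0, a) \<in> set (T @ E)" if "a \<in> set L" for a
    proof -
      have "(0, a) \<in> {..length T} \<times> set L" using that by simp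
      then show ?thesis using E(5) by (simp only: set_append) blast
    qed
    ultimately show ?case unfolding T' using E(2) by blast
  qed
  then show ?A ?B ?C ?D ?E by blast+
qed

lemma forest_generic_forest:
  assumes "\<And>m. 0 < G m"
  shows "forest (set L) k (list_structure (generic_forest G L k))"
proof -
  define T where "T = generic_forest G L k"
  note props = generic_forest_props[OF assms T_def]
  have "\<exists>a\<in>set L. \<forall>b. has_label (list_structure T) b j \<longleftrightarrow> b = a" if "j < length T" for j
    using props(2) that nth_mem[OF that] by (auto simp: list_structure_def image_subset_iff)
  then show ?thesis
    using props(1,3) generic_down_closed[OF props(1)]
    unfolding T_def[symmetric] forest_def fixed_at_def
    by (simp add: list_structure_def)
qed

lemma saturated_generic_forest:
  assumes G: "\<And>m. R < G m"
  shows "saturated R (set L) k (list_structure (generic_forest G L k))"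
proof -
  define T where "T = generic_forest G L k"
  have G0: "0 < G m" for m using G[of m] by simp
  note props = generic_forest_props[OF G0 T_def]
  have mult: "R < card {x\<in>universe (list_structure T). P x}"
    if "(p, a) \<in> set T" "\<And>j. j < length T \<Longrightarrow> T ! j = (p, a) \<Longrightarrow> P j" for p a P
  proof -
    have "{j\<in>{..<length T}. T ! j = (p, a)} \<subseteq> {x\<in>universe (list_structure T). P x}"
      using that(2) by (auto simp: list_structure_def)
    then have "card {j\<in>{..<length T}. T ! j = (p, a)} \<le> card {x\<in>universe (list_structure T). P x}"
      by (intro card_mono) (simp_all add: list_structure_def)
    then show ?thesis using generic_multiplicity[OF props(1) G that(1)] by linarith
  qed
  show ?thesis
    unfolding saturated_def T_def[symmetric]
  proof (intro conjI ballI allI impI)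
    fix a assume "a \<in> set L" "0 < k"
    then have "(0, a) \<in> set T" using props(4) by blast
    then show "R < card {x\<in>universe (list_structure T). list_parent T x = x \<and> (\<forall>b. has_label (list_structure T) b x \<longleftrightarrow> b = a)}"
      by (rule mult) (auto simp: list_structure_def)
  next
    fix a u i assume "a \<in> set L" "u \<in> universe (list_structure T)" "Suc i < k"
      "list_parent T ((list_parent T ^^ i) u) = (list_parent T ^^ i) u"
    then have "(Suc u, a) \<in> set T" using props(5) by (simp add: fixed_at_def list_structure_def)
    then show "R < card {x\<in>universe (list_structure T). list_parent T x = u \<and> (\<forall>b. has_label (list_structure T) b x \<longleftrightarrow> b = a)}"
      by (rule mult) (auto simp: list_structure_def)
  qed
qed

text \<open>Put K = M * 2 ^ m. The ratio of \<open>x choose Suc p\<close> to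
  \<open>x choose p\<close> is (x - p) / (p + 1), and x at least R + R * (K * R + 1) makes it at
  least K * R + 1 for all p < R. One factor K * R + 1 then beats K times a sum of at most R smaller
  binomial coefficients. The second R in \<open>2 * R\<close> makes up for the \<open>x + R\<close>
  in \<open>fast_growing\<close>.\<close>

definition growth :: "nat \<Rightarrow> nat \<Rightarrow> nat \<Rightarrow> nat" where
  "growth R M m = Suc (2 * R + R * Suc (M * 2 ^ m * R))"

lemma fast_growing_growth: "fast_growing R M (growth R M)"
  unfolding fast_growing_def
proof (intro conjI allI impI)
  fix m x q assume x: "growth R M m \<le> x + R" and q: "0 < q" "q \<le> R"
  define K where "K = M * 2 ^ m"
  have xR: "R + R * Suc (K * R) \<le> x" using x by (simp add: growth_def K_def)
  have step: "Suc (K * R) * (x choose p) \<le> x choose Suc p" if p: "Suc p \<le> R" for p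
  proof -
    have "Suc p * Suc (K * R) \<le> x - p"
      using mult_le_mono1[OF p, of "Suc (K * R)"] p xR by linarith
    then have "Suc p * (Suc (K * R) * (x choose p)) \<le> (x - p) * (x choose p)"
      using mult_le_mono1[of "Suc p * Suc (K * R)" "x - p" "x choose p"] by (simp only: mult.assoc)
    also have "\<dots> = Suc p * (x choose Suc p)"
      by (simp only: binomial_absorb_comp binomial_absorption)
    finally show ?thesis by (simp only: mult_le_cancel1 zero_less_Suc simp_thms)
  qed
  have mono: "x choose p \<le> x choose (p + i)" if "p + i \<le> R" for p i
    using that
  proof (induction i)
    case (Suc i)
    have "x choose (p + i) \<le> Suc (K * R) * (x choose (p + i))" by simp
    also have "\<dots> \<le> x choose Suc (p + i)" using Suc by (intro step) simp
    finally show ?case using Suc by simp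
  qed simp
  obtain q' where q': "q = Suc q'" using q(1) by (cases q) auto
  have "(\<Sum>p<q. x choose p) \<le> (\<Sum>p<q. x choose q')"
  proof (rule sum_mono)
    fix p assume "p \<in> {..<q}"
    then show "x choose p \<le> x choose q'" using mono[of p "q' - p"] q q' by simp
  qed
  also have "\<dots> \<le> R * (x choose q')" using q(2) by simp
  finally have "K * (\<Sum>p<q. x choose p) \<le> K * R * (x choose q')" by (simp add: mult.assoc)
  also have "\<dots> < Suc (K * R) * (x choose q')"
  proof -
    have "q' \<le> x" using q q' xR by simp
    then show ?thesis by simp
  qed
  also have "\<dots> \<le> x choose q" unfolding q' using q q' by (intro step) simp
  finally show "M * 2 ^ m * (\<Sum>p<q. x choose p) < x choose q" by (simp add: K_def)
next
  show "R < growth R M m" for m by (simp add: growth_def)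
qed

section \<open>Rooted trees\<close>

lemma tree_parent_unique:
  assumes "rooted_tree V R r" "(u, v) \<in> R" "(u', v) \<in> R" shows "u = u'"
proof -
  have "v \<in> V - {r}" using assms by (auto simp: rooted_tree_def)
  then have "\<exists>!u. (u, v) \<in> R" using assms(1) by (simp add: rooted_tree_def)
  then show ?thesis using assms(2,3) by blast
qed

lemma tree_reach:
  assumes "rooted_tree V R r" "v \<in> V" shows "\<exists>m. (r, v) \<in> R ^^ m"
proof -
  have "(r, v) \<in> R\<^sup>*" using assms by (simp add: rooted_tree_def)
  then show ?thesis by (rule rtrancl_imp_relpow)
qed

lemma tree_depth_unique:
  assumes "rooted_tree V R r" "(r, v) \<in> R ^^ m" "(r, v) \<in> R ^^ m'" shows "m = m'"
  using assms(2,3)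
proof (induction m arbitrary: v m')
  case 0
  then have "v = r" by simp
  then show ?case using 0(2) assms(1) by (cases m') (auto simp: rooted_tree_def)
next
  case (Suc m)
  then obtain u where u: "(r, u) \<in> R ^^ m" "(u, v) \<in> R" by auto
  then have "v \<noteq> r" using assms(1) by (auto simp: rooted_tree_def)
  then obtain m'' where m'': "m' = Suc m''" using Suc.prems(2) by (cases m') auto
  then obtain u' where u': "(r, u') \<in> R ^^ m''" "(u', v) \<in> R" using Suc.prems(2) by auto
  then have "u' = u" using tree_parent_unique[OF assms(1)] u by blast
  then show ?case using Suc.IH[OF u(1)] u'(1) m'' by simp
qed

lemma tree_relpow_in: "rooted_tree V R r \<Longrightarrow> (r, v) \<in> R ^^ m \<Longrightarrow> v \<in> V"
  by (cases m) (auto simp: rooted_tree_def)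

text \<open>Each node has only one depth, so there are at most as many depths as nodes. Finiteness
  is what gives \<open>Max\<close> in \<open>tree_height\<close> its meaning.\<close>

lemma tree_finite_depths:
  assumes "rooted_tree V R r" shows "finite {m. \<exists>v. P v \<and> (r, v) \<in> R ^^ m}"
proof (rule finite_subset)
  show "{m. \<exists>v. P v \<and> (r, v) \<in> R ^^ m} \<subseteq> (\<lambda>v. THE m. (r, v) \<in> R ^^ m) ` V"
  proof
    fix m assume "m \<in> {m. \<exists>v. P v \<and> (r, v) \<in> R ^^ m}"
    then obtain v where v: "(r, v) \<in> R ^^ m" by blast
    have the: "(THE m. (r, v) \<in> R ^^ m) = m"
      by (rule the_equality[where P = "\<lambda>m. (r, v) \<in> R ^^ m", OF v tree_depth_unique[OF assms _ v]])
    show "m \<in> (\<lambda>v. THE m. (r, v) \<in> R ^^ m) ` V"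
    proof (rule image_eqI)
      show "m = (THE m. (r, v) \<in> R ^^ m)" using the by simp
      show "v \<in> V" using tree_relpow_in[OF assms v] .
    qed
  qed
  have "finite V" using assms by (simp add: rooted_tree_def)
  then show "finite ((\<lambda>v. THE m. (r, v) \<in> R ^^ m) ` V)" by (rule finite_imageI)
qed

text \<open>A deepest descendant of v is a leaf. The height is defined through paths to leaves, and
  this makes it a bound for all paths from the root.\<close>

lemma tree_leaf_below:
  assumes "rooted_tree V R r" "(r, v) \<in> R ^^ m"
  shows "\<exists>m' v'. m \<le> m' \<and> (r, v') \<in> R ^^ m' \<and> (\<forall>w. (v', w) \<notin> R)"
proof -
  define S where "S = {m'. \<exists>v'. (v, v') \<in> R\<^sup>* \<and> (r, v') \<in> R ^^ m'}"
  have S: "finite S" "m \<in> S" using tree_finite_depths[OF assms(1)] assms(2) by (auto simp: S_def)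
  then have "Max S \<in> S" by (intro Max_in) auto
  then obtain v' where v': "(v, v') \<in> R\<^sup>*" "(r, v') \<in> R ^^ Max S" by (auto simp: S_def)
  have "(v', w) \<notin> R" for w
  proof
    assume "(v', w) \<in> R"
    then have "Suc (Max S) \<in> S" using v' by (auto simp: S_def intro: rtrancl_into_rtrancl)
    then have "Suc (Max S) \<le> Max S" by (rule Max_ge[OF S(1)])
    then show False by simp
  qed
  then show ?thesis using v'(2) Max_ge[OF S] by blast
qed

lemma tree_path_le:
  assumes "rooted_tree V R r" "(r, v) \<in> R ^^ m" shows "m \<le> tree_height R r"
proof -
  obtain m' v' where v': "m \<le> m'" "(r, v') \<in> R ^^ m'" "\<forall>w. (v', w) \<notin> R"
    using tree_leaf_below[OF assms] by blast
  have "finite {m. \<exists>v. (r, v) \<in> R ^^ m \<and> (\<forall>w. (v, w) \<notin> R)}"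
    by (rule finite_subset[OF _ tree_finite_depths[OF assms(1), of "\<lambda>_. True"]]) blast
  then have "m' \<le> tree_height R r" unfolding tree_height_def using v' by (intro Max_ge) blast+
  then show ?thesis using v'(1) by simp
qed

lemma tree_height_le:
  assumes "rooted_tree V R r" "\<And>v m. (r, v) \<in> R ^^ m \<Longrightarrow> m \<le> k" shows "tree_height R r \<le> k"
proof -
  let ?S = "{m. \<exists>v. (r, v) \<in> R ^^ m \<and> (\<forall>w. (v, w) \<notin> R)}"
  have "finite ?S"
    by (rule finite_subset[OF _ tree_finite_depths[OF assms(1), of "\<lambda>_. True"]]) blast
  moreover have "?S \<noteq> {}" using tree_leaf_below[OF assms(1), of r 0] by auto
  ultimately have "tree_height R r \<in> ?S" unfolding tree_height_def by (rule Max_in)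
  then show ?thesis using assms(2) by blast
qed

lemma forest_edge_rep:
  assumes "t \<in> labelled_trees k \<Sigma>" shows "forest \<Sigma> k (edge_rep t)"
proof -
  define V R r where "V = tree_nodes t" and "R = tree_edges t" and "r = tree_root t"
  have t: "rooted_tree V R r" "tree_height R r \<le> k" "edge_label t ` R \<subseteq> \<Sigma>"
    using assms by (auto simp: labelled_trees_def V_def R_def r_def)
  have sub: "R \<subseteq> V \<times> V" "finite V" using t(1) by (auto simp: rooted_tree_def)
  have U: "universe (edge_rep t) = R" by (simp add: edge_rep_def R_def)
  have par_root: "parent (edge_rep t) (r, v) = (r, v)" for v by (simp add: edge_rep_def r_def)
  have par: "parent (edge_rep t) (u, v) = (w, u)" if "(w, u) \<in> R" for u v w
  proof -
    have "u \<noteq> r" using t(1) that by (auto simp: rooted_tree_def)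
    moreover have "(THE e'. e' \<in> R \<and> snd e' = u) = (w, u)"
    proof (rule the_equality)
      show "(w, u) \<in> R \<and> snd (w, u) = u" using that by simp
      fix e' assume "e' \<in> R \<and> snd e' = u"
      then have "(fst e', u) \<in> R" "e' = (fst e', u)" by (auto simp: prod_eq_iff)
      then show "e' = (w, u)" using tree_parent_unique[OF t(1) that, of "fst e'"] by simp
    qed
    ultimately show ?thesis by (simp add: edge_rep_def r_def R_def)
  qed
  have inv: "parent (edge_rep t) e \<in> R" if "e \<in> R" for e
  proof (cases "fst e = r")
    case True
    then show ?thesis using that par_root[of "snd e"] by (cases e) simp
  next
    case False
    then have "fst e \<in> V - {r}" using sub that by auto
    then have "\<exists>!w. (w, fst e) \<in> R" using t(1) by (simp add: rooted_tree_def)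
    then obtain w where "(w, fst e) \<in> R" by blast
    then show ?thesis using par[of w "fst e" "snd e"] by simp
  qed
  have fixed: "fst ((parent (edge_rep t) ^^ m) (u, v)) = r" if "(r, u) \<in> R ^^ m" for m u v
    using that
  proof (induction m arbitrary: u v)
    case (Suc m)
    then obtain w where w: "(r, w) \<in> R ^^ m" "(w, u) \<in> R" by auto
    have "(parent (edge_rep t) ^^ Suc m) (u, v) = (parent (edge_rep t) ^^ m) (w, u)"
      using par[OF w(2)] by (simp only: funpow_Suc_right comp_apply)
    then show ?case using Suc.IH[OF w(1)] by (simp only:)
  qed simp
  \<comment> \<open>An edge whose upper node has depth m ends at depth m + 1, which is at most k,
    and m parent steps lead from it to an edge leaving the root.\<close>
  have dep: "\<exists>i<k. parent (edge_rep t) ((parent (edge_rep t) ^^ i) e) = (parent (edge_rep t) ^^ i) e" if "e \<in> R" for e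
  proof -
    obtain u v where e: "e = (u, v)" by fastforce
    have "u \<in> V" using that sub e by auto
    then obtain m where m: "(r, u) \<in> R ^^ m" using tree_reach[OF t(1)] by blast
    then have "(r, v) \<in> R ^^ Suc m" using that e by auto
    then have "Suc m \<le> tree_height R r" by (rule tree_path_le[OF t(1)])
    then have "Suc m \<le> k" using t(2) by simp
    moreover have "parent (edge_rep t) ((parent (edge_rep t) ^^ m) e) = (parent (edge_rep t) ^^ m) e"
      using fixed[OF m, of v] par_root by (cases "(parent (edge_rep t) ^^ m) e") (simp add: e)
    ultimately show ?thesis by (intro exI[of _ m]) simp
  qed
  have finR: "finite R" using finite_subset[OF sub(1)] sub(2) by simp
  have lab: "\<exists>a\<in>\<Sigma>. \<forall>b. has_label (edge_rep t) b e \<longleftrightarrow> b = a" if "e \<in> R" for e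
  proof (rule bexI[of _ "edge_label t e"])
    show "\<forall>b. has_label (edge_rep t) b e \<longleftrightarrow> b = edge_label t e" by (auto simp: edge_rep_def)
    show "edge_label t e \<in> \<Sigma>" using t(3) that by (simp add: image_subset_iff)
  qed
  have "down_closed (edge_rep t) R" using inv U by (simp add: down_closed_def image_subset_iff)
  then show ?thesis
    unfolding forest_def U using finR dep lab by simp
qed

text \<open>Node 0 is the root and node \<open>Suc j\<close> the lower end of edge j. With this
  numbering the first component of \<open>T ! j\<close> is literally the upper node of edge j. It is
  smaller than \<open>Suc j\<close>, so descending from any node reaches 0.\<close>

lemma list_structure_realised:
  assumes gen: "generic G T" and \<Sigma>: "snd ` set T \<subseteq> \<Sigma>" and dep: "\<forall>j<length T. \<exists>i<k. fixed_at T i j"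
  obtains A h where "A \<in> E_class k \<Sigma>" "local_iso (list_structure T) A {..<length T} h" "h ` {..<length T} = universe A"
proof -
  define h where "h j = (fst (T ! j), Suc j)" for j
  define R where "R = h ` {..<length T}"
  define t where "t = \<lparr>tree_nodes = {..length T}, tree_edges = R, tree_root = 0, edge_label = (\<lambda>e. snd (T ! (snd e - 1)))\<rparr>"
  have lt: "fst (T ! j) \<le> j" if "j < length T" for j using generic_fst[OF gen that] .
  have Rm: "(u, v) \<in> R \<longleftrightarrow> (\<exists>j<length T. v = Suc j \<and> u = fst (T ! j))" for u v
    by (auto simp: R_def h_def)
  have reach: "(0, v) \<in> R\<^sup>*" if "v \<le> length T" for v
    using that
  proof (induction v rule: less_induct)
    case (less v)
    show ?case
    proof (cases v)
      case (Suc j)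
      then have "(fst (T ! j), v) \<in> R" using less.prems Rm by auto
      moreover have "(0, fst (T ! j)) \<in> R\<^sup>*" using less.IH[of "fst (T ! j)"] lt[of j] Suc less.prems by simp
      ultimately show ?thesis by simp
    qed simp
  qed
  have rt: "rooted_tree {..length T} R 0"
    unfolding rooted_tree_def
  proof (intro conjI ballI allI)
    show "R \<subseteq> {..length T} \<times> {..length T}"
    proof
      fix e assume "e \<in> R"
      then obtain j where "j < length T" "e = (fst (T ! j), Suc j)" by (auto simp: R_def h_def)
      then show "e \<in> {..length T} \<times> {..length T}" using lt[of j] by simp
    qed
    fix v assume "v \<in> {..length T} - {0}"
    then obtain j where "v = Suc j" "j < length T" by (cases v) auto
    then have "(u, v) \<in> R \<longleftrightarrow> u = fst (T ! j)" for u by (auto simp: Rm)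
    then show "\<exists>!u. (u, v) \<in> R" by simp
  next
    show "(u, 0) \<notin> R" for u by (simp add: Rm)
    show "(0, v) \<in> R\<^sup>*" if "v \<in> {..length T}" for v using reach that by simp
  qed simp_all
  \<comment> \<open>If i parent steps lead from edge j to an edge leaving the root, the path from
    the root to node \<open>Suc j\<close> has at most i + 1 edges.\<close>
  have path: "m \<le> Suc i" if "(0, Suc j) \<in> R ^^ m" "fixed_at T i j" for m i j
    using that
  proof (induction i arbitrary: j m)
    case 0
    then obtain m' where m': "m = Suc m'" by (cases m) auto
    then obtain p where p: "(0, p) \<in> R ^^ m'" "(p, Suc j) \<in> R" using 0(1) by auto
    then have "j < length T" "p = fst (T ! j)" using Rm by auto
    moreover from this have "p = 0"
      using 0(2) lt[of j] by (cases p) (auto simp: fixed_at_def list_structure_def split: nat.splits)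
    ultimately have "m' = 0" using p(1) tree_depth_unique[OF rt, of 0 m' 0] by simp
    then show ?case using m' by simp
  next
    case (Suc i)
    then obtain m' where m': "m = Suc m'" by (cases m) auto
    then obtain p where p: "(0, p) \<in> R ^^ m'" "(p, Suc j) \<in> R" using Suc(2) by auto
    then have j: "j < length T" "p = fst (T ! j)" using Rm by auto
    show ?case
    proof (cases p)
      case 0
      then show ?thesis using p(1) tree_depth_unique[OF rt, of 0 m' 0] m' by simp
    next
      case (Suc q)
      then have "fixed_at T i q" using \<open>fixed_at T (Suc i) j\<close> j by (simp add: fixed_at_Suc list_structure_def)
      then show ?thesis using Suc.IH[of q m'] p(1) Suc m' by simp
    qed
  qed
  have height: "tree_height R 0 \<le> k"
  proof (rule tree_height_le[OF rt])
    fix v m assume vm: "(0, v) \<in> R ^^ m"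
    show "m \<le> k"
    proof (cases v)
      case 0
      then show ?thesis using tree_depth_unique[OF rt, of 0 m 0] vm by simp
    next
      case (Suc j)
      then have "j < length T" using tree_relpow_in[OF rt vm] by simp
      then obtain i where "i < k" "fixed_at T i j" using dep by blast
      then show ?thesis using path[of j m i] vm Suc by simp
    qed
  qed
  have "edge_label t (h j) \<in> \<Sigma>" if "j < length T" for j
  proof -
    have "snd (T ! j) \<in> snd ` set T" using that by simp
    then show ?thesis using \<Sigma> by (simp add: t_def h_def subset_iff)
  qed
  then have "edge_label t ` R \<subseteq> \<Sigma>" by (auto simp: R_def)
  then have "t \<in> labelled_trees k \<Sigma>"
    using rt height by (simp add: labelled_trees_def t_def)
  then have tE: "edge_rep t \<in> E_class k \<Sigma>" by (simp add: E_class_def)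
  have U: "universe (edge_rep t) = R" by (simp add: edge_rep_def t_def)
  have forest: "down_closed (edge_rep t) (universe (edge_rep t))"
    using forest_edge_rep[OF \<open>t \<in> labelled_trees k \<Sigma>\<close>] by (simp add: forest_def)
  have par: "parent (edge_rep t) (h j) = h (list_parent T j)" if "j < length T" for j
  proof (cases "fst (T ! j)")
    case 0
    then show ?thesis by (simp add: edge_rep_def t_def h_def list_structure_def)
  next
    case (Suc q)
    then have "q < length T" using lt[OF that] that by simp
    then have "(THE e'. e' \<in> R \<and> snd e' = Suc q) = h q"
    proof (intro the_equality)
      show "h q \<in> R \<and> snd (h q) = Suc q" using \<open>q < length T\<close> by (simp add: R_def h_def)
      fix e' assume "e' \<in> R \<and> snd e' = Suc q"
      then show "e' = h q" by (auto simp: R_def h_def)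
    qed
    then show ?thesis using Suc by (simp add: edge_rep_def t_def h_def list_structure_def)
  qed
  have "local_iso (list_structure T) (edge_rep t) {..<length T} h"
    unfolding local_iso_def
  proof (intro conjI ballI)
    show "down_closed (list_structure T) {..<length T}" using generic_down_closed[OF gen] .
    show "inj_on h {..<length T}" by (auto simp: inj_on_def h_def)
    show "down_closed (edge_rep t) (h ` {..<length T})" using forest U by (simp add: R_def)
    fix e assume "e \<in> {..<length T}"
    then show "parent (edge_rep t) (h e) = h (list_parent T e)" using par by simp
    show "\<forall>a. has_label (edge_rep t) a (h e) = has_label (list_structure T) a e"
      by (simp add: edge_rep_def t_def h_def list_structure_def)
  qed
  then show ?thesis by (rule that[OF tE]) (simp add: U R_def)
qed

section \<open>Isomorphism of output trees\<close>

text \<open>The colours of output nodes restated for bare graphs, so that isomorphism of trees can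
  be treated without interpretations.\<close>

primrec graph_colour :: "('a \<times> 'a) set \<Rightarrow> nat \<Rightarrow> 'a \<Rightarrow> nat" where
  "graph_colour R 0 v = 0"
| "graph_colour R (Suc m) v =
     list_encode (sorted_list_of_multiset (image_mset (graph_colour R m) (mset_set (R `` {v}))))"

lemma graph_colour_Suc_eq_iff:
  "graph_colour R (Suc m) v = graph_colour R' (Suc m) w \<longleftrightarrow>
     image_mset (graph_colour R m) (mset_set (R `` {v})) = image_mset (graph_colour R' m) (mset_set (R' `` {w}))"
  by (auto simp: list_encode_eq) (metis mset_sorted_list_of_multiset)

lemma image_mset_mset_set_bij:
  assumes "finite X" "finite Y" "image_mset f (mset_set X) = image_mset g (mset_set Y)"
  shows "\<exists>h. bij_betw h X Y \<and> (\<forall>x\<in>X. g (h x) = f x)"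
  using assms
proof (induction X arbitrary: Y)
  case empty
  then have "Y = {}" by (metis image_mset_empty image_mset_is_empty_iff infinite_set_mset_mset_set mset_set.empty mset_set_empty_iff)
  then show ?case by (simp add: bij_betw_def)
next
  case (insert x X)
  then have "f x \<in># image_mset g (mset_set Y)" by (metis finite_insert finite_set_mset_mset_set image_eqI insertI1 set_image_mset)
  then obtain y where y: "y \<in> Y" "g y = f x" using insert.prems(1) by auto
  then have "mset_set Y = add_mset y (mset_set (Y - {y}))" using insert.prems(1) by (simp add: mset_set.remove)
  then have "image_mset f (mset_set X) = image_mset g (mset_set (Y - {y}))" using insert y by simp
  then obtain h where h: "bij_betw h X (Y - {y})" "\<forall>x\<in>X. g (h x) = f x"
    using insert.IH[of "Y - {y}"] insert.prems(1) by auto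
  have eq: "(h(x := y)) z = h z" if "z \<in> X" for z using that insert.hyps by auto
  have "bij_betw (h(x := y)) X (Y - {y})" using h(1) bij_betw_cong[of X "h(x := y)" h] eq by blast
  moreover have "bij_betw (h(x := y)) {x} {y}" by (simp add: bij_betw_def)
  ultimately have "bij_betw (h(x := y)) (X \<union> {x}) ((Y - {y}) \<union> {y})" by (rule bij_betw_combine) auto
  moreover have "(Y - {y}) \<union> {y} = Y" using y(1) by auto
  ultimately have "bij_betw (h(x := y)) (insert x X) Y" by simp
  moreover have "\<forall>z\<in>insert x X. g ((h(x := y)) z) = f z" using h(2) y(2) eq by auto
  ultimately show ?case by blast
qed

lemma mset_set_image_colour:
  assumes "inj_on h X" "\<And>x. x \<in> X \<Longrightarrow> g (h x) = f x"
  shows "image_mset g (mset_set (h ` X)) = image_mset f (mset_set X)"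
proof -
  have "image_mset g (mset_set (h ` X)) = image_mset g (image_mset h (mset_set X))"
    using image_mset_mset_set[OF assms(1)] by simp
  also have "\<dots> = image_mset (\<lambda>x. g (h x)) (mset_set X)" by (simp add: image_mset.compositionality comp_def)
  also have "\<dots> = image_mset f (mset_set X)"
  proof (cases "finite X")
    case True
    then show ?thesis using assms(2) by (intro image_mset_cong) simp
  qed simp
  finally show ?thesis .
qed

lemma graph_colour_iso:
  assumes "bij_betw h V V'" "R \<subseteq> V \<times> V" "R' \<subseteq> V' \<times> V'" "\<forall>x\<in>V. \<forall>y\<in>V. (x, y) \<in> R \<longleftrightarrow> (h x, h y) \<in> R'"
  shows "v \<in> V \<Longrightarrow> graph_colour R' m (h v) = graph_colour R m v"
proof (induction m arbitrary: v)
  case (Suc m)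
  have "R' `` {h v} = h ` (R `` {v})"
  proof
    show "h ` (R `` {v}) \<subseteq> R' `` {h v}" using assms Suc.prems by auto
    show "R' `` {h v} \<subseteq> h ` (R `` {v})"
    proof
      fix w assume "w \<in> R' `` {h v}"
      then have w: "(h v, w) \<in> R'" by simp
      then have "w \<in> h ` V" using assms(1,3) by (auto simp: bij_betw_def)
      then obtain u where "u \<in> V" "w = h u" by blast
      then show "w \<in> h ` (R `` {v})" using assms(4) Suc.prems w by auto
    qed
  qed
  moreover have "inj_on h (R `` {v})" using assms(1,2) by (auto simp: bij_betw_def intro: inj_on_subset)
  ultimately have "image_mset (graph_colour R' m) (mset_set (R' `` {h v})) = image_mset (graph_colour R m) (mset_set (R `` {v}))"
    using mset_set_image_colour[of h "R `` {v}" "graph_colour R' m" "graph_colour R m"] Suc.IH assms(2) by auto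
  then show ?case by simp
qed simp

lemma tree_no_cycle:
  assumes "rooted_tree V R r" "v \<in> V" shows "(v, v) \<notin> R\<^sup>+"
proof
  assume "(v, v) \<in> R\<^sup>+"
  then obtain l where l: "l > 0" "(v, v) \<in> R ^^ l" using trancl_power by metis
  obtain m where m: "(r, v) \<in> R ^^ m" using tree_reach[OF assms] by blast
  then have "(r, v) \<in> R ^^ (m + l)" using l(2) by (auto simp: relpow_add)
  then have "m = m + l" by (rule tree_depth_unique[OF assms(1) m])
  then show False using l(1) by simp
qed

text \<open>The ancestors of a common descendant form a chain, so one of z and z' would lie below
  the other. Then y, the unique parent of the lower one, would lie below the upper one, which is a
  child of y: a cycle.\<close>

lemma tree_disjoint_subtrees:
  assumes t: "rooted_tree V R r" and "(y, z) \<in> R" "(y, z') \<in> R" "z \<noteq> z'"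
  shows "R\<^sup>* `` {z} \<inter> R\<^sup>* `` {z'} = {}"
proof (rule ccontr)
  assume "R\<^sup>* `` {z} \<inter> R\<^sup>* `` {z'} \<noteq> {}"
  then obtain v where v: "(v, z) \<in> (R\<inverse>)\<^sup>*" "(v, z') \<in> (R\<inverse>)\<^sup>*" by (auto simp: rtrancl_converse)
  have "single_valued (R\<inverse>)" using tree_parent_unique[OF t] by (auto simp: single_valued_def)
  then have "(z, z') \<in> R\<^sup>* \<or> (z', z) \<in> R\<^sup>*"
    using single_valued_confluent[OF _ v] by (auto simp: rtrancl_converse)
  moreover have no: False if ab: "(a, b) \<in> R\<^sup>*" "a \<noteq> b" and "(y, a) \<in> R" "(y, b) \<in> R" for a b
  proof -
    obtain c where "(a, c) \<in> R\<^sup>*" "(c, b) \<in> R" using ab by (auto elim: rtranclE)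
    then have "(a, y) \<in> R\<^sup>*" using tree_parent_unique[OF t _ that(4)] by blast
    then have "(y, y) \<in> R\<^sup>+" using that(3) by (meson rtrancl_into_trancl2)
    moreover have "y \<in> V" using t that(3) by (auto simp: rooted_tree_def)
    ultimately show False using tree_no_cycle[OF t] by blast
  qed
  ultimately show False using assms(2-4) no[of z z'] no[of z' z] by blast
qed

lemma subtree_decompose: "R\<^sup>* `` {y} = {y} \<union> (\<Union>z\<in>R `` {y}. R\<^sup>* `` {z})"
  by (auto intro: converse_rtrancl_into_rtrancl elim: converse_rtranclE)

text \<open>Equality of the multisets of colours gives a bijection between the children of y and y'
  that preserves colours one level down. The isomorphisms of the child subtrees, which are pairwise
  disjoint, are glued along it.\<close>

lemma subtree_iso:
  assumes t: "rooted_tree V R r" and t': "rooted_tree V' R' r'"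
    and "y \<in> V" "y' \<in> V'"
    and "\<forall>l z. (y, z) \<in> R ^^ l \<longrightarrow> l \<le> m" "\<forall>l z. (y', z) \<in> R' ^^ l \<longrightarrow> l \<le> m"
    and "graph_colour R m y = graph_colour R' m y'"
  shows "\<exists>h. bij_betw h (R\<^sup>* `` {y}) (R'\<^sup>* `` {y'}) \<and> h y = y' \<and>
    (\<forall>u\<in>R\<^sup>* `` {y}. \<forall>v\<in>R\<^sup>* `` {y}. (u, v) \<in> R \<longleftrightarrow> (h u, h v) \<in> R')"
  using assms(3-)
proof (induction m arbitrary: y y')
  case 0
  have no: "(y, z) \<notin> R" "(y', z') \<notin> R'" for z z'
    using 0(3)[rule_format, of z 1] 0(4)[rule_format, of z' 1] by auto
  have "R\<^sup>* `` {y} = {y}" "R'\<^sup>* `` {y'} = {y'}"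
    using no by (auto elim: converse_rtranclE)
  then show ?case using no by (intro exI[of _ "\<lambda>_. y'"]) (auto simp: bij_betw_def)
next
  case (Suc m)
  let ?S = "\<lambda>z. R\<^sup>* `` {z}" and ?S' = "\<lambda>z. R'\<^sup>* `` {z}"
  have sub: "R \<subseteq> V \<times> V" "R' \<subseteq> V' \<times> V'" "finite V" "finite V'" using t t' by (auto simp: rooted_tree_def)
  let ?X = "R `` {y}" and ?X' = "R' `` {y'}"
  have fin: "finite ?X" "finite ?X'"
    using finite_subset[of ?X V] finite_subset[of ?X' V'] sub by auto
  obtain \<pi> where \<pi>: "bij_betw \<pi> ?X ?X'" "\<forall>z\<in>?X. graph_colour R' m (\<pi> z) = graph_colour R m z"
    using image_mset_mset_set_bij[OF fin] Suc.prems(5)[unfolded graph_colour_Suc_eq_iff] by blast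
  have \<pi>in: "\<pi> z \<in> ?X'" if "z \<in> ?X" for z using \<pi>(1) that by (auto simp: bij_betw_def)
  have "\<exists>h. bij_betw h (?S z) (?S' (\<pi> z)) \<and> h z = \<pi> z \<and>
      (\<forall>u\<in>?S z. \<forall>v\<in>?S z. (u, v) \<in> R \<longleftrightarrow> (h u, h v) \<in> R')" if z: "z \<in> ?X" for z
  proof (rule Suc.IH)
    show "z \<in> V" "\<pi> z \<in> V'" using z \<pi>in[OF z] sub by auto
    show "\<forall>l x. (z, x) \<in> R ^^ l \<longrightarrow> l \<le> m"
    proof (intro allI impI)
      fix l x assume "(z, x) \<in> R ^^ l"
      then have "(y, x) \<in> R ^^ Suc l" using z by (meson Image_singleton_iff relpow_Suc_I2)
      then show "l \<le> m" using Suc.prems(3) by blast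
    qed
    show "\<forall>l x. (\<pi> z, x) \<in> R' ^^ l \<longrightarrow> l \<le> m"
    proof (intro allI impI)
      fix l x assume "(\<pi> z, x) \<in> R' ^^ l"
      then have "(y', x) \<in> R' ^^ Suc l" using \<pi>in[OF z] by (meson Image_singleton_iff relpow_Suc_I2)
      then show "l \<le> m" using Suc.prems(4) by blast
    qed
    show "graph_colour R m z = graph_colour R' m (\<pi> z)" using \<pi>(2) z by simp
  qed
  then obtain H where H: "\<And>z. z \<in> ?X \<Longrightarrow> bij_betw (H z) (?S z) (?S' (\<pi> z))"
    "\<And>z. z \<in> ?X \<Longrightarrow> H z z = \<pi> z"
    "\<And>z u v. z \<in> ?X \<Longrightarrow> u \<in> ?S z \<Longrightarrow> v \<in> ?S z \<Longrightarrow> (u, v) \<in> R \<longleftrightarrow> (H z u, H z v) \<in> R'"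
    by metis
  have disj: "?S z \<inter> ?S z' = {}" if "z \<in> ?X" "z' \<in> ?X" "z \<noteq> z'" for z z'
    using tree_disjoint_subtrees[OF t] that by simp
  have disj': "?S' z \<inter> ?S' z' = {}" if "z \<in> ?X'" "z' \<in> ?X'" "z \<noteq> z'" for z z'
    using tree_disjoint_subtrees[OF t'] that by simp
  have ynot: "(z, y) \<notin> R\<^sup>*" if "z \<in> ?X" for z
  proof
    assume "(z, y) \<in> R\<^sup>*"
    then have "(y, y) \<in> R\<^sup>+" using that by (meson Image_singleton_iff rtrancl_into_trancl2)
    then show False using tree_no_cycle[OF t Suc.prems(1)] by blast
  qed
  have ynot': "(z, y') \<notin> R'\<^sup>*" if "z \<in> ?X'" for z
  proof
    assume "(z, y') \<in> R'\<^sup>*"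
    then have "(y', y') \<in> R'\<^sup>+" using that by (meson Image_singleton_iff rtrancl_into_trancl2)
    then show False using tree_no_cycle[OF t' Suc.prems(2)] by blast
  qed
  define top where "top u = (THE z. z \<in> ?X \<and> u \<in> ?S z)" for u
  have top: "top u = z" if "z \<in> ?X" "u \<in> ?S z" for u z
    unfolding top_def using disj that by (intro the_equality) blast+
  define h where "h u = (if u = y then y' else H (top u) u)" for u
  have hy: "h y = y'" by (simp add: h_def)
  have hz: "h u = H z u" if "z \<in> ?X" "u \<in> ?S z" for u z
    using that ynot top[OF that] by (auto simp: h_def)
  have hin: "h u \<in> ?S' (\<pi> z)" if "z \<in> ?X" "u \<in> ?S z" for u z
    using hz[OF that] H(1)[OF that(1)] that(2) bij_betwE by metis
  have bij_z: "bij_betw h (?S z) (?S' (\<pi> z))" if "z \<in> ?X" for z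
    using H(1)[OF that] bij_betw_cong[of "?S z" h "H z"] hz[OF that] by blast
  have \<pi>inj: "\<pi> z \<noteq> \<pi> z'" if "z \<in> ?X" "z' \<in> ?X" "z \<noteq> z'" for z z'
    using \<pi>(1) that by (auto simp: bij_betw_def dest: inj_onD)
  have "bij_betw h (\<Union>z\<in>?X. ?S z) (\<Union>z\<in>?X. ?S' (\<pi> z))"
    unfolding bij_betw_def
  proof
    show "inj_on h (\<Union>z\<in>?X. ?S z)"
    proof (rule inj_onI)
      fix u v assume "u \<in> (\<Union>z\<in>?X. ?S z)" "v \<in> (\<Union>z\<in>?X. ?S z)" and eq: "h u = h v"
      then obtain z z' where zz: "z \<in> ?X" "u \<in> ?S z" "z' \<in> ?X" "v \<in> ?S z'" by blast
      have "z = z'"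
      proof (rule ccontr)
        assume "z \<noteq> z'"
        then have "?S' (\<pi> z) \<inter> ?S' (\<pi> z') = {}" using disj' \<pi>in \<pi>inj zz by blast
        then show False using hin[OF zz(1,2)] hin[OF zz(3,4)] eq by auto
      qed
      then show "u = v" using bij_z[OF zz(1)] zz eq by (auto simp: bij_betw_def dest: inj_onD)
    qed
    show "h ` (\<Union>z\<in>?X. ?S z) = (\<Union>z\<in>?X. ?S' (\<pi> z))"
      unfolding image_UN using bij_z by (intro SUP_cong refl) (simp add: bij_betw_def)
  qed
  moreover have "(\<Union>z\<in>?X. ?S' (\<pi> z)) = (\<Union>z\<in>?X'. ?S' z)"
    by (subst bij_betw_imp_surj_on[OF \<pi>(1), symmetric]) simp
  ultimately have UN: "bij_betw h (\<Union>z\<in>?X. ?S z) (\<Union>z\<in>?X'. ?S' z)" by simp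
  have "bij_betw h {y} {y'}" by (simp add: bij_betw_def hy)
  moreover have "{y'} \<inter> (\<Union>z\<in>?X'. ?S' z) = {}" using ynot' by auto
  ultimately have "bij_betw h ({y} \<union> (\<Union>z\<in>?X. ?S z)) ({y'} \<union> (\<Union>z\<in>?X'. ?S' z))"
    using bij_betw_combine[OF _ UN] by blast
  then have bij: "bij_betw h (?S y) (?S' y')"
    unfolding subtree_decompose[of R y] subtree_decompose[of R' y'] .
  have edge: "(u, v) \<in> R \<longleftrightarrow> (h u, h v) \<in> R'" if uy: "u \<in> ?S y" and vy: "v \<in> ?S y" for u v
  proof (cases "v = y")
    case True
    have "(u, y) \<notin> R"
    proof
      assume "(u, y) \<in> R"
      then have "(y, y) \<in> R\<^sup>+" using that(1) by (auto intro: rtrancl_into_trancl1)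
      then show False using tree_no_cycle[OF t Suc.prems(1)] by blast
    qed
    moreover have "(h u, y') \<notin> R'"
    proof
      assume "(h u, y') \<in> R'"
      moreover have "h u \<in> ?S' y'" using bij that(1) bij_betwE by metis
      ultimately have "(y', y') \<in> R'\<^sup>+" by (auto intro: rtrancl_into_trancl1)
      then show False using tree_no_cycle[OF t' Suc.prems(2)] by blast
    qed
    ultimately show ?thesis using True hy by simp
  next
    case False
    then obtain z where z: "z \<in> ?X" "v \<in> ?S z" using vy subtree_decompose[of R y] by blast
    have hv: "h v \<in> ?S' (\<pi> z)" using hin[OF z] .
    show ?thesis
    proof (cases "u = y")
      case True
      have "(y, v) \<in> R \<longleftrightarrow> v = z"
      proof
        assume v: "(y, v) \<in> R"
        show "v = z"
        proof (rule ccontr)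
          assume "v \<noteq> z"
          then show False using disj[of v z] v z by auto
        qed
      qed (use z in simp)
      moreover have "(y', h v) \<in> R' \<longleftrightarrow> h v = \<pi> z"
      proof
        assume v: "(y', h v) \<in> R'"
        show "h v = \<pi> z"
        proof (rule ccontr)
          assume "h v \<noteq> \<pi> z"
          then show False using disj'[of "h v" "\<pi> z"] v hv \<pi>in[OF z(1)] by auto
        qed
      qed (use \<pi>in[OF z(1)] in simp)
      moreover have "h v = \<pi> z \<longleftrightarrow> v = z"
      proof -
        have "h z = \<pi> z" using hz[OF z(1), of z] H(2)[OF z(1)] by simp
        moreover have "z \<in> ?S z" by simp
        ultimately show ?thesis using bij_z[OF z(1)] z(2) by (metis bij_betw_def inj_onD)
      qed
      ultimately show ?thesis using True hy by simp
    next
      case False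
      then obtain z' where z': "z' \<in> ?X" "u \<in> ?S z'" using uy subtree_decompose[of R y] by blast
      show ?thesis
      proof (cases "z = z'")
        case True
        then show ?thesis using H(3)[OF z(1) _ z(2)] z' hz[OF z] hz[OF z'] by simp
      next
        case False
        have "(u, v) \<notin> R"
        proof
          assume "(u, v) \<in> R"
          then have "v \<in> ?S z'" using z'(2) by auto
          then show False using disj[OF z(1) z'(1) False] z(2) by blast
        qed
        moreover have "(h u, h v) \<notin> R'"
        proof
          assume "(h u, h v) \<in> R'"
          then have "h v \<in> ?S' (\<pi> z')" using hin[OF z'] by auto
          then show False
            using disj'[OF \<pi>in[OF z(1)] \<pi>in[OF z'(1)] \<pi>inj[OF z(1) z'(1) False]] hv by blast
        qed
        ultimately show ?thesis by simp
      qed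
    qed
  qed
  show ?case using bij hy edge by blast
qed

text \<open>The colours of all nodes are compared rather than those of the roots, because an
  interpretation does not single out the root of its output. The multiset on each side is what the
  colour of the additional output node encodes.\<close>

lemma unlabelled_trees_isomorphic_iff:
  assumes "(V, R) \<in> unlabelled_trees n" "(V', R') \<in> unlabelled_trees n"
  shows "graph_isomorphic (V, R) (V', R') \<longleftrightarrow>
    image_mset (graph_colour R n) (mset_set V) = image_mset (graph_colour R' n) (mset_set V')"
proof -
  obtain r r' where t: "rooted_tree V R r" "tree_height R r \<le> n" and t': "rooted_tree V' R' r'" "tree_height R' r' \<le> n"
    using assms by (auto simp: unlabelled_trees_def)
  have sub: "R \<subseteq> V \<times> V" "R' \<subseteq> V' \<times> V'" and fin: "finite V" "finite V'"
    and r: "r \<in> V" "r' \<in> V'" and reach: "\<And>v. v \<in> V \<Longrightarrow> (r, v) \<in> R\<^sup>*" "\<And>v. v \<in> V' \<Longrightarrow> (r', v) \<in> R'\<^sup>*"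
    using t(1) t'(1) by (auto simp: rooted_tree_def)
  have height: "\<forall>l z. (y, z) \<in> S ^^ l \<longrightarrow> l \<le> n" if tS: "rooted_tree U S s" and hS: "tree_height S s \<le> n" and yU: "y \<in> U"
    for U and S :: "('c \<times> 'c) set" and s y
  proof (intro allI impI)
    fix l z assume l: "(y, z) \<in> S ^^ l"
    obtain m where "(s, y) \<in> S ^^ m" using tree_reach[OF tS yU] by blast
    then have "(s, z) \<in> S ^^ (m + l)" using l by (auto simp: relpow_add)
    then have "m + l \<le> tree_height S s" by (rule tree_path_le[OF tS])
    then show "l \<le> n" using hS by simp
  qed
  have clo: "S\<^sup>* `` {y} \<subseteq> U" if "S \<subseteq> U \<times> U" "y \<in> U" for U and S :: "('c \<times> 'c) set" and y
  proof
    fix z assume "z \<in> S\<^sup>* `` {y}"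
    then have "(y, z) \<in> S\<^sup>*" by simp
    then show "z \<in> U" using that by (induction rule: rtrancl_induct) auto
  qed
  show ?thesis
  proof
    assume "graph_isomorphic (V, R) (V', R')"
    then obtain h where h: "bij_betw h V V'" "\<forall>x\<in>V. \<forall>y\<in>V. (x, y) \<in> R \<longleftrightarrow> (h x, h y) \<in> R'"
      by (auto simp: graph_isomorphic_def)
    have "V' = h ` V" "inj_on h V" using h(1) by (auto simp: bij_betw_def)
    then show "image_mset (graph_colour R n) (mset_set V) = image_mset (graph_colour R' n) (mset_set V')"
      using mset_set_image_colour[of h V "graph_colour R' n" "graph_colour R n"]
        graph_colour_iso[OF h(1) sub h(2)] by simp
  next
    assume eq: "image_mset (graph_colour R n) (mset_set V) = image_mset (graph_colour R' n) (mset_set V')"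
    have sets: "graph_colour R n ` V = graph_colour R' n ` V'"
      using arg_cong[OF eq, of set_mset] fin by simp
    have cards: "card V = card V'" using arg_cong[OF eq, of size] by simp
    \<comment> \<open>Equality of multisets only provides some node \<open>y'\<close> with the
      colour of the root r. Its subtree is isomorphic to the first tree, so it has as many nodes as
      \<open>V'\<close> and is all of \<open>V'\<close>.\<close>
    obtain y' where y': "y' \<in> V'" "graph_colour R n r = graph_colour R' n y'" using sets r(1) by blast
    obtain h where h: "bij_betw h (R\<^sup>* `` {r}) (R'\<^sup>* `` {y'})"
      "\<forall>u\<in>R\<^sup>* `` {r}. \<forall>v\<in>R\<^sup>* `` {r}. (u, v) \<in> R \<longleftrightarrow> (h u, h v) \<in> R'"
      using subtree_iso[OF t(1) t'(1) r(1) y'(1) height[OF t r(1)] height[OF t' y'(1)] y'(2)] by blast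
    have V: "R\<^sup>* `` {r} = V" using clo[OF sub(1) r(1)] reach(1) by auto
    have "card (R'\<^sup>* `` {y'}) = card V'" using bij_betw_same_card[OF h(1)] V cards by simp
    then have "R'\<^sup>* `` {y'} = V'" using card_subset_eq[OF fin(2) clo[OF sub(2) y'(1)]] by simp
    then show "graph_isomorphic (V, R) (V', R')"
      using h V by (auto simp: graph_isomorphic_def)
  qed
qed

section \<open>The decision procedure as a functional program\<close>

text \<open>The quotient is the number of positive multiples of the divisor up to the dividend.
  Division serves to read the bits of a coded alphabet.\<close>

lemma computable_div [comp_intros]:
  fixes f g :: "_ \<Rightarrow> nat"
  assumes "computable f" "computable g" shows "computable (\<lambda>x. f x div g x)"
proof -
  have *: "m div n = (if n = 0 then 0 else length (filter (\<lambda>i. Suc i * n \<le> m) [0..<m]))" for m n :: nat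
  proof (cases "n = 0")
    case False
    then have "i < m \<and> Suc i * n \<le> m \<longleftrightarrow> i < m div n" for i
    proof -
      have "Suc i \<le> m div n \<longleftrightarrow> Suc i * n \<le> m" using False by (simp add: less_eq_div_iff_mult_less_eq)
      moreover have "m div n \<le> m" by simp
      ultimately show ?thesis by linarith
    qed
    then have "{i. i < m \<and> Suc i * n \<le> m} = {..<m div n}" by blast
    then have "length (filter (\<lambda>i. Suc i * n \<le> m) [0..<m]) = m div n"
      by (simp add: length_filter_conv_card cong: conj_cong)
    then show ?thesis using False by simp
  qed simp
  have g: "computable (\<lambda>p. g (fst p))" using compose_fst[OF assms(2)] .
  have f: "computable (\<lambda>p. f (fst p))" using compose_fst[OF assms(1)] .
  show ?thesis unfolding * by (intro comp_intros assms f g)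
qed

lemma computable_even [comp_intros]:
  fixes f :: "_ \<Rightarrow> nat" assumes "computable f" shows "computable (\<lambda>x. even (f x))"
proof -
  have "even m \<longleftrightarrow> m - 2 * (m div 2) = 0" for m :: nat by presburger
  then show ?thesis by (simp only:) (intro comp_intros assms)
qed

text \<open>Takes the place of structural recursion on terms and formulas, which the program sees
  only as numbers: G receives the values at all smaller codes, among them those of the immediate
  subterms.\<close>

fun course_of_values :: "('a \<Rightarrow> nat \<Rightarrow> 'b list \<Rightarrow> 'b) \<Rightarrow> 'a \<Rightarrow> nat \<Rightarrow> 'b" where
  "course_of_values G x c = G x c (map (course_of_values G x) [0..<c])"

declare course_of_values.simps [simp del]

lemma computable_course_of_values:
  fixes G :: "'a::coded \<Rightarrow> nat \<Rightarrow> 'b::coded list \<Rightarrow> 'b"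
  assumes G: "computable (\<lambda>p. G (fst p) (fst (snd p)) (snd (snd p)))" and "computable p" "computable n"
  shows "computable (\<lambda>x. course_of_values G (p x) (n x))"
proof -
  let ?h = "course_of_values G"
  have hist: "map (?h x) [0..<m] = rec_nat [] (\<lambda>i l. l @ [G x i l]) m" for x m
  proof (induction m)
    case (Suc m)
    then show ?case using course_of_values.simps[of G x m] by simp
  qed simp
  have "computable (\<lambda>q. map (?h (fst q)) [0..<snd q])"
    unfolding hist
    by (intro comp_intros computable_compose[OF G, of "\<lambda>p. (fst (fst p), snd p)", simplified])
  then have "computable (\<lambda>q. G (fst q) (snd q) (map (?h (fst q)) [0..<snd q]))"
    using computable_compose[OF G, of "\<lambda>q. (fst q, snd q, map (?h (fst q)) [0..<snd q])"]
    by (simp add: comp_intros)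
  then have "computable (\<lambda>q. ?h (fst q) (snd q))" by (simp only: course_of_values.simps[symmetric])
  from computable_compose[OF this, of "\<lambda>x. (p x, n x)"] show ?thesis
    by (simp add: comp_intros assms)
qed

lemma nth_course_of_values:
  "r < c \<Longrightarrow> hd (drop r (map (course_of_values G x) [0..<c])) = course_of_values G x r"
  by (simp add: hd_drop_conv_nth)

text \<open>Makes the code of a subterm smaller than that of the term. Tag 0 is a true exception,
  since \<open>prod_encode (0, 0) = 0\<close>; it belongs to \<open>Var\<close> and
  \<open>TrueF\<close>, where no recursion takes place.\<close>

lemma less_prod_encode: "0 < t \<Longrightarrow> m < prod_encode (t, m)"
proof -
  have "n \<le> triangle n" for n by (induction n) auto
  from this[of "t + m"] show "0 < t \<Longrightarrow> m < prod_encode (t, m)" by (simp add: prod_encode_def)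
qed

section \<open>Evaluation of coded terms and formulas\<close>

definition tm_step :: "(nat \<times> nat) list \<times> nat list \<Rightarrow> nat \<Rightarrow> nat list \<Rightarrow> nat" where
  "tm_step q c l = (if fst (prod_decode c) = 0 then hd (drop (snd (prod_decode c)) (snd q))
     else case fst (hd (drop (hd (drop (snd (prod_decode c)) l)) (fst q))) of
       0 \<Rightarrow> hd (drop (snd (prod_decode c)) l) | Suc u \<Rightarrow> u)"

definition tm_eval :: "(nat \<times> nat) list \<times> nat list \<Rightarrow> nat \<Rightarrow> nat" where
  "tm_eval = course_of_values tm_step"

lemma computable_tm_eval [comp_intros]:
  "computable q \<Longrightarrow> computable c \<Longrightarrow> computable (\<lambda>x. tm_eval (q x) (c x))"
  unfolding tm_eval_def
  by (rule computable_course_of_values) (unfold tm_step_def, intro comp_intros)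

lemma tm_eval_Par:
  "tm_eval q (prod_encode (1, m)) = (case fst (hd (drop (tm_eval q m) (fst q))) of 0 \<Rightarrow> tm_eval q m | Suc u \<Rightarrow> u)"
  unfolding tm_eval_def
  by (subst course_of_values.simps) (simp add: tm_step_def nth_course_of_values less_prod_encode split: nat.split)

lemma tm_eval_encode:
  assumes gen: "generic G T" and xs: "set xs \<subseteq> {..<length T}" and "tm_vars s \<subseteq> {..<length xs}"
  shows "tm_eval (T, xs) (tm_encode s) = tm_val (list_structure T) xs s"
  using assms(3)
proof (induction s)
  case (Var p)
  then show ?case by (simp add: tm_eval_def course_of_values.simps tm_step_def hd_drop_conv_nth)
next
  case (Par s)
  define u where "u = tm_val (list_structure T) xs s"
  have "u < length T"
    using Par.prems tm_val_in[OF generic_down_closed[OF gen] xs] by (simp add: u_def)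
  moreover have "tm_eval (T, xs) (tm_encode s) = u" using Par by (simp add: u_def)
  moreover have "tm_val (list_structure T) xs (Par s) = list_parent T u" by (simp add: u_def)
  ultimately show ?case
    using tm_eval_Par[of "(T, xs)" "tm_encode s"] by (simp add: list_structure_def hd_drop_conv_nth del: tm_val.simps split: nat.split)
qed

definition sat_step :: "(nat \<times> nat) list \<times> nat list \<Rightarrow> nat \<Rightarrow> bool list \<Rightarrow> bool" where
  "sat_step q c l =
    (if fst (prod_decode c) = 0 then True
     else if fst (prod_decode c) = 1 then
       snd (hd (drop (tm_eval q (snd (prod_decode (snd (prod_decode c))))) (fst q))) = fst (prod_decode (snd (prod_decode c)))
     else if fst (prod_decode c) = 2 then
       tm_eval q (fst (prod_decode (snd (prod_decode c)))) = tm_eval q (snd (prod_decode (snd (prod_decode c))))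
     else if fst (prod_decode c) = 3 then \<not> hd (drop (snd (prod_decode c)) l)
     else if fst (prod_decode c) = 4 then
       hd (drop (fst (prod_decode (snd (prod_decode c)))) l) \<and> hd (drop (snd (prod_decode (snd (prod_decode c)))) l)
     else
       hd (drop (fst (prod_decode (snd (prod_decode c)))) l) \<or> hd (drop (snd (prod_decode (snd (prod_decode c)))) l))"

definition sat :: "(nat \<times> nat) list \<Rightarrow> nat list \<Rightarrow> qf \<Rightarrow> bool" where
  "sat T xs \<phi> = course_of_values sat_step (T, xs) (enc \<phi>)"

lemma computable_sat [comp_intros]:
  assumes "computable T" "computable xs" "computable \<phi>" shows "computable (\<lambda>x. sat (T x) (xs x) (\<phi> x))"
  unfolding sat_def
  by (rule computable_course_of_values) (unfold sat_step_def, (intro comp_intros assms)+)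

lemma sat_iff:
  assumes gen: "generic G T" and xs: "set xs \<subseteq> {..<length T}" and "qf_vars \<phi> \<subseteq> {..<length xs}"
  shows "sat T xs \<phi> \<longleftrightarrow> qf_sat (list_structure T) xs \<phi>"
  using assms(3)
proof (induction \<phi>)
  case TrueF
  then show ?case by (simp add: sat_def course_of_values.simps sat_step_def)
next
  case (LabelF a s)
  then have "tm_val (list_structure T) xs s \<in> {..<length T}"
    using tm_val_in[OF generic_down_closed[OF gen] xs] by simp
  then show ?case using LabelF tm_eval_encode[OF gen xs]
    by (simp add: sat_def course_of_values.simps sat_step_def list_structure_def hd_drop_conv_nth)
next
  case (EqF s s')
  then show ?case using tm_eval_encode[OF gen xs]
    by (simp add: sat_def course_of_values.simps sat_step_def)
next
  case (NotF \<phi>)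
  then show ?case
    by (simp add: sat_def course_of_values.simps[of _ _ "prod_encode _"] sat_step_def nth_course_of_values less_prod_encode)
next
  case (AndF \<phi> \<psi>)
  have "qf_encode \<phi> < prod_encode (4, prod_encode (qf_encode \<phi>, qf_encode \<psi>))"
    "qf_encode \<psi> < prod_encode (4, prod_encode (qf_encode \<phi>, qf_encode \<psi>))"
    using le_prod_encode_1[of "qf_encode \<phi>" "qf_encode \<psi>"] le_prod_encode_2[of "qf_encode \<psi>" "qf_encode \<phi>"]
      less_prod_encode[of 4 "prod_encode (qf_encode \<phi>, qf_encode \<psi>)"] by simp_all
  then show ?case using AndF
    by (simp add: sat_def course_of_values.simps[of _ _ "prod_encode _"] sat_step_def nth_course_of_values)
next
  case (OrF \<phi> \<psi>)
  have "qf_encode \<phi> < prod_encode (5, prod_encode (qf_encode \<phi>, qf_encode \<psi>))"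
    "qf_encode \<psi> < prod_encode (5, prod_encode (qf_encode \<phi>, qf_encode \<psi>))"
    using le_prod_encode_1[of "qf_encode \<phi>" "qf_encode \<psi>"] le_prod_encode_2[of "qf_encode \<psi>" "qf_encode \<phi>"]
      less_prod_encode[of 5 "prod_encode (qf_encode \<phi>, qf_encode \<psi>)"] by simp_all
  then show ?case using OrF
    by (simp add: sat_def course_of_values.simps[of _ _ "prod_encode _"] sat_step_def nth_course_of_values)
qed

lemma computable_mem [comp_intros]:
  fixes f :: "_ \<Rightarrow> nat \<times> nat"
  assumes "computable f" "computable T" shows "computable (\<lambda>x. f x \<in> set (T x))"
proof -
  have "y \<in> set l \<longleftrightarrow> list_ex (\<lambda>z. fst z = fst y \<and> snd z = snd y) l" for y :: "nat \<times> nat" and l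
    by (auto simp: list_ex_iff prod_eq_iff)
  then show ?thesis
    by simp (intro comp_intros assms compose_fst[OF assms(1)])
qed

lemma computable_growth [comp_intros]:
  "computable R \<Longrightarrow> computable M \<Longrightarrow> computable m \<Longrightarrow> computable (\<lambda>x. growth (R x) (M x) (m x))"
  unfolding growth_def by (intro comp_intros)

lemma computable_add_block [comp_intros]:
  "computable R \<Longrightarrow> computable M \<Longrightarrow> computable T \<Longrightarrow> computable y \<Longrightarrow>
    computable (\<lambda>x. add_block (growth (R x) (M x)) (T x) (y x))"
  unfolding add_block_def by (intro comp_intros)

lemma computable_extend [comp_intros]:
  assumes "computable R" "computable M" "computable L" "computable T"
  shows "computable (\<lambda>x. extend (growth (R x) (M x)) (L x) (T x))"
proof -
  note f = compose_fst[OF assms(1)] compose_fst[OF assms(2)] compose_fst[OF assms(3)]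
  show ?thesis unfolding extend_def by (intro comp_intros assms f)
qed

lemma computable_generic_forest [comp_intros]:
  assumes "computable R" "computable M" "computable L" "computable k"
  shows "computable (\<lambda>x. generic_forest (growth (R x) (M x)) (L x) (k x))"
proof -
  have eq: "generic_forest G L k = rec_nat [] (\<lambda>i T. extend G L T) k" for G L k
    unfolding generic_forest_def by (induction k) simp_all
  note f = compose_fst[OF assms(1)] compose_fst[OF assms(2)] compose_fst[OF assms(3)]
  show ?thesis unfolding eq by (intro comp_intros assms f)
qed

section \<open>Computation of the colours of all output nodes\<close>

type_synonym interp_lists = "(nat \<times> qf) list \<times> qf list list"

definition output_nodes :: "(nat \<times> nat) list \<Rightarrow> interp_lists \<Rightarrow> (nat \<times> nat list) list" where
  "output_nodes T F = concat (map (\<lambda>j. map (\<lambda>ys. (j, ys))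
     (filter (\<lambda>ys. sat T ys (snd (hd (drop j (fst F))))) (List.n_lists (fst (hd (drop j (fst F)))) [0..<length T])))
     [0..<length (fst F)])"

text \<open>All nodes are recoloured at once from a table of the previous colours, so the colours at
  depth n arise by plain iteration. Sorting produces the same canonical list as the definition of
  colours, hence the same number.\<close>

definition recolour ::
    "(nat \<times> nat) list \<Rightarrow> interp_lists \<Rightarrow> ((nat \<times> nat list) \<times> nat) list \<Rightarrow> ((nat \<times> nat list) \<times> nat) list" where
  "recolour T F tab = map (\<lambda>v. (fst v, enc (sort (map (\<lambda>w. snd w)
     (filter (\<lambda>w. sat T (snd (fst v) @ snd (fst w)) (hd (drop (fst (fst w)) (hd (drop (fst (fst v)) (snd F)))))) tab))))) tab"

definition output_colours :: "(nat \<times> nat) list \<Rightarrow> nat \<Rightarrow> interp_lists \<Rightarrow> nat list" where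
  "output_colours T n F = sort (map (\<lambda>v. snd v)
     (rec_nat (map (\<lambda>v. (v, 0)) (output_nodes T F)) (\<lambda>i tab. recolour T F tab) n))"

lemma computable_output_nodes [comp_intros]:
  assumes "computable T" "computable F" shows "computable (\<lambda>x. output_nodes (T x) (F x))"
proof -
  note f = compose_fst[OF assms(1)] compose_fst[OF assms(2)]
    compose_fst[OF compose_fst[OF assms(1)]] compose_fst[OF compose_fst[OF assms(2)]]
  show ?thesis unfolding output_nodes_def by (intro comp_intros assms f)
qed

lemma computable_recolour [comp_intros]:
  assumes "computable T" "computable F" "computable tab" shows "computable (\<lambda>x. recolour (T x) (F x) (tab x))"
proof -
  note f = compose_fst[OF assms(1)] compose_fst[OF assms(2)] compose_fst[OF assms(3)]
    compose_fst[OF compose_fst[OF assms(1)]] compose_fst[OF compose_fst[OF assms(2)]]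
  show ?thesis unfolding recolour_def by (intro comp_intros assms f)
qed

lemma computable_output_colours [comp_intros]:
  assumes "computable T" "computable n" "computable F" shows "computable (\<lambda>x. output_colours (T x) (n x) (F x))"
proof -
  note f = compose_fst[OF assms(1)] compose_fst[OF assms(3)]
  show ?thesis unfolding output_colours_def by (intro comp_intros assms f)
qed

text \<open>The code c of the instance serves as a bound on the numbers and dimensions of components.\<close>

definition decide :: "nat \<times> nat \<times> nat \<times> nat \<times> interp_lists \<times> interp_lists \<Rightarrow> bool" where
  "decide = (\<lambda>(c, s, k, n, F, F').
     let R = 5 * c * k;
         T = generic_forest (growth R (c * Suc R ^ c)) (filter (\<lambda>a. odd (s div 2 ^ a)) [0..<s]) k
     in enc (output_colours T n F) = enc (output_colours T n F'))"

lemma computable_decide: "computable decide"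
  unfolding decide_def Let_def case_prod_beta by (intro comp_intros)

section \<open>Correctness\<close>

lemma children_graph:
  assumes "(i, xs) \<in> output_universe p A"
  shows "children A (p, i, xs) = Pair p ` (snd (apply_interpretation p A) `` {(i, xs)})"
  using assms by (auto simp: children_def apply_interpretation_def output_universe_def)

lemma children_root: "children A (p, length (components p), xs) = Pair p ` output_universe p A"
  by (auto simp: children_def)

lemma colour_graph:
  "(i, xs) \<in> output_universe p A \<Longrightarrow>
     colour A m (p, i, xs) = graph_colour (snd (apply_interpretation p A)) m (i, xs)"
proof (induction m arbitrary: i xs)
  case (Suc m)
  let ?R = "snd (apply_interpretation p A)"
  have "y \<in> output_universe p A" if "y \<in> ?R `` {(i, xs)}" for y
    using that by (auto simp: apply_interpretation_def)
  then have "image_mset (colour A m) (mset_set (Pair p ` (?R `` {(i, xs)}))) =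
      image_mset (graph_colour ?R m) (mset_set (?R `` {(i, xs)}))"
    using Suc.IH by (intro mset_set_image_colour) (auto simp: inj_on_def)
  then show ?case by (simp add: children_graph[OF Suc.prems])
qed simp

lemma image_mset_colour_graph:
  "image_mset (colour A n) (mset_set (Pair p ` output_universe p A)) =
     image_mset (graph_colour (snd (apply_interpretation p A)) n) (mset_set (output_universe p A))"
  using colour_graph by (intro mset_set_image_colour) (auto simp: inj_on_def)

lemma colour_root_eq_iff:
  assumes "apply_interpretation f A \<in> unlabelled_trees n" "apply_interpretation g A \<in> unlabelled_trees n"
  shows "colour A (Suc n) (f, length (components f), []) = colour A (Suc n) (g, length (components g), []) \<longleftrightarrow>
    graph_isomorphic (apply_interpretation f A) (apply_interpretation g A)"
proof -
  have fst_eq: "fst (apply_interpretation p A) = output_universe p A" for p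
    by (simp add: apply_interpretation_def)
  have pair: "(output_universe p A, snd (apply_interpretation p A)) = apply_interpretation p A" for p
    by (simp add: apply_interpretation_def)
  show ?thesis
    using unlabelled_trees_isomorphic_iff[of "fst (apply_interpretation f A)" "snd (apply_interpretation f A)" n
        "fst (apply_interpretation g A)" "snd (apply_interpretation g A)"] assms
    unfolding colour_Suc_eq_iff children_root image_mset_colour_graph by (simp add: fst_eq pair)
qed

lemma colour_global_iso:
  assumes h: "local_iso A A' (universe A) h" "h ` universe A = universe A'"
  shows "onode d A v \<Longrightarrow> colour A' m (map_node h v) = colour A m v"
proof (induction m arbitrary: v)
  case (Suc m)
  have inj: "inj_on h (universe A)" using h(1) by (simp add: local_iso_def)
  have ent: "entries w \<subseteq> universe A" if "w \<in> children A v" for w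
    using onode_entries[OF onode_children[OF Suc.prems that]] .
  have "children A' (map_node h v) = map_node h ` children A v"
  proof
    show "map_node h ` children A v \<subseteq> children A' (map_node h v)"
      using map_node_children[OF h(1) onode_entries[OF Suc.prems] ent Suc.prems] by blast
    show "children A' (map_node h v) \<subseteq> map_node h ` children A v"
    proof
      fix y assume y: "y \<in> children A' (map_node h v)"
      have "onode d A' (map_node h v)" using onode_map_node[OF h(1) onode_entries[OF Suc.prems] Suc.prems] .
      then have ys: "entries y \<subseteq> h ` universe A" using onode_entries[OF onode_children[OF _ y]] h(2) by simp
      define z where "z = map_node (inv_into (universe A) h) y"
      have z: "map_node h z = y"
        unfolding z_def map_node_comp using ys by (intro map_node_ident) (simp add: f_inv_into_f subset_iff)
      have "entries z \<subseteq> universe A" using ys inv_into_into[of _ h "universe A"] by (auto simp: z_def)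
      then have "z \<in> children A v"
        using map_node_children[OF h(1) onode_entries[OF Suc.prems] _ Suc.prems, of z] y z by simp
      then show "y \<in> map_node h ` children A v" using z by blast
    qed
  qed
  moreover have "inj_on (map_node h) (children A v)"
    by (rule inj_onI) (use map_node_inj[OF inj] ent in blast)
  ultimately have "image_mset (colour A' m) (mset_set (children A' (map_node h v))) = image_mset (colour A m) (mset_set (children A v))"
    using mset_set_image_colour[of "map_node h" "children A v" "colour A' m" "colour A m"] Suc.IH onode_children[OF Suc.prems]
    by simp
  then show ?case by simp
qed simp

lemma output_nodes_correct:
  assumes gen: "generic G T" and wf: "wf_interpretation \<Sigma> p"
  shows "set (output_nodes T (components p, child_formulas p)) = output_universe p (list_structure T)"
    and "distinct (output_nodes T (components p, child_formulas p))"
proof -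
  let ?F = "(components p, child_formulas p)"
  define blk where "blk j = map (\<lambda>ys. (j, ys))
     (filter (\<lambda>ys. sat T ys (snd (hd (drop j (fst ?F))))) (List.n_lists (fst (hd (drop j (fst ?F)))) [0..<length T]))" for j
  have nodes: "output_nodes T ?F = concat (map blk [0..<length (components p)])"
    unfolding output_nodes_def blk_def[abs_def] by simp
  have blk: "set (blk j) = {(j, ys) | ys. length ys = dimension p j \<and> set ys \<subseteq> {..<length T} \<and>
      qf_sat (list_structure T) ys (universe_formula p j)}" if j: "j < length (components p)" for j
  proof -
    have comp: "hd (drop j (fst ?F)) = (dimension p j, universe_formula p j)"
      using j by (simp add: hd_drop_conv_nth dimension_def universe_formula_def)
    have "sat T ys (universe_formula p j) \<longleftrightarrow> qf_sat (list_structure T) ys (universe_formula p j)"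
      if "length ys = dimension p j" "set ys \<subseteq> {..<length T}" for ys
      using wf that j by (intro sat_iff[OF gen]) (auto simp: wf_interpretation_def Let_def)
    moreover have "{0..<length T} = {..<length T}" by auto
    ultimately have "{ys. (length ys = dimension p j \<and> set ys \<subseteq> {0..<length T}) \<and> sat T ys (universe_formula p j)} =
        {ys. length ys = dimension p j \<and> set ys \<subseteq> {..<length T} \<and> qf_sat (list_structure T) ys (universe_formula p j)}"
      by auto
    then show ?thesis unfolding blk_def comp by (auto simp: set_n_lists)
  qed
  show "set (output_nodes T ?F) = output_universe p (list_structure T)"
    unfolding nodes using blk by (auto simp: output_universe_def list_structure_def)
  have db: "distinct (blk j)" for j
    by (simp add: blk_def distinct_map inj_on_def distinct_n_lists)
  have fb: "fst v = j" if "v \<in> set (blk j)" for v j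
    using that by (auto simp: blk_def)
  have "distinct (concat (map blk [0..<m]))" for m
  proof (induction m)
    case (Suc m)
    have "set (concat (map blk [0..<m])) \<inter> set (blk m) = {}"
    proof (rule ccontr)
      assume "\<not> ?thesis"
      then obtain v j where "j < m" "v \<in> set (blk j)" "v \<in> set (blk m)" by auto
      then show False using fb[of v j] fb[of v m] by simp
    qed
    then show ?case using Suc db[of m] by simp
  qed simp
  then show "distinct (output_nodes T ?F)" unfolding nodes .
qed

lemma output_colours_correct:
  assumes gen: "generic G T" and wf: "wf_interpretation \<Sigma> p"
  defines "B \<equiv> list_structure T"
  shows "output_colours T n (components p, child_formulas p) = sorted_list_of_multiset
    (image_mset (graph_colour (snd (apply_interpretation p B)) n) (mset_set (output_universe p B)))"
proof -
  define F where "F = (components p, child_formulas p)"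
  define R where "R = snd (apply_interpretation p B)"
  define ns where "ns = output_nodes T F"
  have ns: "set ns = output_universe p B" "distinct ns"
    using output_nodes_correct[OF gen wf] by (simp_all add: ns_def F_def B_def)
  let ?q = "\<lambda>v w. sat T (snd v @ snd w) (hd (drop (fst w) (hd (drop (fst v) (snd F)))))"
  have R_iff: "(v, w) \<in> R \<longleftrightarrow> ?q v w"
    if "v \<in> set ns" "w \<in> set ns" for v w
  proof -
    obtain i xs j ys where vw: "v = (i, xs)" "w = (j, ys)" by (metis prod.collapse)
    have mem: "(i, xs) \<in> output_universe p B" "(j, ys) \<in> output_universe p B" using that ns(1) vw by auto
    then have b: "i < length (components p)" "j < length (components p)" "length xs = dimension p i" "length ys = dimension p j"
      "set xs \<subseteq> {..<length T}" "set ys \<subseteq> {..<length T}"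
      by (auto simp: output_universe_def B_def list_structure_def)
    then have "hd (drop j (hd (drop i (child_formulas p)))) = child_formula p i j"
      using wf by (simp add: wf_interpretation_def Let_def hd_drop_conv_nth child_formula_def)
    moreover have "sat T (xs @ ys) (child_formula p i j) \<longleftrightarrow> qf_sat B (xs @ ys) (child_formula p i j)"
      unfolding B_def using wf b by (intro sat_iff[OF gen]) (auto simp: wf_interpretation_def Let_def)
    ultimately show ?thesis using mem by (simp add: vw R_def apply_interpretation_def F_def)
  qed
  have "rec_nat (map (\<lambda>v. (v, 0)) ns) (\<lambda>i tab. recolour T F tab) m = map (\<lambda>v. (v, graph_colour R m v)) ns" for m
  proof (induction m)
    case (Suc m)
    have "enc (sort (map (graph_colour R m) (filter (?q v) ns)))
        = graph_colour R (Suc m) v" if v: "v \<in> set ns" for v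
    proof -
      have "filter (?q v) ns = filter (\<lambda>w. (v, w) \<in> R) ns"
        using R_iff[OF v] by (intro filter_cong) simp_all
      moreover have "mset (filter (\<lambda>w. (v, w) \<in> R) ns) = mset_set (R `` {v})"
      proof -
        have "set (filter (\<lambda>w. (v, w) \<in> R) ns) = R `` {v}"
          using ns(1) by (auto simp: R_def apply_interpretation_def)
        then show ?thesis using mset_set_set[of "filter (\<lambda>w. (v, w) \<in> R) ns"] ns(2) by simp
      qed
      ultimately have "sort (map (graph_colour R m) (filter (?q v) ns))
          = sorted_list_of_multiset (image_mset (graph_colour R m) (mset_set (R `` {v})))"
        by (simp flip: sorted_list_of_multiset_mset)
      moreover have "enc l = list_encode l" for l :: "nat list" by (induction l) auto
      ultimately show ?thesis by simp
    qed
    then show ?case using Suc by (simp add: recolour_def comp_def filter_map)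
  qed simp
  then have "output_colours T n F = sort (map (graph_colour R n) ns)"
    by (simp add: output_colours_def ns_def comp_def)
  also have "\<dots> = sorted_list_of_multiset (image_mset (graph_colour R n) (mset ns))"
    by (simp flip: sorted_list_of_multiset_mset)
  finally show ?thesis using mset_set_set[OF ns(2)] ns(1) by (simp add: F_def R_def)
qed

lemma member_le_list_encode: "x \<in> set xs \<Longrightarrow> x \<le> list_encode xs"
proof (induction xs)
  case (Cons y xs)
  then show ?case
    using le_prod_encode_1[of y "list_encode xs"] le_prod_encode_2[of "list_encode xs" y] by auto
qed simp

lemma length_le_list_encode: "length xs \<le> list_encode xs"
proof (induction xs)
  case (Cons y xs)
  then show ?case using le_prod_encode_2[of "list_encode xs" y] by simp
qed simp

lemma bounded_interp_encode:
  assumes "wf_interpretation \<Sigma> p" "interpretation_encode p \<le> c" shows "bounded_interp c p"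
proof -
  let ?l = "map (\<lambda>(d, \<phi>). prod_encode (d, qf_encode \<phi>)) (components p)"
  have "list_encode ?l \<le> interpretation_encode p"
    unfolding interpretation_encode_def by (rule le_prod_encode_1)
  then have l: "list_encode ?l \<le> c" using assms(2) by linarith
  have "dimension p j \<le> c" if "j < length (components p)" for j
  proof -
    have "(\<lambda>(d, \<phi>). prod_encode (d, qf_encode \<phi>)) (components p ! j) \<in> set ?l"
      using nth_mem[OF that] by simp
    then have "prod_encode (dimension p j, qf_encode (universe_formula p j)) \<in> set ?l"
      by (simp add: dimension_def universe_formula_def case_prod_unfold)
    then have "prod_encode (dimension p j, qf_encode (universe_formula p j)) \<le> list_encode ?l"
      by (rule member_le_list_encode)
    moreover have "dimension p j \<le> prod_encode (dimension p j, qf_encode (universe_formula p j))"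
      by (rule le_prod_encode_1)
    ultimately show ?thesis using l by linarith
  qed
  moreover have "length (components p) \<le> c" using length_le_list_encode[of ?l] l by simp
  ultimately show ?thesis using assms(1) by (auto simp: bounded_interp_def)
qed

text \<open>The promise that outputs are trees covers only members of \<open>E_class\<close>, and
  the forest B of numbered edges is not literally one. Over B only colours are compared; they are
  read as isomorphism over an input A, which is arbitrary for the one direction and a copy of B for
  the other.\<close>

lemma decide_correct:
  assumes fin: "finite \<Sigma>" and f: "qf_interpretation_into_trees k \<Sigma> n f" and g: "qf_interpretation_into_trees k \<Sigma> n g"
    and c: "interpretation_encode f \<le> c" "interpretation_encode g \<le> c"
  shows "decide (c, set_encode \<Sigma>, k, n, (components f, child_formulas f), (components g, child_formulas g)) \<longleftrightarrow>
    (\<forall>A\<in>E_class k \<Sigma>. graph_isomorphic (apply_interpretation f A) (apply_interpretation g A))"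
proof -
  define L where "L = filter (\<lambda>a. odd (set_encode \<Sigma> div 2 ^ a)) [0..<set_encode \<Sigma>]"
  define R where "R = 5 * c * k"
  define M where "M = c * Suc R ^ c"
  define T where "T = generic_forest (growth R M) L k"
  have decode: "set_decode (set_encode \<Sigma>) = \<Sigma>" using set_encode_inverse[OF fin] .
  \<comment> \<open>The program searches for elements of the alphabet below the code of the
    alphabet. None is missed, since a < 2 ^ a and 2 ^ a is a summand of the code.\<close>
  have "a < set_encode \<Sigma>" if "a \<in> \<Sigma>" for a
  proof -
    have "2 ^ a \<le> set_encode \<Sigma>"
      unfolding set_encode_def using fin that by (intro member_le_sum) auto
    then show ?thesis using less_exp[of a] by (meson less_le_trans)
  qed
  then have L: "set L = \<Sigma>" using decode by (auto simp: L_def set_decode_def)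
  have grow: "R < growth R M m" for m using fast_growing_growth[of R M] by (simp add: fast_growing_def)
  have grow0: "0 < growth R M m" for m using grow[of m] by simp
  note props = generic_forest_props[OF grow0 T_def]
  have wf: "wf_interpretation \<Sigma> f" "wf_interpretation \<Sigma> g"
    and trees: "\<And>A. A \<in> E_class k \<Sigma> \<Longrightarrow> apply_interpretation f A \<in> unlabelled_trees n"
      "\<And>A. A \<in> E_class k \<Sigma> \<Longrightarrow> apply_interpretation g A \<in> unlabelled_trees n"
    using f g by (auto simp: qf_interpretation_into_trees_def)
  have bnd: "bounded_interp c f" "bounded_interp c g" using bounded_interp_encode wf c by blast+
  interpret generic_base \<Sigma> k R M c "growth R M" T
  proof
    show "generic (growth R M) T" using props(1) .
    show "fast_growing R M (growth R M)" by (rule fast_growing_growth)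
    show "saturated R \<Sigma> k (list_structure T)" using saturated_generic_forest[OF grow, where L = L] by (simp add: L T_def)
    show "forest \<Sigma> k (list_structure T)" using forest_generic_forest[OF grow0, where L = L] by (simp add: L T_def)
  qed (simp_all add: R_def M_def)
  let ?v = "(f, length (components f), [])" and ?w = "(g, length (components g), [])"
  have D: "decide (c, set_encode \<Sigma>, k, n, (components f, child_formulas f), (components g, child_formulas g)) \<longleftrightarrow>
      colour B (Suc n) ?v = colour B (Suc n) ?w"
  proof -
    have "enc l = list_encode l" for l :: "nat list" by (induction l) auto
    then show ?thesis
      unfolding decide_def Let_def prod.case L_def[symmetric] R_def[symmetric] M_def[symmetric] T_def[symmetric]
        output_colours_correct[OF gen wf(1)] output_colours_correct[OF gen wf(2)]
      by (simp add: children_root image_mset_colour_graph)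
  qed
  have node: "onode c A ?v" "onode c A ?w" for A using bnd by (simp_all add: onode_def)
  show ?thesis
    unfolding D
  proof
    assume eq: "colour B (Suc n) ?v = colour B (Suc n) ?w"
    show "\<forall>A\<in>E_class k \<Sigma>. graph_isomorphic (apply_interpretation f A) (apply_interpretation g A)"
    proof
      fix A assume A: "A \<in> E_class k \<Sigma>"
      then have "forest \<Sigma> k A" using forest_edge_rep by (auto simp: E_class_def)
      then have cl: "reflects A (Suc n)" by (rule reflects_forest)
      \<comment> \<open>The two additional nodes have no entries, so the empty map is an embedding
        of all their parameters and they occur unchanged over B.\<close>
      have emp: "local_iso A (list_structure T) {} (\<lambda>_. 0)" by (rule local_iso_empty)
      have "colour A (Suc n) ?v = colour A (Suc n) ?w"
        using cl[unfolded reflects_def, rule_format, OF node emp] eq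
        by (simp add: entries_def map_node_def del: colour.simps)
      then show "graph_isomorphic (apply_interpretation f A) (apply_interpretation g A)"
        using colour_root_eq_iff[OF trees[OF A]] by simp
    qed
  next
    assume iso: "\<forall>A\<in>E_class k \<Sigma>. graph_isomorphic (apply_interpretation f A) (apply_interpretation g A)"
    obtain A h where A: "A \<in> E_class k \<Sigma>" "local_iso (list_structure T) A {..<length T} h" "h ` {..<length T} = universe A"
      using list_structure_realised[OF gen _ props(3)] props(2) L by metis
    have "universe B = {..<length T}" by (simp add: list_structure_def)
    then have h: "local_iso B A (universe B) h" "h ` universe B = universe A" using A(2,3) by simp_all
    have "colour A (Suc n) ?v = colour A (Suc n) ?w"
      using colour_root_eq_iff[OF trees[OF A(1)]] iso A(1) by blast
    then show "colour B (Suc n) ?v = colour B (Suc n) ?w"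
      using colour_global_iso[OF h node(1), of "Suc n"] colour_global_iso[OF h node(2), of "Suc n"]
      by (simp add: map_node_def del: colour.simps)
  qed
qed

text \<open>The coded interpretation is already a coded argument of \<open>decide\<close>, so no
  translation of formulas has to be computed.\<close>

lemma enc_interp_lists: "enc (components f, child_formulas f) = interpretation_encode f"
proof -
  have "enc = (\<lambda>(d, \<phi>). prod_encode (d, qf_encode \<phi>))" by (rule ext) auto
  moreover have "enc = (\<lambda>row. list_encode (map qf_encode row))" by (rule ext) (simp add: enc_qf_def[abs_def])
  ultimately show ?thesis by (simp add: interpretation_encode_def)
qed

theorem theorem5p1:
  "decidable_on instance_encode
     {(\<Sigma>, k, n, f, g). finite \<Sigma> \<and>
        qf_interpretation_into_trees k \<Sigma> n f \<and> qf_interpretation_into_trees k \<Sigma> n g}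
     (\<lambda>(\<Sigma>, k, n, f, g). \<forall>A\<in>E_class k \<Sigma>.
        graph_isomorphic (apply_interpretation f A) (apply_interpretation g A))"
proof -
  \<comment> \<open>Rearranges the five entries of the instance code into nested pairs and puts the
    code itself in front, where \<open>decide\<close> expects the bound on components and
    dimensions.\<close>
  define pre :: "nat list \<Rightarrow> nat \<times> nat \<times> nat \<times> nat \<times> nat \<times> nat" where
    "pre l = (enc l, hd l, hd (drop 1 l), hd (drop 2 l), hd (drop 3 l), hd (drop 4 l))" for l
  have "computable pre" unfolding pre_def by (intro comp_intros)
  then obtain r where r: "\<And>l. rec_eval r [enc l] (enc (pre l))" by (auto simp: computable_def)
  obtain s where s: "\<And>x. rec_eval s [enc x] (enc (decide x))"
    using computable_decide unfolding computable_def by blast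
  show ?thesis
    unfolding decidable_on_def
  proof (intro exI[of _ "Comp s [r]"] ballI)
    fix x :: problem_instance
    assume x: "x \<in> {(\<Sigma>, k, n, f, g). finite \<Sigma> \<and>
        qf_interpretation_into_trees k \<Sigma> n f \<and> qf_interpretation_into_trees k \<Sigma> n g}"
    obtain \<Sigma> k n f g where x': "x = (\<Sigma>, k, n, f, g)" by (metis prod_cases5)
    define l where "l = [set_encode \<Sigma>, k, n, interpretation_encode f, interpretation_encode g]"
    define y where "y = (list_encode l, set_encode \<Sigma>, k, n, (components f, child_formulas f), (components g, child_formulas g))"
    have enc_l: "enc l = list_encode l" by (simp add: l_def)
    \<comment> \<open>The two values have different types, numbers on the left and lists of formulas
      on the right, but the same code, and the code is all that the recursive function
      receives.\<close>
    have "enc (pre l) = enc y"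
      using enc_l enc_interp_lists[of f] enc_interp_lists[of g]
      by (simp add: pre_def y_def l_def numeral_2_eq_2 numeral_3_eq_3 eval_nat_numeral
          del: enc_list_def list_encode.simps)
    then have "rec_eval r [list_encode l] (enc y)" using r[of l] enc_l by simp
    then have "rec_eval (Comp s [r]) [list_encode l] (enc (decide y))"
      using s[of y] by (auto intro!: rec_eval.Comp[where ys = "[_]"])
    moreover have "decide y \<longleftrightarrow> (\<forall>A\<in>E_class k \<Sigma>. graph_isomorphic (apply_interpretation f A) (apply_interpretation g A))"
      unfolding y_def
      by (rule decide_correct) (use x in \<open>auto simp: x' l_def intro!: member_le_list_encode simp del: list_encode.simps\<close>)
    ultimately show "rec_eval (Comp s [r]) [instance_encode x]
        (if case x of (\<Sigma>, k, n, f, g) \<Rightarrow> \<forall>A\<in>E_class k \<Sigma>.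
           graph_isomorphic (apply_interpretation f A) (apply_interpretation g A) then 1 else 0)"
      by (simp add: x' l_def of_bool_def del: list_encode.simps)
  qed
qed

end
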